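(* Suppose that $\Phi:\mathbb R^d\times\mathbb R^d\to\mathbb R^k$ is a $C^\infty$ function, $k\le d$, satisfying $\operatorname{rank}(D_x\Phi)=k$ and $\operatorname{rank}(D_y\Phi)=k$ everywhere, and that the generalized Radon transforms $\mathcal R_{\vec t}$, $\vec t\in W$, associated with $\Phi$ satisfy, for some $\alpha_\Phi$ with $0\le\alpha_\Phi\le (d-k)/2$ and every $s\in\mathbb R$, $$\|\mathcal R_{\vec t}\|_{L^2_s(\mathbb R^d)\to L^2_{s+\alpha_\Phi}(\mathbb R^d)}\le C_s,$$ with $C_s$ bounded as $\vec t$ varies over $W$; equivalently, with $\beta_\Phi=\frac{d-k}{2}-\alpha_\Phi$ (so that $0\le\beta_\Phi\le (d-k)/2$), $$\|\mathcal R_{\vec t}\|_{L^2_s(\mathbb R^d)\to L^2_{s+\frac{d-k}{2}-\beta_\Phi}(\mathbb R^d)}\le C_s .$$ Then, if $E\subset\mathbb R^d$ is a compact set with $$\dim_{\mathcal H}(E)>d-\alpha_\Phi=\frac{d+k}{2}+\beta_\Phi,$$ it follows that $\Delta_\Phi(E)=\{\Phi(x,y):x,y\in E\}\subset\mathbb R^k$ has nonempty interior.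
   Context: $\dim_{\mathcal H}$ denotes Hausdorff dimension and $L^2_s(\mathbb R^d)$ the $L^2$-based Sobolev space of order $s\in\mathbb R$. Since many functions $\Phi$ of interest fail to be smooth at some points or have critical values, the domain or codomain may be restricted, so that one considers $\Phi:X\times Y\to W$ with $X,Y\subset\mathbb R^d$ and $W\subset\subset\mathbb R^k$; $W$ is the set of parameters $\vec t$. For $\vec t\in W$, let $Z_{\vec t}=\{(x,y):\Phi(x,y)=\vec t\}$, a smooth surface of codimension $k$ in $\mathbb R^d\times\mathbb R^d$, and for each $x$ let $Z_{\vec t}^x=\{y:(x,y)\in Z_{\vec t}\}$, a smooth surface of codimension $k$. For each $\vec t\in W$, a compactly supported smooth density $d\rho_{\vec t}$ on $Z_{\vec t}$ is chosen (such as the Leray density induced by $\Phi$), and the generalized Radon transform is $\mathcal R_{\vec t}f(x)=\int_{Z_{\vec t}^x}f(y)$, the integral being taken with respect to this density; that is, $\mathcal R_{\vec t}$ is the operator whose Schwartz kernel is $d\rho_{\vec t}(x,y)$, a smooth compactly supported multiple $b(x,y)\,\delta_k(\Phi(x,y)-\vec t)$, with $b\in C_0^\infty$ and $\delta_k$ the delta distribution on $\mathbb R^k$.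
   Formalization: The relation of W and the density to E is made explicit: W is open and bounded and contains Φ(E×E), and the smooth compactly supported factor b of the density does not vanish on E×E; without this (e.g. b = 0 or W empty) the claim is false. *)

theory Defs
  imports "HOL-Analysis.Analysis"
begin

section \<open>Hausdorff dimension\<close>

definition hausdorff_premeasure :: "real \<Rightarrow> real \<Rightarrow> 'a::metric_space set \<Rightarrow> ennreal" where
  "hausdorff_premeasure s \<delta> E =
     (INF U \<in> {U :: nat \<Rightarrow> 'a set. E \<subseteq> (\<Union>i. U i) \<and> (\<forall>i. bounded (U i) \<and> diameter (U i) \<le> \<delta>)}.
        \<Sum>i. ennreal (diameter (U i) powr s))"

definition hausdorff_outer :: "real \<Rightarrow> 'a::metric_space set \<Rightarrow> ennreal" where
  "hausdorff_outer s E = (SUP \<delta> \<in> {0<..}. hausdorff_premeasure s \<delta> E)"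

text \<open>Only \<open>s > 0\<close> is used, which avoids the convention \<open>0 powr 0 = 0\<close>; the infimum is the same
  as over \<open>s \<ge> 0\<close>.\<close>

definition hausdorff_dim :: "'a::metric_space set \<Rightarrow> ereal" where
  "hausdorff_dim E = (INF s \<in> {s. 0 < s \<and> hausdorff_outer s E = 0}. ereal s)"

section \<open>Smooth functions, Schwartz functions, tempered distributions\<close>

text \<open>\<open>iter_deriv [v\<^sub>1, \<dots>, v\<^sub>m] f\<close> is the iterated directional derivative of \<open>f\<close> along
  \<open>v\<^sub>m\<close>, then \<dots>, then \<open>v\<^sub>1\<close>.\<close>

fun iter_deriv :: "'a::real_normed_vector list \<Rightarrow> ('a \<Rightarrow> 'b::real_normed_vector) \<Rightarrow> 'a \<Rightarrow> 'b" where
  "iter_deriv [] f = f"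
| "iter_deriv (v # vs) f = (\<lambda>x. frechet_derivative (iter_deriv vs f) (at x) v)"

definition smooth :: "('a::real_normed_vector \<Rightarrow> 'b::real_normed_vector) \<Rightarrow> bool" where
  "smooth f \<longleftrightarrow> (\<forall>vs. iter_deriv vs f differentiable_on UNIV)"

definition test_function :: "('a::real_normed_vector \<Rightarrow> complex) \<Rightarrow> bool" where
  "test_function f \<longleftrightarrow> smooth f \<and> compact (closure {x. f x \<noteq> 0})"

definition schwartz :: "('a::euclidean_space \<Rightarrow> complex) set" where
  "schwartz = {\<phi>. smooth \<phi> \<and>
     (\<forall>vs n. bounded (range (\<lambda>x. (1 + norm x) ^ n *\<^sub>R iter_deriv vs \<phi> x)))}"

definition schwartz_seminorm :: "nat \<Rightarrow> ('a::euclidean_space \<Rightarrow> complex) \<Rightarrow> real" where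
  "schwartz_seminorm n \<phi> =
     (SUP (vs, x) \<in> {vs. set vs \<subseteq> Basis \<and> length vs \<le> n} \<times> UNIV.
        (1 + norm x) ^ n * cmod (iter_deriv vs \<phi> x))"

text \<open>A tempered distribution is represented by a functional on all functions; only its values on
  \<^const>\<open>schwartz\<close> are meaningful. The seminorms increase with \<open>n\<close>, so continuity is domination by
  a single one of them.\<close>

type_synonym 'a functional = "('a \<Rightarrow> complex) \<Rightarrow> complex"

definition tempered :: "'a::euclidean_space functional \<Rightarrow> bool" where
  "tempered u \<longleftrightarrow>
     (\<forall>\<phi>\<in>schwartz. \<forall>\<psi>\<in>schwartz. u (\<lambda>x. \<phi> x + \<psi> x) = u \<phi> + u \<psi>) \<and>
     (\<forall>\<phi>\<in>schwartz. \<forall>c. u (\<lambda>x. c * \<phi> x) = c * u \<phi>) \<and>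
     (\<exists>n C. \<forall>\<phi>\<in>schwartz. cmod (u \<phi>) \<le> C * schwartz_seminorm n \<phi>)"

section \<open>Sobolev spaces\<close>

text \<open>With this normalization of the Fourier transform, the weight below gives a norm equivalent to
  the one obtained with the kernel \<open>cis (- x \<bullet> \<xi>)\<close>.\<close>

definition fourier :: "('a::euclidean_space \<Rightarrow> complex) \<Rightarrow> 'a \<Rightarrow> complex" where
  "fourier f \<xi> = (LINT x|lborel. cis (- 2 * pi * (x \<bullet> \<xi>)) * f x)"

text \<open>The Fourier transform of the tempered distribution \<open>u\<close>, i.e. the distribution
  \<open>\<phi> \<mapsto> u (fourier \<phi>)\<close>, is the function \<open>g\<close>.\<close>

definition has_fourier_transform :: "'a::euclidean_space functional \<Rightarrow> ('a \<Rightarrow> complex) \<Rightarrow> bool" where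
  "has_fourier_transform u g \<longleftrightarrow> g \<in> borel_measurable lborel \<and>
     (\<forall>\<phi>\<in>schwartz. integrable lborel (\<lambda>\<xi>. g \<xi> * \<phi> \<xi>) \<and>
        u (fourier \<phi>) = (LINT \<xi>|lborel. g \<xi> * \<phi> \<xi>))"

definition sobolev_density :: "real \<Rightarrow> ('a::euclidean_space \<Rightarrow> complex) \<Rightarrow> 'a \<Rightarrow> real" where
  "sobolev_density s g \<xi> = (1 + (norm \<xi>)\<^sup>2) powr s * (cmod (g \<xi>))\<^sup>2"

definition sobolev :: "real \<Rightarrow> 'a::euclidean_space functional set" where
  "sobolev s = {u. tempered u \<and>
     (\<exists>g. has_fourier_transform u g \<and> integrable lborel (sobolev_density s g))}"

text \<open>The function \<open>g\<close> is determined by \<open>u\<close> up to a null set, so the choice does not matter.\<close>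

definition sobolev_norm :: "real \<Rightarrow> 'a::euclidean_space functional \<Rightarrow> real" where
  "sobolev_norm s u =
     sqrt (LINT \<xi>|lborel. sobolev_density s (SOME g. has_fourier_transform u g) \<xi>)"

definition sobolev_bounded ::
    "('a::euclidean_space functional \<Rightarrow> 'a functional) \<Rightarrow> real \<Rightarrow> real \<Rightarrow> real \<Rightarrow> bool" where
  "sobolev_bounded T s r C \<longleftrightarrow>
     (\<forall>u\<in>sobolev s. T u \<in> sobolev r \<and> sobolev_norm r (T u) \<le> C * sobolev_norm s u)"

section \<open>Generalized Radon transforms\<close>

text \<open>The pairing of \<open>\<delta>(\<Psi>(y) - t)\<close> with \<open>h\<close>, where \<open>\<delta>\<close> on the codomain is the limit of normalized
  indicator functions of small balls. If \<open>\<Psi>\<close> is a smooth submersion and \<open>h\<close> is continuous with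
  compact support, this is the integral of \<open>h\<close> over the level set \<open>\<Psi> = t\<close> with respect to the Leray
  density induced by \<open>\<Psi>\<close>.\<close>

definition delta_integral ::
    "('a::euclidean_space \<Rightarrow> 'b::euclidean_space) \<Rightarrow> 'b \<Rightarrow> ('a \<Rightarrow> complex) \<Rightarrow> complex" where
  "delta_integral \<Psi> t h = Lim (at_right 0)
     (\<lambda>r. (LINT y|lborel. indicator (ball t r) (\<Psi> y) * h y) / measure lborel (ball t r))"

text \<open>The operator with Schwartz kernel \<open>b(x, y) \<delta>(\<Phi>(x, y) - t)\<close> on functions.\<close>

definition radon_fun ::
    "('a::euclidean_space \<times> 'a \<Rightarrow> 'b::euclidean_space) \<Rightarrow> ('a \<times> 'a \<Rightarrow> complex) \<Rightarrow> 'b \<Rightarrow>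
     ('a \<Rightarrow> complex) \<Rightarrow> 'a \<Rightarrow> complex" where
  "radon_fun \<Phi> b t f x = delta_integral (\<lambda>y. \<Phi> (x, y)) t (\<lambda>y. b (x, y) * f y)"

text \<open>The extension to distributions, by duality. The transpose of \<^const>\<open>radon_fun\<close> is the operator of
  the same form with the two variables exchanged.\<close>

definition radon ::
    "('a::euclidean_space \<times> 'a \<Rightarrow> 'b::euclidean_space) \<Rightarrow> ('a \<times> 'a \<Rightarrow> complex) \<Rightarrow> 'b \<Rightarrow>
     'a functional \<Rightarrow> 'a functional" where
  "radon \<Phi> b t u = (\<lambda>\<phi>. u (radon_fun (\<Phi> \<circ> prod.swap) (b \<circ> prod.swap) t \<phi>))"

end

theory Submission
  imports Defs "HOL-Probability.Probability"
begin

text \<open>Finitely supported weights on \<open>E\<close> with Frostman growth, smoothed by Gaussians, have bounded energy in the Sobolev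
  space of order \<open>-\<alpha> / 2\<close>. By the parallelogram law, smoothed weights \<open>f\<^sub>n\<close> of almost minimal energy form a Cauchy
  sequence in that space. The bound for the Radon transforms with \<open>s = -\<alpha> / 2\<close> therefore makes the functions
  \<open>t \<mapsto> \<langle>R\<^sub>t f\<^sub>n, f\<^sub>n\<rangle>\<close> uniformly Cauchy on \<open>W\<close>. Each of them is continuous, because \<open>\<Phi>\<close> is a submersion, so their limit \<open>\<nu>\<close> is
  continuous on \<open>W\<close>. It vanishes off \<open>\<Phi> ` (E \<times> E)\<close>, and once \<open>E\<close> is localized so that \<open>b\<close> is nearly constant, its integral is
  not zero. Hence \<open>{t \<in> W. \<nu> t \<noteq> 0}\<close> is a nonempty open subset of \<open>\<Phi> ` (E \<times> E)\<close>.\<close>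

section \<open>Gaussian Schwartz functions\<close>

text \<open>The order \<open>- \<alpha> / 2\<close> splits the gain \<alpha> evenly: each Radon
  transform then maps a Sobolev space into its dual, so its quadratic form is bounded by the energy
  of that order. For Frostman exponent \<open>s\<close> this energy is a geometric series over
  dyadic frequencies, convergent once \<open>d - s < \<alpha>\<close>; this is the origin of the
  threshold \<open>d - \<alpha>\<close>. Two encodings shape the work. The Fourier transform of a
  functional is visible only through its values at \<open>fourier \<phi>\<close> with \<phi>
  Schwartz, so every function paired with a Radon transform must come with an explicit Schwartz
  inverse transform. Gaussians do, and finite combinations of them inherit it, so no inversion
  theorem enters. Moreover \<open>radon\<close> acts by transposition, and the transposed operator
  is a limit of averages over shrinking balls that has to exist at every point and depend
  continuously on \<open>t\<close>. Both follow from a jointly continuous density of the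
  push-forward of \<open>b (y, x) * h y\<close> under \<open>y \<mapsto> \<Phi> (y, x)\<close>. The
  same density, tested against continuous functions of \<open>t\<close>, links the quadratic forms
  to averages over pairs of points near \<open>E\<close>.\<close>

lemma has_bochner_integral_lborel_prod:
  fixes f :: "'a::euclidean_space \<Rightarrow> real \<Rightarrow> 'c::{real_normed_field,banach,second_countable_topology}"
  assumes f: "\<And>b. b \<in> Basis \<Longrightarrow> integrable lborel (f b)"
  shows "has_bochner_integral lborel (\<lambda>x. \<Prod>b\<in>Basis. f b (x \<bullet> b)) (\<Prod>b\<in>Basis. integral\<^sup>L lborel (f b))"
proof -
  interpret product_sigma_finite "\<lambda>_::'a. lborel :: real measure"
    by standard
  have [measurable]: "(\<lambda>g. \<Sum>b\<in>Basis. g b *\<^sub>R b) \<in> Pi\<^sub>M Basis (\<lambda>_::'a. lborel) \<rightarrow>\<^sub>M borel"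
    by measurable
  have meas: "(\<lambda>x. \<Prod>b\<in>Basis. f b (x \<bullet> b)) \<in> borel_measurable borel"
  proof (rule borel_measurable_prod)
    fix b :: 'a assume "b \<in> Basis"
    then have "f b \<in> borel_measurable borel"
      using f borel_measurable_integrable by fastforce
    then show "(\<lambda>x. f b (x \<bullet> b)) \<in> borel_measurable borel"
      by measurable
  qed
  have eq: "(\<Prod>b\<in>Basis. f b ((\<Sum>b\<in>Basis. g b *\<^sub>R b) \<bullet> b)) = (\<Prod>b\<in>Basis. f b (g b))" for g
    by (intro prod.cong refl) (simp add: inner_sum_left inner_Basis if_distrib cong: if_cong)
  have "has_bochner_integral (Pi\<^sub>M Basis (\<lambda>_. lborel)) (\<lambda>g. \<Prod>b\<in>Basis. f b (g b))
     (\<Prod>b\<in>Basis. integral\<^sup>L lborel (f b))"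
    using product_integrable_prod[of Basis f] product_integral_prod[of Basis f] f
    by (simp add: has_bochner_integral_iff)
  then show ?thesis
    unfolding lborel_eq[where 'a='a]
    by (intro has_bochner_integral_distr) (simp_all add: meas eq)
qed

lemma lborel_distr_affine:
  fixes t :: "'a::euclidean_space"
  assumes "\<bar>c\<bar> = 1"
  shows "distr lborel borel (\<lambda>x. t + c *\<^sub>R x) = lborel"
proof -
  have "c \<noteq> 0" using assms by auto
  from lborel_affine[OF this, of t] show ?thesis
    using assms by (simp add: density_1)
qed

lemma lborel_integral_affine:
  fixes t :: "'a::euclidean_space" and f :: "'a \<Rightarrow> 'c::{banach, second_countable_topology}"
  assumes "\<bar>c\<bar> = 1" "f \<in> borel_measurable borel"
  shows "(LINT x|lborel. f (t + c *\<^sub>R x)) = integral\<^sup>L lborel f"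
  using integral_distr[of "\<lambda>x. t + c *\<^sub>R x" lborel borel f] assms by (simp add: lborel_distr_affine)

lemma lborel_integrable_affine:
  fixes t :: "'a::euclidean_space" and f :: "'a \<Rightarrow> 'c::{banach, second_countable_topology}"
  assumes "\<bar>c\<bar> = 1" "f \<in> borel_measurable borel"
  shows "integrable lborel (\<lambda>x. f (t + c *\<^sub>R x)) \<longleftrightarrow> integrable lborel f"
  using integrable_distr_eq[of "\<lambda>x. t + c *\<^sub>R x" lborel borel f] assms by (simp add: lborel_distr_affine)

text \<open>A rescaled form of the characteristic function of the standard normal distribution: with
  \<open>k = sqrt (2 * pi * c)\<close>, the exponent \<open>(k * t)\<^sup>2 / 2\<close> equals
  \<open>pi * c * t\<^sup>2\<close>.\<close>

lemma gaussian_1d: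
  fixes c y :: real
  assumes "c > 0"
  shows "has_bochner_integral lborel (\<lambda>t. cis (2 * pi * (y * t)) * of_real (exp (- pi * c * t\<^sup>2)))
    (of_real (1 / sqrt c * exp (- pi * y\<^sup>2 / c)))"
proof -
  define k where "k = sqrt (2 * pi * c)"
  have k: "k > 0" "k\<^sup>2 = 2 * pi * c" using assms by (simp_all add: k_def)
  let ?g = "\<lambda>t. cis (2 * pi * y / k * t) * of_real (std_normal_density t)"
  have i: "integrable lborel ?g"
  proof (rule Bochner_Integration.integrable_bound)
    show "integrable lborel std_normal_density"
      using integrable_std_normal_moment[of 0] by simp
  qed (auto simp: norm_mult normal_density_nonneg cis_conv_exp)
  have "integral\<^sup>L lborel ?g = char std_normal_distribution (2 * pi * y / k)"
    unfolding char_def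
    by (subst integral_density)
       (auto simp: normal_density_nonneg cis_conv_exp scaleR_conv_of_real mult_ac intro!: Bochner_Integration.integral_cong)
  also have "\<dots> = of_real (exp (- pi * y\<^sup>2 / c))"
    using k assms by (simp add: char_std_normal_distribution power_divide power_mult_distrib field_simps power2_eq_square)
  finally have "has_bochner_integral lborel ?g (of_real (exp (- pi * y\<^sup>2 / c)))"
    using i by (simp add: has_bochner_integral_iff)
  then have "has_bochner_integral lborel (\<lambda>t. ?g (0 + k * t)) (of_real (exp (- pi * y\<^sup>2 / c)) /\<^sub>R \<bar>k\<bar>)"
    using lborel_has_bochner_integral_real_affine_iff[of k ?g _ 0] k by simp
  then have "has_bochner_integral lborel (\<lambda>t. of_real (sqrt (2 * pi)) * ?g (0 + k * t)) (of_real (sqrt (2 * pi)) * (of_real (exp (- pi * y\<^sup>2 / c)) /\<^sub>R \<bar>k\<bar>))"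
    by (rule has_bochner_integral_mult_right)
  moreover have "of_real (sqrt (2 * pi)) * ?g (0 + k * t) = cis (2 * pi * (y * t)) * of_real (exp (- pi * c * t\<^sup>2))" for t
    using k by (simp add: std_normal_density_def power_mult_distrib mult_ac)
  moreover have "of_real (sqrt (2 * pi)) * (of_real (exp (- pi * y\<^sup>2 / c)) /\<^sub>R \<bar>k\<bar>) = (of_real (1 / sqrt c * exp (- pi * y\<^sup>2 / c)) :: complex)"
    using assms k by (simp add: k_def scaleR_conv_of_real real_sqrt_mult field_simps)
  ultimately show ?thesis by simp
qed

lemma cis_sum: "finite A \<Longrightarrow> cis (\<Sum>b\<in>A. f b) = (\<Prod>b\<in>A. cis (f b))"
  by (induction rule: finite_induct) (simp_all add: cis_mult[symmetric])

text \<open>Character and Gaussian both factor over the coordinates of \<open>x\<close>, so the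
  integral is a product of one-dimensional ones. The vector \<open>y\<close> is a frequency in the
  Fourier transforms below and a difference of two points in the energy computation.\<close>

lemma has_bochner_integral_gaussian:
  fixes y :: "'a::euclidean_space"
  assumes "c > 0"
  shows "has_bochner_integral lborel (\<lambda>x. cis (2 * pi * (y \<bullet> x)) * of_real (exp (- pi * c * (norm x)\<^sup>2)))
    (of_real ((1 / sqrt c) ^ DIM('a) * exp (- pi * (norm y)\<^sup>2 / c)))"
proof -
  let ?f = "\<lambda>b t. cis (2 * pi * ((y \<bullet> b) * t)) * of_real (exp (- pi * c * t\<^sup>2))"
  have n: "(norm x)\<^sup>2 = (\<Sum>b\<in>Basis. (x \<bullet> b)\<^sup>2)" for x :: 'a
    by (simp add: norm_eq_sqrt_inner euclidean_inner[of x x] power2_eq_square sum_nonneg)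
  have "has_bochner_integral lborel (\<lambda>x::'a. \<Prod>b\<in>Basis. ?f b (x \<bullet> b)) (\<Prod>b\<in>Basis. integral\<^sup>L lborel (?f b))"
    using gaussian_1d[OF assms] by (intro has_bochner_integral_lborel_prod) (auto simp: has_bochner_integral_iff)
  moreover have "(\<Prod>b\<in>Basis. ?f b (x \<bullet> b)) = cis (2 * pi * (y \<bullet> x)) * of_real (exp (- pi * c * (norm x)\<^sup>2))" for x
    by (simp add: prod.distrib cis_sum[symmetric] exp_sum[symmetric] n euclidean_inner[of y x] sum_distrib_left
         flip: of_real_prod)
  moreover have "(\<Prod>b\<in>Basis. integral\<^sup>L lborel (?f b)) = (\<Prod>b\<in>(Basis::'a set). of_real (1 / sqrt c * exp (- pi * (y \<bullet> b)\<^sup>2 / c)))"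
    using gaussian_1d[OF assms] by (intro prod.cong refl has_bochner_integral_integral_eq)
  moreover have "\<dots> = (of_real ((1 / sqrt c) ^ DIM('a) * exp (- pi * (norm y)\<^sup>2 / c)) :: complex)"
    by (simp add: prod.distrib exp_sum[symmetric] n prod_dividef sum_distrib_left sum_divide_distrib sum_negf power_one_over flip: of_real_prod)
  ultimately show ?thesis by simp
qed

lemma has_derivative_exp_complex:
  fixes g :: "'a::real_normed_vector \<Rightarrow> complex"
  assumes "(g has_derivative g') (at x)"
  shows "((\<lambda>x. exp (g x)) has_derivative (\<lambda>v. g' v * exp (g x))) (at x)"
  using has_derivative_compose[OF assms DERIV_exp[of "g x", unfolded has_field_derivative_def]]
  by (simp add: mult.commute)

text \<open>A class of Schwartz functions that is visibly closed under directional derivatives, so that no calculus of iterated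
  derivatives is needed.\<close>

inductive_set gaussian_class :: "('a::euclidean_space \<Rightarrow> complex) set" where
  base: "c > 0 \<Longrightarrow> (\<lambda>x. exp (Complex (u \<bullet> x - c * (x \<bullet> x)) (w \<bullet> x))) \<in> gaussian_class"
| add: "f \<in> gaussian_class \<Longrightarrow> g \<in> gaussian_class \<Longrightarrow> (\<lambda>x. f x + g x) \<in> gaussian_class"
| cmult: "f \<in> gaussian_class \<Longrightarrow> (\<lambda>x. a * f x) \<in> gaussian_class"
| coord: "f \<in> gaussian_class \<Longrightarrow> (\<lambda>x. of_real (v \<bullet> x) * f x) \<in> gaussian_class"

text \<open>Differentiating the exponential produces an affine factor, which \<open>cmult\<close>,
  \<open>coord\<close> and \<open>add\<close> accommodate. Membership is asserted for each fixed
  direction \<open>v\<close>, matching the recursion of \<open>iter_deriv\<close>.\<close>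

lemma gaussian_class_deriv:
  assumes "f \<in> gaussian_class"
  shows "\<exists>f'. (\<forall>x. (f has_derivative f' x) (at x)) \<and> (\<forall>v. (\<lambda>x. f' x v) \<in> gaussian_class)"
  using assms
proof induction
  case (base c u w)
  let ?f = "\<lambda>x. exp (Complex (u \<bullet> x - c * (x \<bullet> x)) (w \<bullet> x))"
  have "(?f has_derivative (\<lambda>v. Complex (u \<bullet> v - 2 * c * (x \<bullet> v)) (w \<bullet> v) * ?f x)) (at x)" for x
  proof -
    have "((\<lambda>x. Complex (u \<bullet> x - c * (x \<bullet> x)) (w \<bullet> x)) has_derivative
       (\<lambda>v. Complex (u \<bullet> v - 2 * c * (x \<bullet> v)) (w \<bullet> v))) (at x)"
      unfolding Complex_eq
      by (rule derivative_eq_intros refl | simp add: fun_eq_iff algebra_simps inner_commute)+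
    then show ?thesis
      by (rule has_derivative_exp_complex)
  qed
  moreover have "(\<lambda>x. Complex (u \<bullet> v - 2 * c * (x \<bullet> v)) (w \<bullet> v) * ?f x) \<in> gaussian_class" for v
  proof -
    have "(\<lambda>x. Complex (u \<bullet> v) (w \<bullet> v) * ?f x + (- 2 * of_real c) * (of_real (v \<bullet> x) * ?f x)) \<in> gaussian_class"
      by (intro gaussian_class.intros base)
    then show ?thesis
      by (simp add: Complex_eq algebra_simps inner_commute)
  qed
  ultimately show ?case by fast
next
  case (add f g)
  then obtain f' g' where "\<And>x. (f has_derivative f' x) (at x)" "\<And>v. (\<lambda>x. f' x v) \<in> gaussian_class"
     "\<And>x. (g has_derivative g' x) (at x)" "\<And>v. (\<lambda>x. g' x v) \<in> gaussian_class" by auto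
  then show ?case
    by (intro exI[of _ "\<lambda>x v. f' x v + g' x v"]) (auto intro!: derivative_intros gaussian_class.add)
next
  case (cmult f a)
  then obtain f' where "\<And>x. (f has_derivative f' x) (at x)" "\<And>v. (\<lambda>x. f' x v) \<in> gaussian_class" by auto
  then show ?case
    by (intro exI[of _ "\<lambda>x v. a * f' x v"]) (auto intro!: derivative_intros gaussian_class.cmult)
next
  case (coord f w)
  then obtain f' where f': "\<And>x. (f has_derivative f' x) (at x)" "\<And>v. (\<lambda>x. f' x v) \<in> gaussian_class" by auto
  have "((\<lambda>x. of_real (w \<bullet> x) * f x) has_derivative (\<lambda>v. of_real (w \<bullet> x) * f' x v + of_real (w \<bullet> v) * f x)) (at x)" for x
    using f'(1) by (auto intro!: derivative_eq_intros)
  moreover have "(\<lambda>x. of_real (w \<bullet> x) * f' x v + of_real (w \<bullet> v) * f x) \<in> gaussian_class" for v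
    using f'(2) coord by (intro gaussian_class.intros)
  ultimately show ?case by fast
qed

lemma gaussian_class_differentiable:
  "f \<in> gaussian_class \<Longrightarrow> f differentiable_on UNIV"
  using gaussian_class_deriv[of f] by (auto simp: differentiable_on_def differentiable_def)

lemma iter_deriv_gaussian_class:
  "f \<in> gaussian_class \<Longrightarrow> iter_deriv vs f \<in> gaussian_class"
proof (induction vs)
  case (Cons v vs)
  then obtain f' where f': "\<And>x. (iter_deriv vs f has_derivative f' x) (at x)" "\<And>v. (\<lambda>x. f' x v) \<in> gaussian_class"
    using gaussian_class_deriv by blast
  have "frechet_derivative (iter_deriv vs f) (at x) = f' x" for x
    using f'(1) by (metis frechet_derivative_at)
  then show ?case using f'(2) by simp
qed simp

lemma gaussian_class_bound:
  fixes f :: "'a::euclidean_space \<Rightarrow> complex"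
  assumes "f \<in> gaussian_class"
  shows "\<exists>C c. c > 0 \<and> C \<ge> 0 \<and> (\<forall>x. cmod (f x) \<le> C * exp (- c * (norm x)\<^sup>2))"
  using assms
proof induction
  case (base c u w)
  \<comment> \<open>Completing the square: half of the quadratic decay absorbs the linear
    term.\<close>
  have "u \<bullet> x - c * (x \<bullet> x) \<le> (norm u)\<^sup>2 / (2 * c) - c / 2 * (norm x)\<^sup>2" for x :: 'a
  proof -
    have "u \<bullet> x \<le> norm u * norm x" by (rule norm_cauchy_schwarz)
    moreover have "0 \<le> (norm u / c - norm x)\<^sup>2 * (c / 2)" using base by simp
    moreover have "(norm u / c - norm x)\<^sup>2 * (c / 2) = (norm u)\<^sup>2 / (2 * c) + c / 2 * (norm x)\<^sup>2 - norm u * norm x"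
      using base by (simp add: power2_eq_square field_simps)
    ultimately show ?thesis by (simp add: power2_norm_eq_inner)
  qed
  then have "cmod (exp (Complex (u \<bullet> x - c * (x \<bullet> x)) (w \<bullet> x))) \<le> exp ((norm u)\<^sup>2 / (2 * c)) * exp (- (c/2) * (norm x)\<^sup>2)" for x :: 'a
    by (simp flip: exp_add)
  then show ?case using base by (intro exI[of _ "exp ((norm u)\<^sup>2 / (2 * c))"] exI[of _ "c/2"]) auto
next
  case (add f g)
  then obtain C c D d where *: "c > 0" "C \<ge> 0" "\<And>x. cmod (f x) \<le> C * exp (- c * (norm x)\<^sup>2)"
    "d > 0" "D \<ge> 0" "\<And>x. cmod (g x) \<le> D * exp (- d * (norm x)\<^sup>2)" by metis
  have "cmod (f x + g x) \<le> (C + D) * exp (- min c d * (norm x)\<^sup>2)" for x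
  proof -
    have "cmod (f x + g x) \<le> C * exp (- c * (norm x)\<^sup>2) + D * exp (- d * (norm x)\<^sup>2)"
      using *(3)[of x] *(6)[of x] norm_triangle_ineq[of "f x" "g x"] by simp
    also have "\<dots> \<le> C * exp (- min c d * (norm x)\<^sup>2) + D * exp (- min c d * (norm x)\<^sup>2)"
      using * by (intro add_mono mult_left_mono) (auto intro: mult_right_mono)
    finally show ?thesis by (simp add: algebra_simps)
  qed
  then show ?case using * by (intro exI[of _ "C + D"] exI[of _ "min c d"]) auto
next
  case (cmult f a)
  then obtain C c where *: "c > 0" "C \<ge> 0" "\<And>x. cmod (f x) \<le> C * exp (- c * (norm x)\<^sup>2)" by metis
  then show ?case
    by (intro exI[of _ "cmod a * C"] exI[of _ c]) (auto simp: norm_mult mult.assoc intro: mult_left_mono)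
next
  case (coord f v)
  then obtain C c where *: "c > 0" "C \<ge> 0" "\<And>x. cmod (f x) \<le> C * exp (- c * (norm x)\<^sup>2)" by metis
  \<comment> \<open>A linear factor costs half of the decay rate, because \<open>norm x\<close> is
    at most a constant times \<open>exp (c / 2 * (norm x)\<^sup>2)\<close>.\<close>
  have "cmod (of_real (v \<bullet> x) * f x) \<le> norm v * (1 + 2 / c) * C * exp (- (c/2) * (norm x)\<^sup>2)" for x
  proof -
    have 1: "norm x \<le> 1 + (norm x)\<^sup>2" 
      using self_le_power[of "norm x" 2] zero_le_power2[of "norm x"] by (cases "norm x \<ge> 1") (auto simp: not_le intro: add_increasing2 less_imp_le)
    have "(norm x)\<^sup>2 = 2 / c * (c / 2 * (norm x)\<^sup>2)" using * by simp
    also have "\<dots> \<le> 2 / c * exp (c / 2 * (norm x)\<^sup>2)"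
      using exp_ge_add_one_self[of "c / 2 * (norm x)\<^sup>2"] *(1)
      by (intro mult_left_mono) (linarith, simp)
    finally have 3: "(norm x)\<^sup>2 \<le> 2 / c * exp (c / 2 * (norm x)\<^sup>2)" .
    have "1 \<le> exp (c / 2 * (norm x)\<^sup>2)" using * by simp
    with 1 3 have 2: "norm x \<le> (1 + 2 / c) * exp (c / 2 * (norm x)\<^sup>2)"
      unfolding distrib_right by linarith
    have "cmod (of_real (v \<bullet> x) * f x) \<le> (norm v * norm x) * (C * exp (- c * (norm x)\<^sup>2))"
      unfolding norm_mult using *(2) by (intro mult_mono *(3)) (auto simp: Cauchy_Schwarz_ineq2)
    also have "\<dots> \<le> (norm v * ((1 + 2 / c) * exp (c / 2 * (norm x)\<^sup>2))) * (C * exp (- c * (norm x)\<^sup>2))"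
      using 2 * by (intro mult_right_mono mult_left_mono) auto
    also have "\<dots> = norm v * (1 + 2 / c) * C * (exp (c / 2 * (norm x)\<^sup>2) * exp (- c * (norm x)\<^sup>2))"
      by simp
    also have "exp (c / 2 * (norm x)\<^sup>2) * exp (- c * (norm x)\<^sup>2) = exp (- (c/2) * (norm x)\<^sup>2)"
      by (simp add: algebra_simps flip: exp_add)
    finally show ?thesis .
  qed
  then show ?case using * by (intro exI[of _ "norm v * (1 + 2 / c) * C"] exI[of _ "c/2"]) auto
qed

lemma power_le_fact_exp:
  fixes u :: real
  assumes "u \<ge> 0"
  shows "u ^ n \<le> fact n * exp u"
proof -
  have "u ^ n /\<^sub>R fact n \<le> (\<Sum>k. u ^ k /\<^sub>R fact k)"
    using sum_le_suminf[OF summable_exp_generic[of u], of "{n}"] assms by simp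
  then show ?thesis by (simp add: exp_def field_simps)
qed

lemma gaussian_class_schwartz:
  fixes f :: "'a::euclidean_space \<Rightarrow> complex"
  assumes "f \<in> gaussian_class"
  shows "f \<in> schwartz"
proof -
  have "smooth f"
    using assms iter_deriv_gaussian_class gaussian_class_differentiable by (auto simp: smooth_def)
  moreover have "bounded (range (\<lambda>x. (1 + norm x) ^ n *\<^sub>R g x))" if g: "g \<in> gaussian_class" for g :: "'a \<Rightarrow> complex" and n
  proof -
    obtain C c where *: "c > 0" "C \<ge> 0" "\<And>x. cmod (g x) \<le> C * exp (- c * (norm x)\<^sup>2)"
      using gaussian_class_bound[OF g] by metis
    have "norm ((1 + norm x) ^ n *\<^sub>R g x) \<le> C * fact n * exp (1 + 1 / (4 * c))" for x
    proof -
      have "(1 + norm x) ^ n \<le> fact n * exp (1 + norm x)" by (rule power_le_fact_exp) simp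
      \<comment> \<open>Completing the square around \<open>1 / (2 * c)\<close>; exponential growth
        is thereby paid for by the Gaussian decay.\<close>
      moreover have "norm x \<le> 1 / (4 * c) + c * (norm x)\<^sup>2"
      proof -
        have "0 \<le> (1 / (2 * c) - norm x)\<^sup>2 * c" using * by simp
        also have "\<dots> = 1 / (4 * c) + c * (norm x)\<^sup>2 - norm x"
          using * by (simp add: power2_eq_square field_simps)
        finally show ?thesis by simp
      qed
      then have "exp (1 + norm x) \<le> exp (1 + 1 / (4 * c)) * exp (c * (norm x)\<^sup>2)"
        by (simp flip: exp_add)
      ultimately have "(1 + norm x) ^ n \<le> fact n * (exp (1 + 1 / (4 * c)) * exp (c * (norm x)\<^sup>2))"
        by (meson fact_ge_zero mult_left_mono order_trans)
      then have "norm ((1 + norm x) ^ n *\<^sub>R g x) \<le> fact n * (exp (1 + 1 / (4 * c)) * exp (c * (norm x)\<^sup>2)) * (C * exp (- c * (norm x)\<^sup>2))"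
        unfolding norm_scaleR using *(2) by (intro mult_mono *(3)) auto
      also have "\<dots> = C * fact n * exp (1 + 1 / (4 * c)) * (exp (c * (norm x)\<^sup>2) * exp (- c * (norm x)\<^sup>2))"
        by simp
      finally show ?thesis by (simp flip: exp_add)
    qed
    then show ?thesis by (auto simp: bounded_iff)
  qed
  ultimately show ?thesis
    using iter_deriv_gaussian_class[OF assms] by (auto simp: schwartz_def)
qed

lemma gaussian_class_continuous: "f \<in> gaussian_class \<Longrightarrow> continuous_on UNIV f"
  using gaussian_class_differentiable differentiable_imp_continuous_on by blast

lemma gaussian_class_measurable [measurable_dest]: "f \<in> gaussian_class \<Longrightarrow> f \<in> borel_measurable borel"
  using gaussian_class_continuous borel_measurable_continuous_onI by blast

lemma integrable_gaussian:
  assumes "c > 0"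
  shows "integrable lborel (\<lambda>x::'a::euclidean_space. exp (- c * (norm x)\<^sup>2))"
proof -
  have "integrable lborel (\<lambda>x::'a. of_real (exp (- pi * (c / pi) * (norm x)\<^sup>2)) :: complex)"
    using has_bochner_integral_gaussian[of "c / pi" "0::'a"] assms by (simp add: has_bochner_integral_iff)
  then show ?thesis
    using complex_of_real_integrable_eq[of lborel "\<lambda>x::'a. exp (- pi * (c / pi) * (norm x)\<^sup>2)"] by simp
qed

lemma gaussian_class_integrable: 
  fixes f :: "'a::euclidean_space \<Rightarrow> complex"
  assumes "f \<in> gaussian_class" 
  shows "integrable lborel f"
proof -
  obtain C c where *: "c > 0" "C \<ge> 0" "\<And>x. cmod (f x) \<le> C * exp (- c * (norm x)\<^sup>2)"
    using gaussian_class_bound[OF assms] by metis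
  show ?thesis
  proof (rule Bochner_Integration.integrable_bound)
    show "integrable lborel (\<lambda>x::'a. C * exp (- c * (norm x)\<^sup>2))"
      by (rule integrable_mult_right[OF integrable_gaussian[OF *(1), where 'a='a]])
  qed (use * assms gaussian_class_measurable in auto)
qed

definition gauss :: "'a::euclidean_space \<Rightarrow> real \<Rightarrow> 'a \<Rightarrow> complex" where
  "gauss p e x = of_real ((1 / e) ^ DIM('a) * exp (- pi * (norm (x - p))\<^sup>2 / e\<^sup>2))"

text \<open>The inverse transform of \<open>gauss p e\<close>, hence the positive sign in the
  character: \<open>has_fourier_transform\<close> evaluates a functional at
  \<open>fourier \<phi>\<close>, so what is needed is a \<phi> whose transform is the given
  Gaussian.\<close>

definition gauss_hat :: "'a::euclidean_space \<Rightarrow> real \<Rightarrow> 'a \<Rightarrow> complex" where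
  "gauss_hat p e \<xi> = cis (2 * pi * (p \<bullet> \<xi>)) * of_real (exp (- pi * e\<^sup>2 * (norm \<xi>)\<^sup>2))"

lemma gauss_hat_gaussian_class: "e > 0 \<Longrightarrow> gauss_hat p e \<in> gaussian_class"
  using gaussian_class.base[of "pi * e\<^sup>2" 0 "(2 * pi) *\<^sub>R p"]
  by (simp add: gauss_hat_def[abs_def] exp_eq_polar power2_norm_eq_inner mult_ac)

lemma gauss_gaussian_class: 
  assumes "e > 0" 
  shows "gauss p e \<in> gaussian_class"
proof -
  have "(\<lambda>x. of_real ((1 / e) ^ DIM('a) * exp (- pi * (norm p)\<^sup>2 / e\<^sup>2)) *
      exp (Complex (((2 * pi / e\<^sup>2) *\<^sub>R p) \<bullet> x - (pi / e\<^sup>2) * (x \<bullet> x)) (0 \<bullet> x))) \<in> gaussian_class"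
    using assms by (intro gaussian_class.intros) auto
  also have "(\<lambda>x. of_real ((1 / e) ^ DIM('a) * exp (- pi * (norm p)\<^sup>2 / e\<^sup>2)) *
      exp (Complex (((2 * pi / e\<^sup>2) *\<^sub>R p) \<bullet> x - (pi / e\<^sup>2) * (x \<bullet> x)) (0 \<bullet> x))) = gauss p e"
  proof
    fix x
    have "- pi * (norm (x - p))\<^sup>2 / e\<^sup>2 = - pi * (norm p)\<^sup>2 / e\<^sup>2 + (((2 * pi / e\<^sup>2) *\<^sub>R p) \<bullet> x - (pi / e\<^sup>2) * (x \<bullet> x))"
      using assms by (simp add: power2_norm_eq_inner inner_diff field_simps inner_commute)
    then show "of_real ((1 / e) ^ DIM('a) * exp (- pi * (norm p)\<^sup>2 / e\<^sup>2)) *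
      exp (Complex (((2 * pi / e\<^sup>2) *\<^sub>R p) \<bullet> x - (pi / e\<^sup>2) * (x \<bullet> x)) (0 \<bullet> x)) = gauss p e x"
      by (simp add: gauss_def exp_eq_polar mult.assoc flip: exp_add of_real_mult)
  qed
  finally show ?thesis .
qed

lemma fourier_gauss_hat:
  fixes p :: "'a::euclidean_space"
  assumes "e > 0"
  shows "fourier (gauss_hat p e) = gauss p e"
proof
  fix x :: 'a
  have "fourier (gauss_hat p e) x = (LINT \<xi>|lborel. cis (2 * pi * ((p - x) \<bullet> \<xi>)) * of_real (exp (- pi * e\<^sup>2 * (norm \<xi>)\<^sup>2)))"
    unfolding fourier_def gauss_hat_def mult.assoc[symmetric] cis_mult
    by (simp add: inner_diff_left algebra_simps inner_commute)
  also have "\<dots> = gauss p e x"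
    using has_bochner_integral_gaussian[of "e\<^sup>2" "p - x"] assms
    by (simp add: has_bochner_integral_iff gauss_def norm_minus_commute)
  finally show "fourier (gauss_hat p e) x = gauss p e x" .
qed

lemma fourier_gauss:
  fixes p :: "'a::euclidean_space"
  assumes "e > 0"
  shows "fourier (gauss p e) \<xi> = gauss_hat p e (- \<xi>)"
proof -
  let ?h = "\<lambda>x. cis (- 2 * pi * (x \<bullet> \<xi>)) * gauss p e x"
  have "fourier (gauss p e) \<xi> = (LINT x|lborel. ?h (p + x))"
    unfolding fourier_def by (rule lborel_integral_affine[where c=1, simplified, symmetric]) (auto intro!: borel_measurable_times borel_measurable_continuous_onI continuous_intros
      gaussian_class_continuous[OF gauss_gaussian_class[OF assms]])
  also have "\<dots> = (LINT x|lborel. cis (- 2 * pi * (p \<bullet> \<xi>)) * of_real ((1 / e) ^ DIM('a)) *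
      (cis (2 * pi * ((- \<xi>) \<bullet> x)) * of_real (exp (- pi * (1 / e\<^sup>2) * (norm x)\<^sup>2))))"
  proof (intro Bochner_Integration.integral_cong refl)
    fix x :: 'a
    have "cis (- 2 * pi * ((p + x) \<bullet> \<xi>)) = cis (- 2 * pi * (p \<bullet> \<xi>)) * cis (2 * pi * ((- \<xi>) \<bullet> x))"
      by (simp add: cis_mult inner_add_left distrib_left inner_commute[of x])
    then show "?h (p + x) = cis (- 2 * pi * (p \<bullet> \<xi>)) * of_real ((1 / e) ^ DIM('a)) *
      (cis (2 * pi * ((- \<xi>) \<bullet> x)) * of_real (exp (- pi * (1 / e\<^sup>2) * (norm x)\<^sup>2)))"
      by (simp add: gauss_def)
  qed
  also have "\<dots> = cis (- 2 * pi * (p \<bullet> \<xi>)) * of_real ((1 / e) ^ DIM('a)) * 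
       of_real ((1 / sqrt (1 / e\<^sup>2)) ^ DIM('a) * exp (- pi * (norm (- \<xi>))\<^sup>2 / (1 / e\<^sup>2)))"
    using assms by (intro has_bochner_integral_integral_eq has_bochner_integral_mult_right has_bochner_integral_gaussian) simp
  also have "\<dots> = gauss_hat p e (- \<xi>)"
    using assms by (simp add: gauss_hat_def real_sqrt_divide power_mult_distrib[symmetric] power_one_over mult_ac)
  finally show ?thesis .
qed

section \<open>Fourier transforms of tempered distributions\<close>

lemma lborel_integral_scale:
  fixes t :: "'a::euclidean_space" and f :: "'a \<Rightarrow> 'c::{banach, second_countable_topology}"
  assumes "c \<noteq> 0" "f \<in> borel_measurable borel"
  shows "integral\<^sup>L lborel f = \<bar>c\<bar> ^ DIM('a) *\<^sub>R (LINT x|lborel. f (t + c *\<^sub>R x))"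
proof -
  have "integral\<^sup>L lborel f = integral\<^sup>L (density (distr lborel borel (\<lambda>x. t + c *\<^sub>R x)) (\<lambda>_. \<bar>c\<bar> ^ DIM('a))) f"
    using lborel_affine[OF assms(1), of t] by simp
  also have "\<dots> = (LINT x|distr lborel borel (\<lambda>x. t + c *\<^sub>R x). \<bar>c\<bar> ^ DIM('a) *\<^sub>R f x)"
    using assms by (subst integral_density) auto
  also have "\<dots> = (LINT x|lborel. \<bar>c\<bar> ^ DIM('a) *\<^sub>R f (t + c *\<^sub>R x))"
    using assms by (subst integral_distr) auto
  finally show ?thesis by simp
qed

lemma integrable_pair_bound:
  fixes F :: "'a::euclidean_space \<times> 'b::euclidean_space \<Rightarrow> complex"
  assumes [measurable]: "F \<in> borel_measurable (lborel \<Otimes>\<^sub>M lborel)"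
    and "integrable lborel g" "integrable lborel h"
    and bound: "\<And>x y. cmod (F (x, y)) \<le> g x * h y"
  shows "integrable (lborel \<Otimes>\<^sub>M lborel) F"
proof -
  have [measurable]: "g \<in> borel_measurable borel" "h \<in> borel_measurable borel"
    using assms(2,3) borel_measurable_integrable by fastforce+
  have "integrable (lborel \<Otimes>\<^sub>M lborel) (\<lambda>(x, y). g x * h y)"
    using assms(2,3) by (intro lborel_pair.Fubini_integrable) (auto simp: abs_mult)
  then show ?thesis
    by (rule Bochner_Integration.integrable_bound) (use bound in \<open>auto intro!: AE_I2 order_trans[OF _ abs_ge_self]\<close>)
qed

lemma integrable_mult_bounded:
  fixes f g :: "'a \<Rightarrow> 'b::{real_normed_field, banach, second_countable_topology}"
  assumes f: "integrable M f" and g: "g \<in> borel_measurable M" and B: "\<And>x. norm (g x) \<le> B"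
  shows "integrable M (\<lambda>x. f x * g x)"
proof (rule Bochner_Integration.integrable_bound)
  show "integrable M (\<lambda>x. norm (f x) * B)" using f by simp
  show "(\<lambda>x. f x * g x) \<in> borel_measurable M"
    using g borel_measurable_integrable[OF f] by simp
  have "norm (f x * g x) \<le> norm (f x) * B" for x
    unfolding norm_mult by (intro mult_left_mono B norm_ge_zero)
  then show "AE x in M. norm (f x * g x) \<le> norm (norm (f x) * B)"
    by (intro AE_I2) (metis abs_ge_self order_trans real_norm_def)
qed

lemma schwartz_continuous:
  assumes "\<phi> \<in> schwartz" shows "continuous_on UNIV \<phi>"
proof -
  have "iter_deriv [] \<phi> differentiable_on UNIV" using assms unfolding schwartz_def smooth_def by blast
  then show ?thesis using differentiable_imp_continuous_on by simp
qed

lemma schwartz_measurable: "\<phi> \<in> schwartz \<Longrightarrow> \<phi> \<in> borel_measurable borel"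
  using schwartz_continuous borel_measurable_continuous_onI by blast

lemma schwartz_bounded:
  assumes "\<phi> \<in> schwartz" 
  obtains B where "B \<ge> 0" "\<And>x. (1 + norm x) ^ n * cmod (\<phi> x) \<le> B"
proof -
  have "bounded (range (\<lambda>x. (1 + norm x) ^ n *\<^sub>R iter_deriv [] \<phi> x))"
    using assms unfolding schwartz_def by blast
  then obtain B where B: "\<And>x. (1 + norm x) ^ n * cmod (\<phi> x) \<le> B"
    by (auto simp: bounded_iff)
  show ?thesis by (rule that[of B]) (use B order_trans[OF _ B[of 0]] in auto)
qed

lemma schwartz_seminorm_bound:
  fixes \<phi> :: "'a::euclidean_space \<Rightarrow> complex"
  assumes "\<phi> \<in> schwartz"
  shows "cmod (\<phi> x) \<le> schwartz_seminorm 0 \<phi>"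
proof -
  obtain B where B: "\<And>x. (1 + norm x) ^ 0 * cmod (\<phi> x) \<le> B"
    using schwartz_bounded[OF assms, of 0] by metis
  have "(case ([]::'a list, x) of (vs, x) \<Rightarrow> (1 + norm x) ^ 0 * cmod (iter_deriv vs \<phi> x)) \<le> schwartz_seminorm 0 \<phi>"
    unfolding schwartz_seminorm_def using B by (intro cSUP_upper bdd_aboveI2[where M=B]) auto
  then show ?thesis by simp
qed

text \<open>Domination by a product of the one-dimensional functions
  \<open>1 / (1 + t\<^sup>2)\<close>. Each of the \<open>DIM('a)\<close> factors
  \<open>1 + (x \<bullet> b)\<^sup>2\<close> is at most \<open>(1 + norm x)\<^sup>2\<close>, whence
  the exponent \<open>2 * DIM('a)\<close>.\<close>

lemma schwartz_integrable:
  fixes \<phi> :: "'a::euclidean_space \<Rightarrow> complex"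
  assumes "\<phi> \<in> schwartz"
  shows "integrable lborel \<phi>"
proof -
  obtain B where B: "B \<ge> 0" "\<And>x. (1 + norm x) ^ (2 * DIM('a)) * cmod (\<phi> x) \<le> B"
    using schwartz_bounded[OF assms, of "2 * DIM('a)"] by metis
  have "integrable lborel (\<lambda>x::real. inverse (1 + x\<^sup>2))"
    using integrable_inverse_1_plus_square by (simp add: set_integrable_def)
  then have "integrable lborel (\<lambda>x::'a. \<Prod>b\<in>Basis. inverse (1 + (x \<bullet> b)\<^sup>2))"
    using has_bochner_integral_lborel_prod[of "\<lambda>_ x. inverse (1 + x\<^sup>2) :: real"] by (auto simp: has_bochner_integral_iff)
  then have "integrable lborel (\<lambda>x::'a. B * (\<Prod>b\<in>Basis. inverse (1 + (x \<bullet> b)\<^sup>2)))"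
    by simp
  then show ?thesis
  proof (rule Bochner_Integration.integrable_bound)
    have "cmod (\<phi> x) \<le> B * (\<Prod>b\<in>Basis. inverse (1 + (x \<bullet> b)\<^sup>2))" for x
    proof -
      have "(\<Prod>b\<in>(Basis::'a set). 1 + (x \<bullet> b)\<^sup>2) \<le> (\<Prod>b\<in>(Basis::'a set). (1 + norm x)\<^sup>2)"
      proof (intro prod_mono conjI)
        fix b :: 'a assume "b \<in> Basis"
        then have "(x \<bullet> b)\<^sup>2 \<le> (norm x)\<^sup>2"
          using Basis_le_norm by (metis abs_le_square_iff abs_norm_cancel)
        then show "1 + (x \<bullet> b)\<^sup>2 \<le> (1 + norm x)\<^sup>2" by (simp add: power2_sum add_increasing2)
      qed simp
      then have "(\<Prod>b\<in>(Basis::'a set). 1 + (x \<bullet> b)\<^sup>2) * cmod (\<phi> x) \<le> B"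
        using B(2)[of x] by (simp add: power_mult[symmetric]) (meson mult_right_mono norm_ge_zero order_trans)
      moreover have "0 < (\<Prod>b\<in>(Basis::'a set). 1 + (x \<bullet> b)\<^sup>2)"
        by (intro prod_pos) (simp add: add_pos_nonneg)
      ultimately have "cmod (\<phi> x) \<le> B * inverse (\<Prod>b\<in>(Basis::'a set). 1 + (x \<bullet> b)\<^sup>2)"
        by (simp add: field_simps)
      then show ?thesis by (simp add: prod_inversef[symmetric] o_def)
    qed
    then show "AE x in lborel. norm (\<phi> x) \<le> norm (B * (\<Prod>b\<in>Basis. inverse (1 + (x \<bullet> b)\<^sup>2)))"
      by (auto intro!: AE_I2 order_trans[OF _ abs_ge_self])
  qed (use schwartz_measurable[OF assms] in auto)
qed

text \<open>Exponents of base functions add; the other cases are linear. Products arise when a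
  Gaussian factor is inserted to gain integrability and when a transform is squared.\<close>

lemma gaussian_class_mult:
  assumes "f \<in> gaussian_class" "g \<in> gaussian_class"
  shows "(\<lambda>x. f x * g x) \<in> gaussian_class"
  using assms(2)
proof induction
  case g: (base c u w)
  show ?case using assms(1)
  proof induction
    case (base c' u' w')
    have "(\<lambda>x. exp (Complex (u' \<bullet> x - c' * (x \<bullet> x)) (w' \<bullet> x)) * exp (Complex (u \<bullet> x - c * (x \<bullet> x)) (w \<bullet> x)))
       = (\<lambda>x. exp (Complex ((u + u') \<bullet> x - (c + c') * (x \<bullet> x)) ((w + w') \<bullet> x)))"
      by (simp add: fun_eq_iff Complex_eq exp_add[symmetric] inner_add_left algebra_simps)
    then show ?case using gaussian_class.base[of "c + c'" "u + u'" "w + w'"] base g by simp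
  qed (use gaussian_class.intros in \<open>auto simp: distrib_right mult.assoc\<close>)
next
  case (add g h)
  then show ?case by (auto simp: distrib_left intro: gaussian_class.add)
next
  case (cmult g a)
  then show ?case using gaussian_class.cmult[of "\<lambda>x. f x * g x" a] by (simp add: mult_ac)
next
  case (coord g v)
  then show ?case using gaussian_class.coord[of "\<lambda>x. f x * g x" v] by (simp add: mult_ac)
qed

section \<open>Gaussian mollifiers and uniqueness of Fourier transforms\<close>

lemma gauss_swap: "gauss p e x = gauss x e p"
  by (simp add: gauss_def norm_minus_commute)

lemma gauss_has_integral: "e > 0 \<Longrightarrow> has_bochner_integral lborel (gauss p e) 1"
  using fourier_gauss[of e p 0] gaussian_class_integrable[OF gauss_gaussian_class[of e p]]
  by (simp add: has_bochner_integral_iff fourier_def gauss_hat_def)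

lemma integrable_norm_gauss: "e > 0 \<Longrightarrow> integrable lborel (\<lambda>x. cmod (gauss p e x))"
  using gauss_has_integral by (auto simp: has_bochner_integral_iff)

lemma norm_gauss: "e > 0 \<Longrightarrow> of_real (cmod (gauss p e x)) = gauss p e x"
  by (simp add: gauss_def norm_mult norm_power norm_divide)

lemma integral_norm_gauss: "e > 0 \<Longrightarrow> (LINT x|lborel. cmod (gauss p e x)) = 1"
proof -
  assume e: "e > 0"
  have "complex_of_real (LINT x|lborel. cmod (gauss p e x)) = (LINT x|lborel. gauss p e x)"
    using e by (subst integral_complex_of_real[symmetric]) (simp add: norm_gauss)
  also have "\<dots> = 1" using gauss_has_integral[OF e, of p] by (simp add: has_bochner_integral_iff)
  finally show ?thesis by simp
qed

lemma integral_mult_norm_gauss: 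
  assumes "e > 0"
  shows "(LINT x|lborel. a * cmod (gauss p e x)) = a"
  using integral_norm_gauss[OF assms, of p] by simp

text \<open>The substitution \<open>p = \<xi> + e n *\<^sub>R z\<close> turns the shrinking Gaussian
  into a fixed one, after which dominated convergence applies with majorant
  \<open>B * cmod (gauss 0 1 z)\<close>.\<close>

lemma gauss_convolution_tendsto:
  fixes \<eta> :: "'a::euclidean_space \<Rightarrow> complex"
  assumes \<eta>: "continuous_on UNIV \<eta>" and B: "\<And>x. cmod (\<eta> x) \<le> B"
    and e: "e \<longlonglongrightarrow> 0" "\<And>n. e n > 0"
  shows "(\<lambda>n. LINT p|lborel. \<eta> p * gauss \<xi> (e n) p) \<longlonglongrightarrow> \<eta> \<xi>"
proof -
  have [measurable]: "\<eta> \<in> borel_measurable borel" using \<eta> by (rule borel_measurable_continuous_onI)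
  have [measurable]: "gauss p r \<in> borel_measurable borel" for p :: 'a and r :: real
    unfolding gauss_def by measurable
  have eq: "(LINT p|lborel. \<eta> p * gauss \<xi> (e n) p) = (LINT z|lborel. \<eta> (\<xi> + e n *\<^sub>R z) * gauss 0 1 z)" for n
  proof -
    have "(LINT p|lborel. \<eta> p * gauss \<xi> (e n) p)
       = \<bar>e n\<bar> ^ DIM('a) *\<^sub>R (LINT z|lborel. \<eta> (\<xi> + e n *\<^sub>R z) * gauss \<xi> (e n) (\<xi> + e n *\<^sub>R z))"
      using e(2)[of n] by (intro lborel_integral_scale) auto
    also have "\<dots> = (LINT z|lborel. \<bar>e n\<bar> ^ DIM('a) *\<^sub>R (\<eta> (\<xi> + e n *\<^sub>R z) * gauss \<xi> (e n) (\<xi> + e n *\<^sub>R z)))"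
      by simp
    also have "\<dots> = (LINT z|lborel. \<eta> (\<xi> + e n *\<^sub>R z) * gauss 0 1 z)"
      using e(2)[of n]
      by (intro Bochner_Integration.integral_cong)
         (simp_all add: gauss_def scaleR_conv_of_real power_mult_distrib power_divide)
    finally show ?thesis .
  qed
  have "(\<lambda>n. LINT z|lborel. \<eta> (\<xi> + e n *\<^sub>R z) * gauss 0 1 z) \<longlonglongrightarrow> (LINT z::'a|lborel. \<eta> \<xi> * gauss 0 1 z)"
  proof (rule integral_dominated_convergence[where w="\<lambda>z::'a. B * cmod (gauss 0 1 z)"])
    show "integrable lborel (\<lambda>z::'a. B * cmod (gauss 0 1 z))"
      using integrable_norm_gauss[of 1 "0::'a"] by simp
    show "AE z in lborel. (\<lambda>n. \<eta> (\<xi> + e n *\<^sub>R z) * gauss 0 1 z) \<longlonglongrightarrow> \<eta> \<xi> * gauss 0 1 z"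
    proof (intro AE_I2 tendsto_mult tendsto_const)
      fix z :: 'a
      have "(\<lambda>n. \<xi> + e n *\<^sub>R z) \<longlonglongrightarrow> \<xi> + 0 *\<^sub>R z" by (intro tendsto_intros e)
      then show "(\<lambda>n. \<eta> (\<xi> + e n *\<^sub>R z)) \<longlonglongrightarrow> \<eta> \<xi>"
        using isCont_tendsto_compose[of "\<xi> + 0 *\<^sub>R z" \<eta> "\<lambda>n. \<xi> + e n *\<^sub>R z"] \<eta> by (simp add: continuous_on_eq_continuous_at)
    qed
    show "AE z in lborel. cmod (\<eta> (\<xi> + e n *\<^sub>R z) * gauss 0 1 z) \<le> B * cmod (gauss 0 1 z)" for n
      unfolding norm_mult by (intro AE_I2 mult_right_mono B norm_ge_zero)
  qed measurable
  also have "(LINT z::'a|lborel. \<eta> \<xi> * gauss 0 1 z) = \<eta> \<xi>"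
    using gauss_has_integral[of 1 "0::'a"] by (simp add: has_bochner_integral_iff)
  finally show ?thesis unfolding eq .
qed

text \<open>A mollified \<eta> is a superposition of Gaussians, so by Fubini \<kappa> integrates to
  zero against it; then the width of the mollifier tends to zero.\<close>

lemma integral_test_gaussians_eq_0:
  fixes \<kappa> :: "'a::euclidean_space \<Rightarrow> complex"
  assumes \<kappa>: "integrable lborel \<kappa>"
    and 0: "\<And>p e. e > 0 \<Longrightarrow> (LINT \<xi>|lborel. \<kappa> \<xi> * gauss p e \<xi>) = 0"
    and \<eta>: "continuous_on UNIV \<eta>" and B: "\<And>x. cmod (\<eta> x) \<le> B"
  shows "(LINT \<xi>|lborel. \<kappa> \<xi> * \<eta> \<xi>) = 0"
proof -
  have [measurable]: "\<eta> \<in> borel_measurable borel" "\<kappa> \<in> borel_measurable borel"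
    using \<eta> \<kappa> borel_measurable_integrable by (auto intro: borel_measurable_continuous_onI)
  have [measurable]: "(\<lambda>(x, p). gauss p r x :: complex) \<in> borel_measurable (lborel \<Otimes>\<^sub>M (lborel :: 'a measure))" for r :: real
    unfolding gauss_def by measurable
  have [measurable]: "gauss p r \<in> borel_measurable borel" for p :: 'a and r :: real
    unfolding gauss_def by measurable
  have B0: "B \<ge> 0" using order_trans[OF norm_ge_zero B[of 0]] .
  define e where "e n = 1 / real (Suc n)" for n
  have e: "e \<longlonglongrightarrow> 0" "\<And>n. e n > 0" 
    unfolding e_def using LIMSEQ_inverse_real_of_nat by (auto simp: inverse_eq_divide)
  \<comment> \<open>Centre and variable of a Gaussian can be exchanged, which turns the hypothesis
    about tests centred at \<open>p\<close> into one about the mollifying kernel.\<close>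
  have zero': "(LINT \<xi>|lborel. \<kappa> \<xi> * gauss \<xi> (e n) p) = 0" for n p
    using 0[OF e(2)[of n], of p] unfolding gauss_swap[of p] .
  have meas: "(\<lambda>(\<xi>, p). \<kappa> \<xi> * (\<eta> p * gauss \<xi> (e n) p)) \<in> borel_measurable (lborel \<Otimes>\<^sub>M lborel)" for n
    unfolding gauss_def case_prod_unfold by measurable
  have meas_norm: "(\<lambda>(\<xi>, p). norm (\<kappa> \<xi> * (\<eta> p * gauss \<xi> (e n) p))) \<in> borel_measurable (lborel \<Otimes>\<^sub>M lborel)" for n
    unfolding gauss_def case_prod_unfold by measurable
  have int: "integrable (lborel \<Otimes>\<^sub>M lborel) (\<lambda>(\<xi>, p). \<kappa> \<xi> * (\<eta> p * gauss \<xi> (e n) p))" for n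
  proof (rule lborel_pair.Fubini_integrable)
    show i: "AE \<xi> in lborel. integrable lborel (\<lambda>p. case (\<xi>, p) of (\<xi>, p) \<Rightarrow> \<kappa> \<xi> * (\<eta> p * gauss \<xi> (e n) p))"
    proof (rule AE_I2)
      fix \<xi> :: 'a
      have "integrable lborel (\<lambda>p. \<eta> p * gauss \<xi> (e n) p)"
        by (rule Bochner_Integration.integrable_bound[of _ "\<lambda>p. B * cmod (gauss \<xi> (e n) p)"])
           (use e(2) integrable_norm_gauss B B0 in \<open>auto simp: norm_mult intro!: mult_right_mono\<close>)
      then show "integrable lborel (\<lambda>p. case (\<xi>, p) of (\<xi>, p) \<Rightarrow> \<kappa> \<xi> * (\<eta> p * gauss \<xi> (e n) p))"
        by simp
    qed
    have bd: "norm (LINT p|lborel. norm (\<kappa> \<xi> * (\<eta> p * gauss \<xi> (e n) p))) \<le> norm (B * cmod (\<kappa> \<xi>))" for \<xi>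
    proof -
      have "(LINT p|lborel. norm (\<kappa> \<xi> * (\<eta> p * gauss \<xi> (e n) p))) \<le> (LINT p|lborel. (B * cmod (\<kappa> \<xi>)) * cmod (gauss \<xi> (e n) p))"
        using e(2) B B0 by (intro integral_mono' integrable_mult_right integrable_norm_gauss)
          (auto simp: norm_mult intro!: mult_right_mono[of _ _ "cmod _"] simp flip: mult.assoc, simp add: mult.commute mult_right_mono)
      also have "\<dots> = B * cmod (\<kappa> \<xi>)" by (rule integral_mult_norm_gauss[OF e(2)])
      finally show ?thesis using B0 by simp
    qed
    show "integrable lborel (\<lambda>\<xi>. LINT p|lborel. norm (case (\<xi>, p) of (\<xi>, p) \<Rightarrow> \<kappa> \<xi> * (\<eta> p * gauss \<xi> (e n) p)))"
    proof (rule Bochner_Integration.integrable_bound[where f="\<lambda>\<xi>. B * cmod (\<kappa> \<xi>)"])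
      show "(\<lambda>\<xi>. LINT p|lborel. norm (case (\<xi>, p) of (\<xi>, p) \<Rightarrow> \<kappa> \<xi> * (\<eta> p * gauss \<xi> (e n) p))) \<in> borel_measurable lborel"
        unfolding prod.case by (rule lborel.borel_measurable_lebesgue_integral[OF meas_norm])
    qed (use \<kappa> bd in simp_all)
    show "(\<lambda>(\<xi>, p). \<kappa> \<xi> * (\<eta> p * gauss \<xi> (e n) p)) \<in> borel_measurable (lborel \<Otimes>\<^sub>M lborel)"
      by (rule meas)
  qed
  have z: "(LINT \<xi>|lborel. \<kappa> \<xi> * (LINT p|lborel. \<eta> p * gauss \<xi> (e n) p)) = 0" for n
  proof -
    have "(LINT \<xi>|lborel. \<kappa> \<xi> * (LINT p|lborel. \<eta> p * gauss \<xi> (e n) p)) = (LINT \<xi>|lborel. LINT p|lborel. \<kappa> \<xi> * (\<eta> p * gauss \<xi> (e n) p))"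
      by simp
    also have "\<dots> = (LINT p|lborel. LINT \<xi>|lborel. \<kappa> \<xi> * (\<eta> p * gauss \<xi> (e n) p))"
      using lborel_pair.Fubini_integral[OF int[of n]] by simp
    also have "\<dots> = (LINT p|lborel. \<eta> p * (LINT \<xi>|lborel. \<kappa> \<xi> * gauss \<xi> (e n) p))"
      by (simp add: mult.left_commute)
    also have "\<dots> = 0" using zero'[of n] by simp
    finally show ?thesis .
  qed
  have "(\<lambda>n. LINT \<xi>|lborel. \<kappa> \<xi> * (LINT p|lborel. \<eta> p * gauss \<xi> (e n) p)) \<longlonglongrightarrow> (LINT \<xi>|lborel. \<kappa> \<xi> * \<eta> \<xi>)"
  proof (rule integral_dominated_convergence[where w="\<lambda>\<xi>. B * cmod (\<kappa> \<xi>)"])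
    show "AE \<xi> in lborel. (\<lambda>n. \<kappa> \<xi> * (LINT p|lborel. \<eta> p * gauss \<xi> (e n) p)) \<longlonglongrightarrow> \<kappa> \<xi> * \<eta> \<xi>"
      using gauss_convolution_tendsto[OF \<eta> B e] by (intro AE_I2 tendsto_intros)
    have "cmod (LINT p|lborel. \<eta> p * gauss \<xi> (e n) p) \<le> (LINT p|lborel. B * cmod (gauss \<xi> (e n) p))" for n \<xi>
      using e(2) B B0 by (intro order_trans[OF integral_norm_bound] integral_mono' integrable_mult_right integrable_norm_gauss)
        (auto simp: norm_mult intro!: mult_right_mono)
    then have bd: "cmod (LINT p|lborel. \<eta> p * gauss \<xi> (e n) p) \<le> B" for n \<xi>
      by (simp only: integral_mult_norm_gauss[OF e(2)])
    show "AE \<xi> in lborel. cmod (\<kappa> \<xi> * (LINT p|lborel. \<eta> p * gauss \<xi> (e n) p)) \<le> B * cmod (\<kappa> \<xi>)" for n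
      unfolding norm_mult mult.commute[of B] by (intro AE_I2 mult_left_mono bd norm_ge_zero)
    show "integrable lborel (\<lambda>\<xi>. B * cmod (\<kappa> \<xi>))" using \<kappa> by (intro integrable_mult_right integrable_norm)
    have m: "(\<lambda>(\<xi>, p). \<eta> p * gauss \<xi> (e n) p) \<in> borel_measurable (lborel \<Otimes>\<^sub>M (lborel :: 'a measure))" for n
      unfolding gauss_def case_prod_unfold by measurable
    show "(\<lambda>\<xi>. \<kappa> \<xi> * (LINT p|lborel. \<eta> p * gauss \<xi> (e n) p)) \<in> borel_measurable lborel" for n
      using lborel.borel_measurable_lebesgue_integral[OF m[of n]] by (intro borel_measurable_times) simp_all
    show "(\<lambda>\<xi>. \<kappa> \<xi> * \<eta> \<xi>) \<in> borel_measurable lborel" by simp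
  qed
  from LIMSEQ_unique[OF this[unfolded z] tendsto_const] show ?thesis .
qed

lemma Int_stable_closed: "Int_stable (Collect closed)"
  by (auto simp: Int_stable_def)

text \<open>Closed sets are stable under intersection and generate the Borel sets, so vanishing
  integrals spread to all Borel sets through complements and disjoint unions.\<close>

lemma AE_eq_0_if_integral_closed:
  fixes \<kappa> :: "'a::euclidean_space \<Rightarrow> complex"
  assumes \<kappa>: "integrable lborel \<kappa>"
    and 0: "\<And>C. closed C \<Longrightarrow> (LINT x:C|lborel. \<kappa> x) = 0"
  shows "AE x in lborel. \<kappa> x = 0"
proof (rule sigma_finite_measure.density_zero[OF lborel.sigma_finite_measure_axioms \<kappa>])
  have int: "set_integrable lborel A \<kappa>" if "A \<in> sets borel" for A
    unfolding set_integrable_def using that by (intro integrable_mult_indicator \<kappa>) simp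
  fix A :: "'a set" assume "A \<in> sets lborel"
  then have A: "A \<in> sigma_sets UNIV (Collect closed)" by (simp add: borel_eq_closed)
  show "(LINT x:A|lborel. \<kappa> x) = 0"
  proof (rule sigma_sets_induct_disjoint[OF Int_stable_closed _ A])
    fix A :: "'a set" assume "A \<in> sigma_sets UNIV (Collect closed)" and A0: "(LINT x:A|lborel. \<kappa> x) = 0"
    then have A: "A \<in> sets borel" by (simp add: borel_eq_closed)
    have "(LINT x:A \<union> (UNIV - A)|lborel. \<kappa> x) = (LINT x:A|lborel. \<kappa> x) + (LINT x:(UNIV - A)|lborel. \<kappa> x)"
      using A by (intro set_integral_Un int) auto
    then show "(LINT x:(UNIV - A)|lborel. \<kappa> x) = 0" using 0[of UNIV] A0 by simp
  next
    fix A :: "nat \<Rightarrow> 'a set"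
    assume dj: "disjoint_family A" and "range A \<subseteq> sigma_sets UNIV (Collect closed)" and A0: "\<And>i. (LINT x:A i|lborel. \<kappa> x) = 0"
    then have A: "A i \<in> sets borel" for i by (auto simp: borel_eq_closed)
    have "(LINT x:(\<Union>i. A i)|lborel. \<kappa> x) = (\<Sum>i. (LINT x:(A i)|lborel. \<kappa> x))"
      by (intro lebesgue_integral_countable_add int) (use A dj in \<open>auto simp: disjoint_family_on_def\<close>)
    then show "(LINT x:(\<Union>i. A i)|lborel. \<kappa> x) = 0" using A0 by simp
  qed (use 0 in \<open>simp_all add: set_lebesgue_integral_def\<close>)
qed

text \<open>\<open>k\<close> itself need not be integrable. Multiplying it by a Gaussian makes it
  so, keeps the orthogonality to Gaussians because products of Gaussians are Schwartz, and loses
  nothing because a Gaussian has no zeros.\<close>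

lemma AE_eq_0_if_orthogonal_schwartz:
  fixes k :: "'a::euclidean_space \<Rightarrow> complex"
  assumes [measurable]: "k \<in> borel_measurable borel"
    and k: "\<And>\<phi>. \<phi> \<in> schwartz \<Longrightarrow> integrable lborel (\<lambda>x. k x * \<phi> x)"
    and 0: "\<And>\<phi>. \<phi> \<in> schwartz \<Longrightarrow> (LINT x|lborel. k x * \<phi> x) = 0"
  shows "AE x in lborel. k x = 0"
proof -
  define \<kappa> where "\<kappa> x = k x * gauss 0 1 x" for x
  have \<kappa>: "integrable lborel \<kappa>"
    unfolding \<kappa>_def by (intro k gaussian_class_schwartz gauss_gaussian_class) simp
  have \<kappa>0: "(LINT \<xi>|lborel. \<kappa> \<xi> * gauss p e \<xi>) = 0" if "e > 0" for p e
    using 0[OF gaussian_class_schwartz[OF gaussian_class_mult[OF gauss_gaussian_class[of 1 0] gauss_gaussian_class[OF that, of p]]]]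
    by (simp add: \<kappa>_def mult.assoc)
  have "(LINT x:C|lborel. \<kappa> x) = 0" if "closed C" for C
  proof (cases "C = {}")
    case False
    \<comment> \<open>Continuous functions decreasing to the indicator of \<open>C\<close>; at a
      point off \<open>C\<close> they vanish eventually, since \<open>infdist x C\<close> is
      positive there.\<close>
    define \<eta> :: "nat \<Rightarrow> 'a \<Rightarrow> complex" where "\<eta> n x = of_real (max 0 (1 - real n * infdist x C))" for n x
    have \<eta>c: "continuous_on UNIV (\<eta> n)" for n unfolding \<eta>_def by (intro continuous_intros)
    have \<eta>b: "cmod (\<eta> n x) \<le> 1" for n x unfolding \<eta>_def by (simp add: infdist_nonneg)
    have "(\<lambda>n. \<eta> n x) \<longlonglongrightarrow> indicator C x" for x
    proof (cases "x \<in> C")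
      case True
      then show ?thesis by (simp add: \<eta>_def)
    next
      case F: False
      then have pos: "infdist x C > 0" 
        using infdist_pos_not_in_closed[OF that False] by auto
      obtain N where N: "real N * infdist x C > 1" using reals_Archimedean3[OF pos] by blast
      have "\<eta> n x = 0" if "n \<ge> N" for n
      proof -
        have "real N * infdist x C \<le> real n * infdist x C" using that infdist_nonneg by (intro mult_right_mono) auto
        with N have "1 - real n * infdist x C \<le> 0" by simp
        then show ?thesis by (simp add: \<eta>_def max_absorb1)
      qed
      then have "eventually (\<lambda>n. \<eta> n x = 0) sequentially" by (auto simp: eventually_sequentially)
      then show ?thesis using F by (simp add: tendsto_eventually)
    qed
    then have "(\<lambda>n. LINT x|lborel. \<kappa> x * \<eta> n x) \<longlonglongrightarrow> (LINT x|lborel. \<kappa> x * indicator C x)"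
      using \<kappa> \<eta>b \<eta>c[THEN borel_measurable_continuous_onI] borel_measurable_integrable[OF \<kappa>] that
      by (intro integral_dominated_convergence[where w="\<lambda>x. cmod (\<kappa> x)"])
         (auto simp: norm_mult mult_left_le intro!: tendsto_intros AE_I2)
    moreover have "(LINT x|lborel. \<kappa> x * \<eta> n x) = 0" for n
      by (rule integral_test_gaussians_eq_0[OF \<kappa> \<kappa>0 \<eta>c \<eta>b])
    ultimately have "(LINT x|lborel. \<kappa> x * indicator C x) = 0"
      using LIMSEQ_unique[OF _ tendsto_const] by fastforce
    moreover have "\<kappa> x * indicator C x = indicat_real C x *\<^sub>R \<kappa> x" for x by (auto simp: indicator_def)
    ultimately show ?thesis by (simp add: set_lebesgue_integral_def)
  qed (simp add: set_lebesgue_integral_def)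
  then have "AE x in lborel. \<kappa> x = 0" by (rule AE_eq_0_if_integral_closed[OF \<kappa>])
  then show ?thesis by eventually_elim (simp add: \<kappa>_def gauss_def)
qed

lemma has_fourier_transformD:
  assumes "has_fourier_transform u g" "\<phi> \<in> schwartz"
  shows "integrable lborel (\<lambda>x. g x * \<phi> x)" "u (fourier \<phi>) = (LINT x|lborel. g x * \<phi> x)"
  using assms unfolding has_fourier_transform_def by blast+

lemma has_fourier_transform_unique:
  assumes "has_fourier_transform u g" "has_fourier_transform u h"
  shows "AE x in lborel. g x = h x"
proof -
  have "AE x in lborel. g x - h x = 0"
  proof (rule AE_eq_0_if_orthogonal_schwartz)
    fix \<phi> :: "'a \<Rightarrow> complex" assume \<phi>: "\<phi> \<in> schwartz"
    note D = has_fourier_transformD[OF assms(1) \<phi>] has_fourier_transformD[OF assms(2) \<phi>]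
    show "integrable lborel (\<lambda>x. (g x - h x) * \<phi> x)"
      unfolding left_diff_distrib using D by (intro Bochner_Integration.integrable_diff)
    show "(LINT x|lborel. (g x - h x) * \<phi> x) = 0"
      unfolding left_diff_distrib Bochner_Integration.integral_diff[OF D(1) D(3)] D(2,4)[symmetric] by simp
  qed (use assms in \<open>auto simp: has_fourier_transform_def\<close>)
  then show ?thesis by simp
qed

text \<open>Records Fourier inversion as data: \<phi> is the inverse transform of \<open>f\<close>,
  and transforming \<open>f\<close> gives back the reflection of \<phi>. Both facts are explicit for
  \<open>gauss\<close> and survive linear combinations.\<close>

definition gaussian_pair :: "('a::euclidean_space \<Rightarrow> complex) \<Rightarrow> ('a \<Rightarrow> complex) \<Rightarrow> bool" where
  "gaussian_pair f \<phi> \<longleftrightarrow> f \<in> gaussian_class \<and> \<phi> \<in> gaussian_class \<and>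
     fourier \<phi> = f \<and> (\<forall>\<xi>. fourier f \<xi> = \<phi> (- \<xi>))"

lemma gaussian_pair_gauss: "e > 0 \<Longrightarrow> gaussian_pair (gauss p e) (gauss_hat p e)"
  by (simp add: gaussian_pair_def gauss_gaussian_class gauss_hat_gaussian_class fourier_gauss fourier_gauss_hat)

lemma integrable_cis_times:
  assumes "integrable lborel f"
  shows "integrable lborel (\<lambda>x. cis (- 2 * pi * (x \<bullet> \<xi>)) * f x)"
proof (rule Bochner_Integration.integrable_bound[OF assms])
  show "(\<lambda>x. cis (- 2 * pi * (x \<bullet> \<xi>)) * f x) \<in> borel_measurable lborel"
    using borel_measurable_integrable[OF assms]
    by (intro borel_measurable_times) (auto intro!: borel_measurable_continuous_onI continuous_intros)
qed (simp add: norm_mult)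

lemma fourier_add: 
  assumes "integrable lborel f" "integrable lborel g"
  shows "fourier (\<lambda>x. f x + g x) \<xi> = fourier f \<xi> + fourier g \<xi>"
  unfolding fourier_def distrib_left
  by (intro Bochner_Integration.integral_add integrable_cis_times assms)

lemma fourier_cmult: "fourier (\<lambda>x. c * f x) \<xi> = c * fourier f \<xi>"
  unfolding fourier_def by (simp add: mult.left_commute)

lemma gaussian_pair_add:
  assumes "gaussian_pair f \<phi>" "gaussian_pair g \<psi>"
  shows "gaussian_pair (\<lambda>x. f x + g x) (\<lambda>x. \<phi> x + \<psi> x)"
  using assms unfolding gaussian_pair_def
  by (auto intro: gaussian_class.add simp: fourier_add gaussian_class_integrable fun_eq_iff)

lemma gaussian_pair_cmult:
  assumes "gaussian_pair f \<phi>"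
  shows "gaussian_pair (\<lambda>x. c * f x) (\<lambda>x. c * \<phi> x)"
  using assms unfolding gaussian_pair_def
  by (auto intro: gaussian_class.cmult simp: fourier_cmult fun_eq_iff)

lemma gaussian_pair_diff:
  assumes "gaussian_pair f \<phi>" "gaussian_pair g \<psi>"
  shows "gaussian_pair (\<lambda>x. f x - g x) (\<lambda>x. \<phi> x - \<psi> x)"
  using gaussian_pair_add[OF assms(1) gaussian_pair_cmult[OF assms(2), of "-1"]] by simp

definition functional_of :: "('a::euclidean_space \<Rightarrow> complex) \<Rightarrow> 'a functional" where
  "functional_of f = (\<lambda>\<psi>. LINT x|lborel. f x * \<psi> x)"

lemma integrable_times_schwartz:
  assumes "integrable lborel f" "\<phi> \<in> schwartz"
  shows "integrable lborel (\<lambda>x. f x * \<phi> x)"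
  by (rule integrable_mult_bounded[OF assms(1) _ schwartz_seminorm_bound[OF assms(2)]])
     (simp add: schwartz_measurable[OF assms(2)])

lemma tempered_functional_of:
  assumes f: "integrable lborel f"
  shows "tempered (functional_of f)"
proof -
  have "cmod (functional_of f \<phi>) \<le> (LINT x|lborel. cmod (f x)) * schwartz_seminorm 0 \<phi>" if \<phi>: "\<phi> \<in> schwartz" for \<phi>
  proof -
    have "cmod (functional_of f \<phi>) \<le> (LINT x|lborel. cmod (f x * \<phi> x))"
      unfolding functional_of_def by (rule integral_norm_bound)
    also have "\<dots> \<le> (LINT x|lborel. cmod (f x) * schwartz_seminorm 0 \<phi>)"
      unfolding norm_mult using f integrable_norm[OF integrable_times_schwartz[OF f \<phi>]]
      by (intro integral_mono mult_left_mono schwartz_seminorm_bound[OF \<phi>] norm_ge_zero) (auto simp: norm_mult)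
    finally show ?thesis by simp
  qed
  moreover have "functional_of f (\<lambda>x. \<phi> x + \<psi> x) = functional_of f \<phi> + functional_of f \<psi>"
    if "\<phi> \<in> schwartz" "\<psi> \<in> schwartz" for \<phi> \<psi>
    unfolding functional_of_def distrib_left
    by (intro Bochner_Integration.integral_add integrable_times_schwartz f that)
  moreover have "functional_of f (\<lambda>x. c * \<phi> x) = c * functional_of f \<phi>" for c \<phi>
    unfolding functional_of_def by (simp add: mult.left_commute)
  ultimately show ?thesis unfolding tempered_def by metis
qed

text \<open>The multiplication formula: by Fubini a Fourier transform may be moved from one factor
  of an integral to the other. The reflection comes from
  \<open>fourier f \<xi> = \<phi> (- \<xi>)\<close>.\<close>

lemma has_fourier_transform_functional_of:
  fixes f :: "'a::euclidean_space \<Rightarrow> complex"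
  assumes "gaussian_pair f \<phi>"
  shows "has_fourier_transform (functional_of f) (\<lambda>\<xi>. \<phi> (- \<xi>))"
proof -
  have f: "integrable lborel f" and [measurable]: "f \<in> borel_measurable borel" "\<phi> \<in> borel_measurable borel"
    and g: "integrable lborel (\<lambda>\<xi>. \<phi> (- \<xi>))"
    using assms gaussian_class_integrable gaussian_class_measurable lborel_integrable_affine[of "-1" \<phi> 0] by (auto simp: gaussian_pair_def)
  have "functional_of f (fourier \<psi>) = (LINT \<xi>|lborel. \<phi> (- \<xi>) * \<psi> \<xi>)" if \<psi>: "\<psi> \<in> schwartz" for \<psi>
  proof -
    have [measurable]: "\<psi> \<in> borel_measurable borel" using schwartz_measurable[OF \<psi>] .
    have [measurable]: "cis \<in> borel_measurable borel" by (intro borel_measurable_continuous_onI continuous_intros)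
    have int: "integrable (lborel \<Otimes>\<^sub>M lborel) (\<lambda>(x, y). cis (- 2 * pi * (x \<bullet> y)) * (f x * \<psi> y))"
      by (rule integrable_pair_bound[of _ "\<lambda>x. cmod (f x)" "\<lambda>x. cmod (\<psi> x)"])
         (use f schwartz_integrable[OF \<psi>] in \<open>simp_all add: norm_mult\<close>)
    have "functional_of f (fourier \<psi>) = (LINT x|lborel. LINT y|lborel. cis (- 2 * pi * (x \<bullet> y)) * (f x * \<psi> y))"
      unfolding functional_of_def fourier_def integral_mult_right_zero[symmetric]
      by (simp add: inner_commute mult_ac)
    also have "\<dots> = (LINT y|lborel. LINT x|lborel. cis (- 2 * pi * (x \<bullet> y)) * (f x * \<psi> y))"
      by (rule lborel_pair.Fubini_integral[OF int, symmetric])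
    also have "\<dots> = (LINT y|lborel. fourier f y * \<psi> y)"
      unfolding fourier_def integral_mult_left_zero[symmetric] by (simp add: mult_ac)
    finally show ?thesis using assms by (simp add: gaussian_pair_def)
  qed
  then show ?thesis
    unfolding has_fourier_transform_def using integrable_times_schwartz[OF g] by simp
qed

section \<open>Sobolev norms of negative order and the duality pairing\<close>

definition sobolev_energy :: "real \<Rightarrow> ('a::euclidean_space \<Rightarrow> complex) \<Rightarrow> real" where
  "sobolev_energy a \<phi> = (LINT \<xi>|lborel. sobolev_density (- a) \<phi> \<xi>)"

lemma sobolev_density_measurable [measurable]:
  "g \<in> borel_measurable borel \<Longrightarrow> sobolev_density s g \<in> borel_measurable borel"
  unfolding sobolev_density_def[abs_def] by measurable

lemma sobolev_density_nonneg: "sobolev_density s g x \<ge> 0"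
  by (simp add: sobolev_density_def)

lemma integrable_sobolev_density:
  fixes \<phi> :: "'a::euclidean_space \<Rightarrow> complex"
  assumes \<phi>: "\<phi> \<in> gaussian_class" and "a \<ge> 0"
  shows "integrable lborel (sobolev_density (- a) \<phi>)"
proof (rule Bochner_Integration.integrable_bound)
  show "integrable lborel (\<lambda>\<xi>. \<phi> \<xi> * \<phi> \<xi>)"
    by (intro gaussian_class_integrable gaussian_class_mult \<phi>)
  have "(1 + (norm \<xi>)\<^sup>2) powr (- a) \<le> 1" for \<xi> :: 'a
    using powr_mono[of "-a" 0 "1 + (norm \<xi>)\<^sup>2"] assms(2) by (simp split: if_splits)
  then show "AE \<xi> in lborel. norm (sobolev_density (- a) \<phi> \<xi>) \<le> norm (\<phi> \<xi> * \<phi> \<xi>)"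
    by (intro AE_I2) (simp add: sobolev_density_def norm_mult power2_eq_square mult_left_le_one_le)
qed (use gaussian_class_measurable[OF \<phi>] in simp)

lemma integral_cauchy_schwarz:
  fixes f g :: "'a \<Rightarrow> real"
  assumes [measurable]: "f \<in> borel_measurable M" "g \<in> borel_measurable M"
    and "integrable M (\<lambda>x. (f x)\<^sup>2)" "integrable M (\<lambda>x. (g x)\<^sup>2)" "integrable M (\<lambda>x. f x * g x)"
    and "\<And>x. f x \<ge> 0" "\<And>x. g x \<ge> 0"
  shows "(LINT x|M. f x * g x) \<le> sqrt (LINT x|M. (f x)\<^sup>2) * sqrt (LINT x|M. (g x)\<^sup>2)"
proof -
  have "(\<integral>\<^sup>+x. ennreal (f x) * ennreal (g x) \<partial>M)\<^sup>2 \<le> (\<integral>\<^sup>+x. (ennreal (f x))\<^sup>2 \<partial>M) * (\<integral>\<^sup>+x. (ennreal (g x))\<^sup>2 \<partial>M)"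
    by (rule Cauchy_Schwarz_nn_integral) auto
  also have "(\<integral>\<^sup>+x. ennreal (f x) * ennreal (g x) \<partial>M) = ennreal (LINT x|M. f x * g x)"
    using assms by (subst nn_integral_eq_integral[symmetric]) (auto simp: ennreal_mult)
  also have "(\<integral>\<^sup>+x. (ennreal (f x))\<^sup>2 \<partial>M) = ennreal (LINT x|M. (f x)\<^sup>2)"
    using assms by (subst nn_integral_eq_integral[symmetric]) (auto simp: ennreal_power)
  also have "(\<integral>\<^sup>+x. (ennreal (g x))\<^sup>2 \<partial>M) = ennreal (LINT x|M. (g x)\<^sup>2)"
    using assms by (subst nn_integral_eq_integral[symmetric]) (auto simp: ennreal_power)
  finally have "(LINT x|M. f x * g x)\<^sup>2 \<le> (LINT x|M. (f x)\<^sup>2) * (LINT x|M. (g x)\<^sup>2)"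
    using assms by (simp add: ennreal_power integral_nonneg_AE flip: ennreal_mult)
  then show ?thesis
    by (metis real_le_rsqrt real_sqrt_mult)
qed

lemma sobolev_norm_eq:
  assumes "has_fourier_transform u g"
  shows "sobolev_norm s u = sqrt (LINT \<xi>|lborel. sobolev_density s g \<xi>)"
proof -
  define g' where "g' = (SOME g. has_fourier_transform u g)"
  have g': "has_fourier_transform u g'" unfolding g'_def by (rule someI[of "has_fourier_transform u", OF assms])
  have [measurable]: "g \<in> borel_measurable borel" "g' \<in> borel_measurable borel"
    using assms g' by (auto simp: has_fourier_transform_def)
  have "AE \<xi> in lborel. sobolev_density s g' \<xi> = sobolev_density s g \<xi>"
    using has_fourier_transform_unique[OF g' assms] by eventually_elim (simp add: sobolev_density_def)
  then have "(LINT \<xi>|lborel. sobolev_density s g' \<xi>) = (LINT \<xi>|lborel. sobolev_density s g \<xi>)"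
    by (intro integral_cong_AE) simp_all
  then show ?thesis unfolding sobolev_norm_def g'_def by simp
qed

lemma sobolev_functional_of:
  fixes f :: "'a::euclidean_space \<Rightarrow> complex"
  assumes f: "gaussian_pair f \<phi>" and "a \<ge> 0"
  shows "functional_of f \<in> sobolev (- a)" "sobolev_norm (- a) (functional_of f) = sqrt (sobolev_energy a \<phi>)"
proof -
  note h = has_fourier_transform_functional_of[OF f]
  have f': "f \<in> gaussian_class" "\<phi> \<in> gaussian_class" using f by (auto simp: gaussian_pair_def)
  \<comment> \<open>The transform of \<open>functional_of f\<close> is a reflection of \<phi>, but
    the weight is even and Lebesgue measure is invariant under reflection, so the energy of \<phi>
    itself appears.\<close>
  have eq: "sobolev_density (- a) (\<lambda>\<xi>. \<phi> (- \<xi>)) \<xi> = sobolev_density (- a) \<phi> (0 + (- 1) *\<^sub>R \<xi>)" for \<xi>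
    by (simp add: sobolev_density_def)
  have "integrable lborel (sobolev_density (- a) (\<lambda>\<xi>. \<phi> (- \<xi>)))"
    unfolding eq using integrable_sobolev_density[OF f'(2) assms(2)] gaussian_class_measurable[OF f'(2)]
    by (subst lborel_integrable_affine) simp_all
  then show "functional_of f \<in> sobolev (- a)"
    unfolding sobolev_def using h tempered_functional_of[OF gaussian_class_integrable[OF f'(1)]] by blast
  have "(LINT \<xi>|lborel. sobolev_density (- a) (\<lambda>\<xi>. \<phi> (- \<xi>)) \<xi>) = sobolev_energy a \<phi>"
    unfolding eq sobolev_energy_def using gaussian_class_measurable[OF f'(2)]
    by (subst lborel_integral_affine) simp_all
  then show "sobolev_norm (- a) (functional_of f) = sqrt (sobolev_energy a \<phi>)"
    using sobolev_norm_eq[OF h] by simp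
qed

text \<open>Duality of the orders \<open>a\<close> and \<open>- a\<close>. Since
  \<open>h = fourier \<psi>\<close>, the value at \<open>h\<close> is the integral of \<psi> against
  the transform \<open>g\<close> of the image functional; distributing the weight as
  \<open>a / 2\<close> and \<open>- a / 2\<close> over the two factors and applying Cauchy-Schwarz
  yields the two norms.\<close>

lemma sobolev_bounded_pairing:
  fixes T :: "'a::euclidean_space functional \<Rightarrow> 'a functional"
  assumes T: "sobolev_bounded T (- a) a C" and "a \<ge> 0"
    and f: "gaussian_pair f \<phi>" and h: "gaussian_pair h \<psi>"
  shows "cmod (T (functional_of f) h) \<le> C * (sqrt (sobolev_energy a \<phi>) * sqrt (sobolev_energy a \<psi>))"
proof -
  have h': "\<psi> \<in> gaussian_class" "h = fourier \<psi>" using h by (auto simp: gaussian_pair_def)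
  define v where "v = T (functional_of f)"
  have v: "v \<in> sobolev a" "sobolev_norm a v \<le> C * sqrt (sobolev_energy a \<phi>)"
    using T sobolev_functional_of[OF f assms(2)] unfolding sobolev_bounded_def v_def by auto
  then obtain g where g: "has_fourier_transform v g" "integrable lborel (sobolev_density a g)"
    unfolding sobolev_def by blast
  have [measurable]: "g \<in> borel_measurable borel" "\<psi> \<in> borel_measurable borel"
    using g(1) gaussian_class_measurable[OF h'(1)] by (auto simp: has_fourier_transform_def)
  note D = has_fourier_transformD[OF g(1) gaussian_class_schwartz[OF h'(1)]]
  let ?w = "\<lambda>s \<xi>::'a. (1 + (norm \<xi>)\<^sup>2) powr (s / 2)"
  have sq: "(?w s \<xi> * cmod (k \<xi>))\<^sup>2 = sobolev_density s k \<xi>" for s k \<xi>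
    unfolding sobolev_density_def power_mult_distrib
    by (simp add: power2_eq_square powr_add[symmetric])
  have prod: "(?w a \<xi> * cmod (g \<xi>)) * (?w (- a) \<xi> * cmod (\<psi> \<xi>)) = cmod (g \<xi> * \<psi> \<xi>)" for \<xi>
  proof -
    have "1 + (norm \<xi>)\<^sup>2 > 0" by (simp add: add_pos_nonneg)
    then have "?w a \<xi> * ?w (- a) \<xi> = 1" by (simp add: powr_add[symmetric])
    then have "(?w a \<xi> * ?w (- a) \<xi>) * (cmod (g \<xi>) * cmod (\<psi> \<xi>)) = cmod (g \<xi> * \<psi> \<xi>)" by (simp add: norm_mult)
    then show ?thesis by (simp only: mult_ac)
  qed
  have "cmod (T (functional_of f) h) = cmod (LINT \<xi>|lborel. g \<xi> * \<psi> \<xi>)"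
    using D(2) by (simp add: v_def h'(2))
  also have "\<dots> \<le> (LINT \<xi>|lborel. cmod (g \<xi> * \<psi> \<xi>))" by (rule integral_norm_bound)
  also have "\<dots> = (LINT \<xi>|lborel. (?w a \<xi> * cmod (g \<xi>)) * (?w (- a) \<xi> * cmod (\<psi> \<xi>)))"
    by (simp only: prod)
  also have "\<dots> \<le> sqrt (LINT \<xi>|lborel. (?w a \<xi> * cmod (g \<xi>))\<^sup>2) * sqrt (LINT \<xi>|lborel. (?w (- a) \<xi> * cmod (\<psi> \<xi>))\<^sup>2)"
  proof (rule integral_cauchy_schwarz)
    show "integrable lborel (\<lambda>\<xi>. (?w a \<xi> * cmod (g \<xi>))\<^sup>2)" unfolding sq using g(2) .
    show "integrable lborel (\<lambda>\<xi>. (?w (- a) \<xi> * cmod (\<psi> \<xi>))\<^sup>2)" 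
      unfolding sq using integrable_sobolev_density[OF h'(1) assms(2)] .
    show "integrable lborel (\<lambda>\<xi>. (?w a \<xi> * cmod (g \<xi>)) * (?w (- a) \<xi> * cmod (\<psi> \<xi>)))"
      unfolding prod using D(1) by (rule integrable_norm)
  qed simp_all
  also have "\<dots> = sobolev_norm a v * sqrt (sobolev_energy a \<psi>)"
    unfolding sq sobolev_norm_eq[OF g(1)] sobolev_energy_def by simp
  also have "\<dots> \<le> C * sqrt (sobolev_energy a \<phi>) * sqrt (sobolev_energy a \<psi>)"
    using v(2) by (intro mult_right_mono real_sqrt_ge_zero) (auto simp: sobolev_energy_def sobolev_density_nonneg integral_nonneg_AE)
  finally show ?thesis by (simp add: mult.assoc)
qed

section \<open>Densities of push-forwards under submersions\<close>

definition test_continuous :: "('a::topological_space \<Rightarrow> 'b::real_normed_vector) \<Rightarrow> bool" where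
  "test_continuous f \<longleftrightarrow> continuous_on UNIV f \<and> (\<exists>K. compact K \<and> (\<forall>x. x \<notin> K \<longrightarrow> f x = 0))"

lemma test_continuousI:
  assumes "continuous_on UNIV f" "compact K" "\<And>x. x \<notin> K \<Longrightarrow> f x = 0"
  shows "test_continuous f"
  using assms unfolding test_continuous_def by blast

text \<open>\<open>U\<close> and the complement of \<open>K\<close> form an open cover, and
  \<open>f\<close> is zero on the latter. Used for functions given by a formula on an open set and
  extended by zero.\<close>

lemma test_continuous_glue:
  fixes f :: "'a::t2_space \<Rightarrow> 'b::real_normed_vector"
  assumes "open U" "continuous_on U f" "compact K" "K \<subseteq> U" "\<And>x. x \<notin> K \<Longrightarrow> f x = 0"
  shows "test_continuous f"
proof (rule test_continuousI[OF _ assms(3,5)])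
  have "continuous_on (- K) (\<lambda>_. 0 :: 'b)" by simp
  then have "continuous_on (- K) f" by (rule continuous_on_eq) (use assms(5) in auto)
  moreover have "open (- K)" using assms(3) by (simp add: compact_imp_closed open_Compl)
  ultimately have "continuous_on (U \<union> - K) f" using assms by (intro continuous_on_open_Un) auto
  then show "continuous_on UNIV f" using assms(4) by (metis Compl_partition2 Un_commute compl_le_compl_iff sup.absorb_iff2 sup_top_left Un_UNIV_left Compl_partition subset_UNIV sup_assoc)
qed

lemma test_continuous_bounded:
  assumes "test_continuous f"
  obtains B where "B \<ge> 0" "\<And>x. norm (f x) \<le> B"
proof -
  obtain K where K: "compact K" "\<And>x. x \<notin> K \<Longrightarrow> f x = 0" "continuous_on UNIV f"
    using assms unfolding test_continuous_def by blast
  have "compact (f ` K)" using K by (intro compact_continuous_image continuous_on_subset[OF K(3)]) auto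
  then obtain B where B: "\<And>x. x \<in> K \<Longrightarrow> norm (f x) \<le> B" by (meson bounded_iff compact_imp_bounded imageI)
  have "norm (f x) \<le> max 0 B" for x
    using B[of x] K(2)[of x] by (cases "x \<in> K") auto
  then show ?thesis by (intro that[of "max 0 B"]) auto
qed

lemma test_continuous_measurable: "test_continuous f \<Longrightarrow> f \<in> borel_measurable borel"
  unfolding test_continuous_def by (auto intro: borel_measurable_continuous_onI)

lemma test_continuous_integrable:
  fixes f :: "'a::euclidean_space \<Rightarrow> 'b::euclidean_space"
  assumes "test_continuous f"
  shows "integrable lborel f"
proof -
  obtain K where K: "compact K" "\<And>x. x \<notin> K \<Longrightarrow> f x = 0" "continuous_on UNIV f"
    using assms unfolding test_continuous_def by blast
  have "integrable lborel (\<lambda>x. indicator K x *\<^sub>R f x)"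
    using K by (intro borel_integrable_compact continuous_on_subset[OF K(3)]) auto
  also have "(\<lambda>x. indicator K x *\<^sub>R f x) = f" using K(2) by (auto simp: fun_eq_iff indicator_def)
  finally show ?thesis .
qed

lemma integrable_test_continuous_mult:
  fixes f g :: "'a::euclidean_space \<Rightarrow> 'b::{real_normed_field, euclidean_space}"
  assumes f: "test_continuous f" and g: "g \<in> borel_measurable borel" and B: "\<And>x. norm (g x) \<le> B"
  shows "integrable lborel (\<lambda>x. f x * g x)"
  by (rule integrable_mult_bounded[OF test_continuous_integrable[OF f] _ B]) (use g in simp)

text \<open>\<open>h\<close> is a continuous left inverse of \<open>g\<close>, so the composite is
  supported in the image under \<open>h\<close> of the compact support of \<open>f\<close>. Slices
  and regroupings of variables are instances.\<close>

lemma test_continuous_embed: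
  fixes f :: "'a::t2_space \<Rightarrow> 'c::real_normed_vector"
  assumes f: "test_continuous f" and g: "continuous_on UNIV g" and h: "continuous_on UNIV h"
    and hg: "\<And>w. h (g w) = w"
  shows "test_continuous (\<lambda>w. f (g w))"
proof -
  obtain K where K: "compact K" "\<And>x. x \<notin> K \<Longrightarrow> f x = 0" "continuous_on UNIV f"
    using f unfolding test_continuous_def by blast
  show ?thesis
  proof (rule test_continuousI[of _ "h ` K"])
    show "continuous_on UNIV (\<lambda>w. f (g w))" by (intro continuous_on_compose2[OF K(3) g]) auto
    show "compact (h ` K)" by (intro compact_continuous_image K continuous_on_subset[OF h]) auto
    show "f (g w) = 0" if "w \<notin> h ` K" for w using that hg[of w] by (intro K(2)) (metis image_eqI)
  qed
qed

lemma test_continuous_slice: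
  fixes f :: "'a::t2_space \<times> 'b::t2_space \<Rightarrow> 'c::real_normed_vector"
  assumes "test_continuous f"
  shows "test_continuous (\<lambda>y. f (x, y))" "test_continuous (\<lambda>x. f (x, z))"
  by (rule test_continuous_embed[OF assms, where h=snd], auto intro!: continuous_intros)
     (rule test_continuous_embed[OF assms, where h=fst], auto intro!: continuous_intros)

lemma test_continuous_mult:
  fixes J :: "'a::t2_space \<Rightarrow> 'b::real_normed_algebra"
  assumes "continuous_on UNIV g" "test_continuous J"
  shows "test_continuous (\<lambda>w. g w * J w)"
proof -
  obtain K where K: "compact K" "\<And>w. w \<notin> K \<Longrightarrow> J w = 0" "continuous_on UNIV J"
    using assms(2) unfolding test_continuous_def by blast
  show ?thesis
    by (rule test_continuousI[OF _ K(1)]) (auto simp: K(2) intro!: continuous_on_mult assms(1) K(3))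
qed

lemma test_continuous_mult_fst:
  fixes J :: "'a::t2_space \<times> 'b::t2_space \<Rightarrow> 'c::real_normed_algebra"
  assumes "continuous_on UNIV f" "test_continuous J"
  shows "test_continuous (\<lambda>(x, t). f x * J (x, t))"
proof -
  have "continuous_on UNIV (\<lambda>w::'a \<times> 'b. f (fst w))"
    by (intro continuous_on_compose2[OF assms(1)] continuous_intros) auto
  from test_continuous_mult[OF this assms(2)] show ?thesis by (simp add: case_prod_unfold)
qed

text \<open>Dominated convergence: all slices are bounded by one constant and supported in the
  projection of one compact set.\<close>

lemma test_continuous_integral:
  fixes f :: "'a::euclidean_space \<times> 'b::euclidean_space \<Rightarrow> 'c::euclidean_space"
  assumes f: "test_continuous f"
  shows "test_continuous (\<lambda>y. LINT x|lborel. f (x, y))"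
proof -
  obtain K where K: "compact K" "\<And>x. x \<notin> K \<Longrightarrow> f x = 0" "continuous_on UNIV f"
    using f unfolding test_continuous_def by blast
  obtain B where B: "B \<ge> 0" "\<And>x. norm (f x) \<le> B" using test_continuous_bounded[OF f] by metis
  have c: "compact (snd ` K)" "compact (fst ` K)" using K(1) by (auto intro!: compact_continuous_image continuous_intros)
  show ?thesis
  proof (rule test_continuousI[OF _ c(1)])
    show "(LINT x|lborel. f (x, y)) = 0" if "y \<notin> snd ` K" for y
    proof -
      have "f (x, y) = 0" for x using that by (intro K(2)) force
      then show ?thesis by simp
    qed
    show "continuous_on UNIV (\<lambda>y. LINT x|lborel. f (x, y))"
    proof (rule continuous_on_sequentiallyI)
      fix u :: "nat \<Rightarrow> 'b" and a assume u: "u \<longlonglongrightarrow> a"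
      show "(\<lambda>n. LINT x|lborel. f (x, u n)) \<longlonglongrightarrow> (LINT x|lborel. f (x, a))"
      proof (rule integral_dominated_convergence[where w="\<lambda>x. B * indicator (fst ` K) x"])
        have "emeasure lborel (fst ` K) < \<infinity>" using c(2) emeasure_compact_finite by blast
        moreover have "fst ` K \<in> sets lborel" using c(2) by (simp add: borel_compact)
        ultimately show "integrable lborel (\<lambda>x. B * indicator (fst ` K) x)"
          by (intro integrable_mult_right integrable_real_indicator)
        show "AE x in lborel. (\<lambda>n. f (x, u n)) \<longlonglongrightarrow> f (x, a)"
        proof (rule AE_I2)
          fix x :: 'a
          have "(\<lambda>n. (x, u n)) \<longlonglongrightarrow> (x, a)" by (intro tendsto_intros u)
          then show "(\<lambda>n. f (x, u n)) \<longlonglongrightarrow> f (x, a)"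
            using K(3) by (metis continuous_on_eq_continuous_at isCont_tendsto_compose open_UNIV UNIV_I)
        qed
        have bd: "norm (f (x, y)) \<le> B * indicator (fst ` K) x" for x y
        proof (cases "x \<in> fst ` K")
          case False
          then have "f (x, y) = 0" by (intro K(2)) force
          then show ?thesis using False by simp
        qed (use B in simp)
        show "AE x in lborel. norm (f (x, u n)) \<le> B * indicator (fst ` K) x" for n by (intro AE_I2 bd)
      qed (use test_continuous_slice(2)[OF f] test_continuous_measurable in auto)
    qed
  qed
qed

lemma test_continuous_tent: "test_continuous (\<lambda>s. max 0 (r - dist s t))"
  for t :: "'a::euclidean_space"
  by (rule test_continuousI[of _ "cball t r"]) (auto intro!: continuous_on_max continuous_intros simp: dist_commute)

text \<open>A zero integral would make the zero set of the tent a closed set of full measure, which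
  would then contain the apex \<open>t\<close>.\<close>

lemma integral_tent_pos:
  fixes t :: "'a::euclidean_space"
  assumes "r > 0"
  shows "(LINT s|lborel. max 0 (r - dist s t)) > 0"
proof -
  let ?b = "\<lambda>s. max 0 (r - dist s t)"
  have "(LINT s|lborel. ?b s) \<ge> 0" by (intro integral_nonneg_AE) simp
  moreover have "(LINT s|lborel. ?b s) \<noteq> 0"
  proof
    assume "(LINT s|lborel. ?b s) = 0"
    then have "AE s in lborel. ?b s = 0"
      using integral_nonneg_eq_0_iff_AE[OF test_continuous_integrable[OF test_continuous_tent[of r t]]] by simp
    moreover have "closed {s. ?b s = 0}"
      using test_continuous_tent[of r t] by (intro closed_Collect_eq) (simp_all add: test_continuous_def)
    ultimately have "t \<in> {s. ?b s = 0}"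
      using mem_closed_if_AE_lebesgue[of "{s. ?b s = 0}" t] by (simp add: AE_completion_iff)
    then show False using assms by simp
  qed
  ultimately show ?thesis by (rule order.not_eq_order_implies_strict[OF not_sym, rotated])
qed

text \<open>The index type of the change of variables theorem has to be well-ordered. The following copy of an
  arbitrary finite type is.\<close>

typedef ('k::finite) ordered_copy = "{..<CARD('k)}"
  by (rule exI[of _ 0]) simp

instantiation ordered_copy :: (finite) wellorder
begin

definition less_eq_ordered_copy :: "'a ordered_copy \<Rightarrow> 'a ordered_copy \<Rightarrow> bool" where
  "x \<le> y \<longleftrightarrow> Rep_ordered_copy x \<le> Rep_ordered_copy y"

definition less_ordered_copy :: "'a ordered_copy \<Rightarrow> 'a ordered_copy \<Rightarrow> bool" where
  "x < y \<longleftrightarrow> Rep_ordered_copy x < Rep_ordered_copy y"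

instance
proof
  fix P :: "'a ordered_copy \<Rightarrow> bool" and a
  assume *: "\<And>x. (\<And>y. y < x \<Longrightarrow> P y) \<Longrightarrow> P x"
  show "P a"
    by (induction "Rep_ordered_copy a" arbitrary: a rule: less_induct) (rule *, simp add: less_ordered_copy_def)
qed (auto simp: less_eq_ordered_copy_def less_ordered_copy_def Rep_ordered_copy_inject)

end

instance ordered_copy :: (finite) finite
proof
  show "finite (UNIV :: 'a ordered_copy set)"
    using type_definition.Abs_image[OF type_definition_ordered_copy] by (metis finite_imageI finite_lessThan)
qed

section \<open>Relabelling of coordinates and change of variables\<close>

lemma ex_bij_ordered_copy: "\<exists>\<sigma> :: 'k::finite ordered_copy \<Rightarrow> 'k. bij \<sigma>"
proof -
  have "CARD('k ordered_copy) = CARD('k)"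
    using type_definition.card[OF type_definition_ordered_copy] by simp
  then show ?thesis by (metis finite_same_card_bij finite)
qed

text \<open>A permutation of coordinates pulls boxes back to boxes with the same side lengths, and
  Lebesgue measure is determined by its values on boxes.\<close>

lemma lborel_reindex:
  fixes \<sigma> :: "'m::finite \<Rightarrow> 'k::finite"
  assumes "bij \<sigma>"
  shows "distr lborel borel (\<lambda>v::real^'k. (\<chi> i. v $ \<sigma> i) :: real^'m) = lborel"
proof (rule lborel_eqI[symmetric])
  fix l u :: "real^'m" assume lu: "\<And>b. b \<in> Basis \<Longrightarrow> l \<bullet> b \<le> u \<bullet> b"
  define P where "P = (\<lambda>v::real^'k. (\<chi> i. v $ \<sigma> i) :: real^'m)"
  define Q where "Q = (\<lambda>v::real^'m. (\<chi> i. v $ inv \<sigma> i) :: real^'k)"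
  have sig[simp]: "\<sigma> (inv \<sigma> i) = i" "inv \<sigma> (\<sigma> j) = j" for i j
    using assms by (simp_all add: bij_is_surj bij_is_inj surj_f_inv_f)
  have [measurable]: "P \<in> borel_measurable borel"
    unfolding P_def by (intro borel_measurable_continuous_onI continuous_on_vec_lambda continuous_intros)
  have le: "l $ i \<le> u $ i" for i using lu[of "axis i 1"] by (simp add: inner_axis)
  have "emeasure (distr lborel borel P) (box l u) = emeasure lborel (P -` box l u)"
    by (subst emeasure_distr) auto
  also have "P -` box l u = box (Q l) (Q u)"
    by (auto simp: mem_box_cart P_def Q_def) (metis sig)+
  also have "emeasure lborel (box (Q l) (Q u)) = ennreal (measure lborel (cbox (Q l) (Q u)))"
    by (simp add: emeasure_lborel_box_eq measure_lborel_cbox_eq)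
  also have "measure lborel (cbox (Q l) (Q u)) = (\<Prod>i\<in>UNIV. u $ inv \<sigma> i - l $ inv \<sigma> i)"
    using le by (subst content_cbox_cart) (auto simp: Q_def interval_eq_empty_cart not_less)
  also have "\<dots> = (\<Prod>i\<in>UNIV. u $ i - l $ i)"
    using assms bij_imp_bij_inv by (intro prod.reindex_bij_betw) auto
  also have "\<dots> = measure lborel (cbox l u)"
    using le by (subst content_cbox_cart) (auto simp: interval_eq_empty_cart not_less)
  also have "\<dots> = (\<Prod>b\<in>Basis. (u - l) \<bullet> b)"
    using lu by (simp add: measure_lborel_cbox)
  finally show "emeasure (distr lborel borel P) (box l u) = (\<Prod>b\<in>Basis. (u - l) \<bullet> b)" .
qed simp

text \<open>Since \<open>f\<close> vanishes off the image and \<open>h\<close> off \<open>S\<close>,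
  integrals over sets become integrals over the whole space. The function \<open>h\<close> stands
  for the Jacobian times the composite on \<open>S\<close> and so needs no derivative of
  \<open>g\<close> elsewhere.\<close>

lemma lborel_integral_change_of_variables:
  fixes g :: "real^'m::{finite,wellorder} \<Rightarrow> real^'m::_" and f h :: "real^'m::_ \<Rightarrow> real"
  assumes S: "S \<in> sets borel" 
    and der: "\<And>x. x \<in> S \<Longrightarrow> (g has_derivative g' x) (at x within S)"
    and inj: "inj_on g S"
    and f: "integrable lborel f" "\<And>y. y \<notin> g ` S \<Longrightarrow> f y = 0"
    and h: "h \<in> borel_measurable borel" "\<And>x. x \<notin> S \<Longrightarrow> h x = 0"
    and eq: "\<And>x. x \<in> S \<Longrightarrow> h x = \<bar>det (matrix (g' x))\<bar> * f (g x)"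
  shows "(LINT x|lborel. h x) = (LINT y|lborel. f y)"
proof -
  have ind: "indicator (g ` S) y *\<^sub>R f y = f y" for y using f(2)[of y] by (auto simp: indicator_def)
  have fb: "f \<in> borel_measurable lborel" using f(1) by (rule borel_measurable_integrable)
  have f': "f absolutely_integrable_on g ` S"
    unfolding set_integrable_def ind using f(1) integrable_completion[OF fb] by simp
  have fi: "integral (g ` S) f = (LINT y|lborel. f y)"
    using set_lebesgue_integral_eq_integral(2)[OF f'] unfolding set_lebesgue_integral_def ind
    by (simp add: integral_completion[OF fb])
  \<comment> \<open>Scalar functions are viewed as functions into \<open>real ^ 1\<close>, since the
    theorem used is about vector values.\<close>
  have "(\<lambda>x. \<bar>det (matrix (g' x))\<bar> *\<^sub>R vec (f (g x)) :: real ^ 1) absolutely_integrable_on S \<and>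
           integral S (\<lambda>x. \<bar>det (matrix (g' x))\<bar> *\<^sub>R vec (f (g x))) = (vec (LINT y|lborel. f y) :: real ^ 1)
     \<longleftrightarrow> (\<lambda>x. vec (f x) :: real ^ 1) absolutely_integrable_on (g ` S) \<and>
           integral (g ` S) (\<lambda>x. vec (f x)) = (vec (LINT y|lborel. f y) :: real ^ 1)"
    using S by (intro has_absolute_integral_change_of_variables der inj) auto
  then have *: "(\<lambda>x. \<bar>det (matrix (g' x))\<bar> * f (g x)) absolutely_integrable_on S"
    "integral S (\<lambda>x. \<bar>det (matrix (g' x))\<bar> * f (g x)) = (LINT y|lborel. f y)"
    using f' fi by (simp_all add: absolutely_integrable_on_1_iff integral_on_1_eq)
  have hx: "indicator S x *\<^sub>R (\<bar>det (matrix (g' x))\<bar> * f (g x)) = h x" for x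
  proof (cases "x \<in> S")
    case True
    then show ?thesis by (simp add: eq[OF True])
  qed (simp add: h(2))
  have "(LINT x|lebesgue. h x) = (LINT y|lborel. f y)"
    using set_lebesgue_integral_eq_integral(2)[OF *(1)] unfolding set_lebesgue_integral_def hx *(2) .
  moreover have "h \<in> borel_measurable lborel" using h(1) by simp
  ultimately show ?thesis by (simp only: integral_completion)
qed

text \<open>The fibrewise change of variables \<open>t = g (p, s)\<close>; continuity of the resulting density
  in both variables is invariance of domain for \<open>(p, s) \<mapsto> (p, g (p, s))\<close>.\<close>

lemma fibrewise_change_of_variables:
  fixes g :: "'q::euclidean_space \<times> (real^'m::{finite,wellorder}) \<Rightarrow> real^'m::_" and H :: "'q \<times> (real^'m::_) \<Rightarrow> real"
  assumes V: "open V" and B: "open B"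
    and g: "continuous_on UNIV g"
    and der: "\<And>p s. p \<in> V \<Longrightarrow> s \<in> B \<Longrightarrow> ((\<lambda>s. g (p, s)) has_derivative g' (p, s)) (at s)"
    and inj: "\<And>p. p \<in> V \<Longrightarrow> inj_on (\<lambda>s. g (p, s)) B"
    and det: "continuous_on (V \<times> B) (\<lambda>w. det (matrix (g' w)))" "\<And>w. w \<in> V \<times> B \<Longrightarrow> det (matrix (g' w)) \<noteq> 0"
    and H: "continuous_on UNIV H" "compact K" "K \<subseteq> V \<times> B" "\<And>w. w \<notin> K \<Longrightarrow> H w = 0"
  obtains J where "test_continuous J" 
    "\<And>p \<psi> c. \<psi> \<in> borel_measurable borel \<Longrightarrow> (\<And>t. \<bar>\<psi> t\<bar> \<le> c) \<Longrightarrow>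
       (LINT s|lborel. H (p, s) * \<psi> (g (p, s))) = (LINT t|lborel. J (p, t) * \<psi> t)"
proof -
  define U where "U = V \<times> B"
  define G where "G = (\<lambda>(p, s). (p, g (p, s)))"
  define G' where "G' = inv_into U G"
  \<comment> \<open>Density of the image of \<open>H (p, s)\<close> under
    \<open>s \<mapsto> g (p, s)\<close>, written for all \<open>p\<close> at once through the
    inverse of \<open>G\<close>. It lives on the open set of images and is continued by 0; the
    support of \<open>H\<close> keeps it away from the boundary.\<close>
  define J where "J w = (if w \<in> G ` U then H (G' w) / \<bar>det (matrix (g' (G' w)))\<bar> else 0)" for w
  have U: "open U" unfolding U_def by (intro open_Times V B)
  have Gc: "continuous_on UNIV G" unfolding G_def case_prod_unfold
    by (intro continuous_intros) (simp add: g)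
  have Ginj: "inj_on G U" unfolding inj_on_def G_def U_def using inj by (auto dest: inj_onD)
  have GU: "open (G ` U)" using U Gc Ginj by (intro invariance_of_domain) (auto intro: continuous_on_subset)
  have G'[simp]: "w \<in> U \<Longrightarrow> G' (G w) = w" for w unfolding G'_def using Ginj by simp
  have G'c: "continuous_on (G ` U) G'"
    using U Gc by (intro continuous_on_inverse_open) (auto intro: continuous_on_subset)
  have Jc: "test_continuous J"
  proof (rule test_continuous_glue[OF GU])
    have im: "G' ` G ` U \<subseteq> U" by auto
    have "continuous_on (G ` U) (\<lambda>w. H (G' w) / \<bar>det (matrix (g' (G' w)))\<bar>)"
      using det by (intro continuous_intros continuous_on_compose2[OF H(1) G'c] continuous_on_compose2[OF det(1) G'c])
        (auto simp: U_def)
    then show "continuous_on (G ` U) J"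
      by (rule continuous_on_eq) (simp add: J_def)
    show "compact (G ` K)" using H(2) Gc by (intro compact_continuous_image) (auto intro: continuous_on_subset)
    show "G ` K \<subseteq> G ` U" using H(3) by (auto simp: U_def)
    show "J w = 0" if "w \<notin> G ` K" for w
    proof (cases "w \<in> G ` U")
      case True
      then obtain v where v: "v \<in> U" "w = G v" by auto
      then have "v \<notin> K" using that by auto
      then show ?thesis using v by (simp add: J_def H(4))
    qed (simp add: J_def)
  qed
  show ?thesis
  proof (rule that[OF Jc])
    fix p and \<psi> :: "(real^'m::_) \<Rightarrow> real" and c assume \<psi>[measurable]: "\<psi> \<in> borel_measurable borel" and c: "\<And>t. \<bar>\<psi> t\<bar> \<le> c"
    show "(LINT s|lborel. H (p, s) * \<psi> (g (p, s))) = (LINT t|lborel. J (p, t) * \<psi> t)"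
    proof (cases "p \<in> V")
      case False
      have "H (p, s) = 0" for s using False H(3) by (intro H(4)) auto
      moreover have "J (p, t) = 0" for t using False by (auto simp: J_def G_def U_def)
      ultimately show ?thesis by simp
    next
      case True
      show ?thesis
      proof (rule lborel_integral_change_of_variables[where S=B and g="\<lambda>s. g (p, s)" and g'="\<lambda>s. g' (p, s)"])
        show "((\<lambda>s. g (p, s)) has_derivative g' (p, s)) (at s within B)" if "s \<in> B" for s
          using der[OF True that] by (rule has_derivative_at_withinI)
        show "integrable lborel (\<lambda>t. J (p, t) * \<psi> t)"
          using c by (intro integrable_test_continuous_mult test_continuous_slice(1) Jc \<psi>) simp
        show "J (p, t) * \<psi> t = 0" if "t \<notin> (\<lambda>s. g (p, s)) ` B" for t
          using that by (auto simp: J_def G_def U_def)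
        have "continuous_on UNIV (\<lambda>s. H (p, s))" "continuous_on UNIV (\<lambda>s. g (p, s))"
          by (auto intro!: continuous_on_compose2[OF H(1)] continuous_on_compose2[OF g] continuous_intros)
        then have [measurable]: "(\<lambda>s. H (p, s)) \<in> borel_measurable borel" "(\<lambda>s. g (p, s)) \<in> borel_measurable borel"
          by (auto intro: borel_measurable_continuous_onI)
        show "(\<lambda>s. H (p, s) * \<psi> (g (p, s))) \<in> borel_measurable borel" by measurable
        show "H (p, s) * \<psi> (g (p, s)) = 0" if "s \<notin> B" for s using that H(3,4) by (simp add: subset_eq) blast
        show "H (p, s) * \<psi> (g (p, s)) = \<bar>det (matrix (g' (p, s)))\<bar> * (J (p, g (p, s)) * \<psi> (g (p, s)))" if "s \<in> B" for s
        proof -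
          have w: "(p, s) \<in> U" using True that by (simp add: U_def)
          have "J (G (p, s)) = H (p, s) / \<bar>det (matrix (g' (p, s)))\<bar>"
            unfolding J_def using w by (simp only: G' imageI if_True)
          then have "J (p, g (p, s)) * \<bar>det (matrix (g' (p, s)))\<bar> = H (p, s)"
            using det(2)[of "(p, s)"] w by (simp add: G_def U_def)
          then show ?thesis by (metis mult.assoc mult.commute)
        qed
      qed (use B True inj in auto)
    qed
  qed
qed

definition has_fibre_density :: "('a::euclidean_space \<times> 'p::euclidean_space \<Rightarrow> 'b::euclidean_space) \<Rightarrow> ('a \<times> 'p \<Rightarrow> real) \<Rightarrow> ('p \<times> 'b \<Rightarrow> real) \<Rightarrow> bool" where
  "has_fibre_density \<Phi> F J \<longleftrightarrow> test_continuous J \<and>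
     (\<forall>x \<psi> c. \<psi> \<in> borel_measurable borel \<longrightarrow> (\<forall>t. \<bar>\<psi> t\<bar> \<le> c) \<longrightarrow>
        (LINT y|lborel. F (y, x) * \<psi> (\<Phi> (y, x))) = (LINT t|lborel. J (x, t) * \<psi> t))"

text \<open>Averaging over the translates \<open>y = z + A s\<close>, with \<open>A\<close> a right inverse of the derivative of \<open>\<Phi>\<close> in its first
  variable, makes \<open>s \<mapsto> \<Phi> (z + A s, x)\<close> a local diffeomorphism of the codomain. This
  avoids splitting off the kernel of the derivative.\<close>

lemma has_fibre_density_local:
  fixes \<Phi> :: "'a::euclidean_space \<times> 'p::euclidean_space \<Rightarrow> real^'m::{finite,wellorder}"
  assumes \<Phi>: "continuous_on UNIV \<Phi>"
    and der: "\<And>y x. ((\<lambda>y. \<Phi> (y, x)) has_derivative D (y, x)) (at y)"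
    and Dc: "\<And>v. continuous_on UNIV (\<lambda>w. D w v)"
    and surj: "surj (D w0)"
  obtains r where "r > 0" "\<And>F. continuous_on UNIV F \<Longrightarrow> (\<And>w. w \<notin> cball w0 r \<Longrightarrow> F w = 0) \<Longrightarrow> \<exists>J. has_fibre_density \<Phi> F J"
proof -
  have lin: "linear (D w)" for w using der[of "snd w" "fst w"] has_derivative_linear by (metis prod.collapse)
  obtain A where A: "linear A" "D w0 \<circ> A = id"
    using linear_surjective_right_inverse[OF lin[of w0] surj] by blast
  have bA: "bounded_linear A" using A(1) by (simp add: linear_conv_bounded_linear)
  obtain a where a: "a > 0" "\<And>s. norm (A s) \<le> a * norm s"
    using linear_bounded_pos[OF A(1)] by blast
  \<comment> \<open>A continuous bound for the operator norm of the deviation of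
    \<open>D w \<circ> A\<close> from the identity. It is 0 at \<open>w0\<close>, hence below
    \<open>1 / 2\<close> nearby.\<close>
  define m where "m w = (\<Sum>i\<in>Basis. norm (D w (A i) - i))" for w
  have "continuous_on UNIV m" unfolding m_def by (intro continuous_intros Dc)
  then have "open {w. m w < 1 / 2}" by (intro open_Collect_less continuous_intros)
  moreover have "m w0 < 1 / 2" using A(2) by (simp add: m_def fun_eq_iff)
  ultimately obtain \<rho> where \<rho>: "\<rho> > 0" "ball w0 \<rho> \<subseteq> {w. m w < 1 / 2}"
    using open_contains_ball by blast
  have close: "norm (D w (A v) - v) \<le> m w * norm v" for w v
  proof -
    have "D w (A v) - v = (\<Sum>i\<in>Basis. (v \<bullet> i) *\<^sub>R (D w (A i) - i))"
    proof -
      define L where "L v = D w (A v) - v" for v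
      have l: "linear L"
        unfolding L_def using linear_compose[OF A(1) lin[of w]] by (intro linear_compose_sub) (auto simp: o_def linear_ident)
      have "L v = L (\<Sum>i\<in>Basis. (v \<bullet> i) *\<^sub>R i)" by (simp add: euclidean_representation)
      also have "\<dots> = (\<Sum>i\<in>Basis. (v \<bullet> i) *\<^sub>R L i)"
        unfolding linear_sum[OF l] linear_scale[OF l] ..
      finally show ?thesis unfolding L_def .
    qed
    also have "norm \<dots> \<le> (\<Sum>i\<in>Basis. norm v * norm (D w (A i) - i))"
      by (intro sum_norm_le) (simp add: Basis_le_norm mult_right_mono)
    also have "\<dots> = m w * norm v" by (simp add: m_def sum_distrib_left mult.commute)
    finally show ?thesis .
  qed
  \<comment> \<open>Makes \<open>r + a * r = \<rho> / 4\<close>, so that points of \<open>V\<close>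
    stay within \<rho> of \<open>w0\<close> after a displacement by \<open>A s\<close> of length at
    most \<open>a * r\<close>.\<close>
  define r where "r = (\<rho> / 4) / (1 + a)"
  have r: "r > 0" using \<rho>(1) a(1) by (simp add: r_def)
  have "r * (1 + a) = \<rho> / 4" using nonzero_eq_divide_eq[of "1 + a" r "\<rho> / 4"] a(1) r_def by linarith
  then have r2: "r + a * r = \<rho> / 4" by (simp add: algebra_simps)
  define V where "V = {q :: 'a \<times> 'p. dist w0 q < r + a * r + r / 2}"
  define B where "B = ball (0 :: (real^'m::_)) r"
  define g where "g = (\<lambda>(q :: 'a \<times> 'p, s). \<Phi> (fst q + A s, snd q))"
  define g' where "g' = (\<lambda>(q :: 'a \<times> 'p, s) v. D (fst q + A s, snd q) (A v))"
  have Ac: "continuous_on S (\<lambda>x. A (h x))" if "continuous_on S h" for S and h :: "'z::topological_space \<Rightarrow> _"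
    by (rule bounded_linear.continuous_on[OF bA that])
  have gc: "continuous_on UNIV g" unfolding g_def case_prod_unfold
    by (intro continuous_on_compose2[OF \<Phi>] continuous_intros Ac) auto
  have near: "m (fst q + A s, snd q) < 1 / 2" if "q \<in> V" "s \<in> B" for q s
  proof -
    have "dist w0 (fst q + A s, snd q) \<le> dist w0 q + dist q (fst q + A s, snd q)" by (rule dist_triangle)
    also have "dist q (fst q + A s, snd q) = norm (A s)"
      by (cases q) (simp add: dist_Pair_Pair dist_norm)
    also have "norm (A s) \<le> a * r" using a(2)[of s] that(2) a(1) 
      by (intro order_trans[OF a(2)] mult_left_mono) (auto simp: B_def)
    also have "dist w0 q < r + a * r + r / 2" using that(1) by (simp add: V_def)
    finally have "dist w0 (fst q + A s, snd q) < \<rho>" using r r2 \<rho>(1) by linarith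
    then show "m (fst q + A s, snd q) < 1 / 2" using \<rho>(2) by auto
  qed
  have gder: "((\<lambda>s. g (q, s)) has_derivative g' (q, s)) (at s)" for q s
  proof -
    have "((\<lambda>s. fst q + A s) has_derivative A) (at s)"
      using bounded_linear_imp_has_derivative[OF bA] by (auto intro!: derivative_eq_intros)
    from has_derivative_compose[OF this der[where x="snd q"]] show ?thesis
      by (simp add: g_def g'_def)
  qed
  have ginj: "inj_on (\<lambda>s. g (q, s)) B" if q: "q \<in> V" for q
  proof (rule inj_onI)
    fix s s' assume s: "s \<in> B" "s' \<in> B" "g (q, s) = g (q, s')"
    \<comment> \<open>The map differs from the identity by a contraction with constant
      \<open>1 / 2\<close>, which forces injectivity.\<close>
    define h where "h s = g (q, s) - s" for s
    have "norm (h s - h s') \<le> 1 / 2 * norm (s - s')"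
    proof (rule differentiable_bound[where S=B and f=h and f'="\<lambda>s v. g' (q, s) v - v"])
      show "(h has_derivative (\<lambda>v. g' (q, s) v - v)) (at s within B)" for s
        unfolding h_def by (intro has_derivative_diff has_derivative_ident has_derivative_at_withinI[OF gder])
      show "onorm (\<lambda>v. g' (q, s) v - v) \<le> 1 / 2" if "s \<in> B" for s
      proof (rule onorm_le)
        fix v
        have "norm (g' (q, s) v - v) \<le> m (fst q + A s, snd q) * norm v" unfolding g'_def using close by simp
        also have "\<dots> \<le> 1 / 2 * norm v" using near[OF q that] by (intro mult_right_mono) auto
        finally show "norm (g' (q, s) v - v) \<le> 1 / 2 * norm v" .
      qed
    qed (use s in \<open>auto simp: B_def\<close>)
    then show "s = s'" using s(3) by (simp add: h_def norm_minus_commute)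
  qed
  have detc: "continuous_on UNIV (\<lambda>w. det (matrix (g' w)))"
    unfolding det_def matrix_def g'_def case_prod_unfold
    by (simp, intro continuous_intros continuous_on_compose2[OF Dc] Ac) auto
  have det0: "det (matrix (g' (q, s))) \<noteq> 0" if "q \<in> V" "s \<in> B" for q s
  proof -
    have l: "linear (g' (q, s))" using gder has_derivative_linear by blast
    have "v = 0" if v: "g' (q, s) v = 0" for v
    proof (rule ccontr)
      assume "v \<noteq> 0"
      have "norm v \<le> m (fst q + A s, snd q) * norm v" using close[of "(fst q + A s, snd q)" v] v by (simp add: g'_def)
      also have "\<dots> < 1 * norm v" using near[OF \<open>q \<in> V\<close> \<open>s \<in> B\<close>] \<open>v \<noteq> 0\<close> by (intro mult_strict_right_mono) auto
      finally show False by simp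
    qed
    then have "inj (g' (q, s))" using linear_injective_0[OF l] by blast
    then show ?thesis using det_nz_iff_inj[OF l] by blast
  qed
  show ?thesis
  proof (rule that[OF r])
    fix F :: "'a \<times> 'p \<Rightarrow> real" assume F: "continuous_on UNIV F" "\<And>w. w \<notin> cball w0 r \<Longrightarrow> F w = 0"
    \<comment> \<open>The averaging weight, of integral \<open>c\<close>. Its radius
      \<open>r / 2\<close> puts its support strictly inside \<open>B\<close>, as the fibrewise
      change of variables requires of the support of \<open>H\<close>.\<close>
    define b where "b s = max 0 (r / 2 - dist s 0)" for s :: "(real^'m::_)"
    have b: "test_continuous b" unfolding b_def by (rule test_continuous_tent)
    define c where "c = (LINT s|lborel. b s)"
    have c: "c > 0" unfolding c_def b_def by (rule integral_tent_pos) (use r in simp)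
    define H where "H = (\<lambda>(q :: 'a \<times> 'p, s). F (fst q + A s, snd q) * (b s / c))"
    define K where "K = cball w0 (r + a * (r / 2)) \<times> cball (0 :: (real^'m::_)) (r / 2)"
    have bc: "continuous_on S (\<lambda>x. b (h x))" if "continuous_on S h" for S and h :: "'z::topological_space \<Rightarrow> _"
      unfolding b_def by (intro continuous_intros that)
    have Hc: "continuous_on UNIV H" unfolding H_def case_prod_unfold
      using c by (intro continuous_intros continuous_on_compose2[OF F(1)] Ac bc) auto
    have HK: "H w = 0" if w: "w \<notin> K" for w
    proof (rule ccontr)
      assume H0: "H w \<noteq> 0"
      obtain q s where ws: "w = (q, s)" by fastforce
      have 1: "norm s \<le> r / 2" using H0 by (auto simp: H_def ws b_def max_def split: if_splits)
      have "dist w0 (fst q + A s, snd q) \<le> r" using H0 F(2)[of "(fst q + A s, snd q)"] by (auto simp: H_def ws)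
      moreover have "dist (fst q + A s, snd q) q = norm (A s)" by (cases q) (simp add: dist_Pair_Pair dist_norm)
      moreover have "norm (A s) \<le> a * (r / 2)" using a 1 by (intro order_trans[OF a(2)] mult_left_mono) auto
      ultimately have "dist w0 q \<le> r + a * (r / 2)" using dist_triangle[of w0 q "(fst q + A s, snd q)"] by linarith
      then show False using w 1 by (simp add: K_def ws)
    qed
    have Kc: "compact K" unfolding K_def by (intro compact_Times compact_cball)
    have "a * (r / 2) < a * r + r / 2" using a r by (simp add: field_simps) (smt (verit) mult_pos_pos)
    then have KV: "K \<subseteq> V \<times> B" using r by (auto simp: K_def V_def B_def)
    have Vo: "open V" unfolding V_def by (intro open_Collect_less continuous_intros)
    obtain J where J: "test_continuous J"
      "\<And>q \<psi> c. \<psi> \<in> borel_measurable borel \<Longrightarrow> (\<And>t. \<bar>\<psi> t\<bar> \<le> c) \<Longrightarrow>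
         (LINT s|lborel. H (q, s) * \<psi> (g (q, s))) = (LINT t|lborel. J (q, t) * \<psi> t)"
      by (rule fibrewise_change_of_variables[where V=V and B=B and g=g and g'=g' and H=H and K=K])
         (use Vo gc gder ginj detc det0 Hc Kc KV HK in \<open>auto simp: B_def intro: continuous_on_subset\<close>)
    define J3 where "J3 = (\<lambda>(z :: 'a, x :: 'p, t). J ((z, x), t))"
    have J3: "test_continuous J3"
      unfolding J3_def case_prod_unfold
      by (rule test_continuous_embed[OF J(1), where h="\<lambda>w. (fst (fst w), snd (fst w), snd w)"])
         (auto intro!: continuous_intros)
    define J' where "J' w = (LINT z|lborel. J3 (z, w))" for w
    have "has_fibre_density \<Phi> F J'"
      unfolding has_fibre_density_def
    proof (intro conjI allI impI)
      show "test_continuous J'" unfolding J'_def by (rule test_continuous_integral[OF J3])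
      fix x :: 'p and \<psi> :: "(real^'m::_) \<Rightarrow> real" and C :: real assume \<psi>[measurable]: "\<psi> \<in> borel_measurable borel" and C: "\<forall>t. \<bar>\<psi> t\<bar> \<le> C"
      have [measurable]: "F \<in> borel_measurable borel" "\<Phi> \<in> borel_measurable borel" "A \<in> borel_measurable borel" "b \<in> borel_measurable borel"
        using F(1) \<Phi> Ac[of UNIV "\<lambda>x. x"] test_continuous_measurable[OF b] by (auto intro: borel_measurable_continuous_onI)
      have Fm: "(\<lambda>y. F (y, x)) \<in> borel_measurable borel" "(\<lambda>y. \<Phi> (y, x)) \<in> borel_measurable borel"
        by (auto intro!: borel_measurable_continuous_onI continuous_on_compose2[OF F(1)] continuous_on_compose2[OF \<Phi>] continuous_intros)
      have fm: "(\<lambda>y. F (y, x) * \<psi> (\<Phi> (y, x))) \<in> borel_measurable borel"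
        using Fm by measurable
      have Htc: "test_continuous H" by (rule test_continuousI[OF Hc Kc HK])
      have cs: "test_continuous (\<lambda>(z, s). H ((z, x), s))"
        unfolding case_prod_unfold
        by (rule test_continuous_embed[OF Htc, where h="\<lambda>w. (fst (fst w), snd w)"]) (auto intro!: continuous_intros)
      have psg: "(\<lambda>(z, s). \<psi> (g ((z, x), s))) \<in> borel_measurable borel"
      proof -
        have "(\<lambda>(z, s). g ((z, x), s)) \<in> borel_measurable borel" unfolding case_prod_unfold
          by (intro borel_measurable_continuous_onI continuous_on_compose2[OF gc] continuous_intros) auto
        from measurable_compose[OF this \<psi>] show ?thesis by (simp add: case_prod_unfold)
      qed
      have int1: "integrable (lborel \<Otimes>\<^sub>M lborel) (\<lambda>(z, s). H ((z, x), s) * \<psi> (g ((z, x), s)))"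
        using integrable_test_continuous_mult[OF cs psg, of C] C by (simp add: case_prod_unfold lborel_prod)
      have cs2: "test_continuous (\<lambda>(z, t). J3 (z, x, t))"
        unfolding case_prod_unfold
        by (rule test_continuous_embed[OF J3, where h="\<lambda>w. (fst w, snd (snd w))"]) (auto intro!: continuous_intros)
      have int2: "integrable (lborel \<Otimes>\<^sub>M lborel) (\<lambda>(z, t). J3 (z, x, t) * \<psi> t)"
      proof -
        have "(\<lambda>(z::'a, t). \<psi> t) \<in> borel_measurable borel" unfolding borel_prod[symmetric] by measurable
        from integrable_test_continuous_mult[OF cs2 this, of C] show ?thesis using C by (simp add: case_prod_unfold lborel_prod)
      qed
      \<comment> \<open>The factor \<open>b s / c\<close> has integral 1. For each \<open>s\<close>
        the variable \<open>y\<close> is translated by \<open>A s\<close>; after Fubini the inner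
        variable is \<open>s\<close>, where the fibrewise density applies, and \<open>J'\<close>
        integrates these densities over \<open>z\<close>.\<close>
      have "(LINT y|lborel. F (y, x) * \<psi> (\<Phi> (y, x))) = (LINT s|lborel. (b s / c) * (LINT y|lborel. F (y, x) * \<psi> (\<Phi> (y, x))))"
        using c by (simp add: c_def)
      also have "\<dots> = (LINT s|lborel. LINT z|lborel. H ((z, x), s) * \<psi> (g ((z, x), s)))"
      proof (intro Bochner_Integration.integral_cong refl)
        fix s
        have "(LINT y|lborel. F (y, x) * \<psi> (\<Phi> (y, x))) = (LINT z|lborel. F (A s + 1 *\<^sub>R z, x) * \<psi> (\<Phi> (A s + 1 *\<^sub>R z, x)))"
          by (rule lborel_integral_affine[symmetric]) (use fm in auto)
        then show "(b s / c) * (LINT y|lborel. F (y, x) * \<psi> (\<Phi> (y, x))) = (LINT z|lborel. H ((z, x), s) * \<psi> (g ((z, x), s)))"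
          unfolding H_def g_def by (simp add: add.commute mult_ac flip: integral_mult_right_zero)
      qed
      also have "\<dots> = (LINT z|lborel. LINT s|lborel. H ((z, x), s) * \<psi> (g ((z, x), s)))"
        by (rule lborel_pair.Fubini_integral[OF int1])
      also have "\<dots> = (LINT z|lborel. LINT t|lborel. J3 (z, x, t) * \<psi> t)"
        using C by (simp add: J(2)[OF \<psi>, of C] J3_def)
      also have "\<dots> = (LINT t|lborel. LINT z|lborel. J3 (z, x, t) * \<psi> t)"
        by (rule lborel_pair.Fubini_integral[OF int2, symmetric])
      also have "\<dots> = (LINT t|lborel. J' (x, t) * \<psi> t)" by (simp add: J'_def)
      finally show "(LINT y|lborel. F (y, x) * \<psi> (\<Phi> (y, x))) = (LINT t|lborel. J' (x, t) * \<psi> t)" .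
    qed
    then show "\<exists>J. has_fibre_density \<Phi> F J" by blast
  qed
qed

lemma has_fibre_density_sum:
  assumes "finite P" "\<And>p. p \<in> P \<Longrightarrow> has_fibre_density \<Phi> (F p) (J p)"
    and F: "\<And>p. p \<in> P \<Longrightarrow> test_continuous (F p)" and \<Phi>: "continuous_on UNIV \<Phi>"
  shows "has_fibre_density \<Phi> (\<lambda>w. \<Sum>p\<in>P. F p w) (\<lambda>w. \<Sum>p\<in>P. J p w)"
proof -
  have J: "test_continuous (J p)" if "p \<in> P" for p using assms(2)[OF that] by (simp add: has_fibre_density_def)
  obtain K where K: "\<And>p. p \<in> P \<Longrightarrow> compact (K p) \<and> (\<forall>w. w \<notin> K p \<longrightarrow> J p w = 0) \<and> continuous_on UNIV (J p)"
    using J unfolding test_continuous_def by metis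
  have "test_continuous (\<lambda>w. \<Sum>p\<in>P. J p w)"
  proof (rule test_continuousI[of _ "\<Union>p\<in>P. K p"])
    show "continuous_on UNIV (\<lambda>w. \<Sum>p\<in>P. J p w)" using K by (intro continuous_on_sum) auto
    show "compact (\<Union>p\<in>P. K p)" using K assms(1) by (intro compact_UN) auto
    show "(\<Sum>p\<in>P. J p w) = 0" if "w \<notin> (\<Union>p\<in>P. K p)" for w using that K by (intro sum.neutral) blast
  qed
  moreover have "(LINT y|lborel. (\<Sum>p\<in>P. F p (y, x)) * \<psi> (\<Phi> (y, x))) = (LINT t|lborel. (\<Sum>p\<in>P. J p (x, t)) * \<psi> t)"
    if \<psi>: "\<psi> \<in> borel_measurable borel" "\<forall>t. \<bar>\<psi> t\<bar> \<le> c" for x \<psi> c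
  proof -
    have "(\<lambda>y. \<Phi> (y, x)) \<in> borel_measurable borel"
      by (auto intro!: borel_measurable_continuous_onI continuous_on_compose2[OF \<Phi>] continuous_intros)
    then have "(\<lambda>y. \<psi> (\<Phi> (y, x))) \<in> borel_measurable borel" using \<psi>(1) by (rule measurable_compose)
    then have i: "integrable lborel (\<lambda>y. F p (y, x) * \<psi> (\<Phi> (y, x)))" if "p \<in> P" for p
      using \<psi>(2) by (intro integrable_test_continuous_mult test_continuous_slice(2) F that) auto
    have j: "integrable lborel (\<lambda>t. J p (x, t) * \<psi> t)" if "p \<in> P" for p
      using \<psi> by (intro integrable_test_continuous_mult test_continuous_slice(1) J that) auto
    have "(LINT y|lborel. (\<Sum>p\<in>P. F p (y, x)) * \<psi> (\<Phi> (y, x))) = (\<Sum>p\<in>P. LINT y|lborel. F p (y, x) * \<psi> (\<Phi> (y, x)))"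
      unfolding sum_distrib_right using i by (rule Bochner_Integration.integral_sum)
    also have "\<dots> = (\<Sum>p\<in>P. LINT t|lborel. J p (x, t) * \<psi> t)"
      using assms(2) \<psi> unfolding has_fibre_density_def by (intro sum.cong refl) blast
    also have "\<dots> = (LINT t|lborel. (\<Sum>p\<in>P. J p (x, t)) * \<psi> t)"
      unfolding sum_distrib_right using j by (rule Bochner_Integration.integral_sum[symmetric])
    finally show ?thesis .
  qed
  ultimately show ?thesis unfolding has_fibre_density_def by blast
qed

text \<open>The local densities are added up along a partition of unity. It is made of tents on
  finitely many balls covering the support of \<open>F\<close>, divided by their sum
  \<sigma>.\<close>

lemma ex_has_fibre_density_ordered:
  fixes \<Phi> :: "'a::euclidean_space \<times> 'p::euclidean_space \<Rightarrow> real^'m::{finite,wellorder}"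
  assumes \<Phi>: "continuous_on UNIV \<Phi>"
    and der: "\<And>y x. ((\<lambda>y. \<Phi> (y, x)) has_derivative D (y, x)) (at y)"
    and Dc: "\<And>v. continuous_on UNIV (\<lambda>w. D w v)"
    and surj: "\<And>w. surj (D w)"
    and F: "test_continuous F"
  shows "\<exists>J. has_fibre_density \<Phi> F J"
proof -
  have "\<exists>r. r > 0 \<and> (\<forall>F. continuous_on UNIV F \<longrightarrow> (\<forall>v. v \<notin> cball w r \<longrightarrow> F v = 0) \<longrightarrow> (\<exists>J. has_fibre_density \<Phi> F J))" for w
    by (rule has_fibre_density_local[OF \<Phi> der Dc surj, of w]) blast
  then obtain r where r: "\<And>w. r w > 0"
    "\<And>w F. continuous_on UNIV F \<Longrightarrow> (\<And>v. v \<notin> cball w (r w) \<Longrightarrow> F v = 0) \<Longrightarrow> \<exists>J. has_fibre_density \<Phi> F J"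
    by metis
  obtain K where K: "compact K" "\<And>w. w \<notin> K \<Longrightarrow> F w = 0" "continuous_on UNIV F"
    using F unfolding test_continuous_def by blast
  have "K \<subseteq> (\<Union>w\<in>K. ball w (r w))" using r(1) by auto
  then obtain P where P: "P \<subseteq> K" "finite P" "K \<subseteq> (\<Union>w\<in>P. ball w (r w))"
    using compactE_image[OF K(1), of K "\<lambda>w. ball w (r w)"] by (metis open_ball)
  define \<tau> where "\<tau> w v = max 0 (r w - dist w v)" for w v
  define \<sigma> where "\<sigma> v = (\<Sum>w\<in>P. \<tau> w v)" for v
  have \<tau>: "\<tau> w v \<ge> 0" "continuous_on UNIV (\<tau> w)" for w v
    unfolding \<tau>_def by (auto intro!: continuous_intros)
  have \<sigma>c: "continuous_on UNIV \<sigma>" unfolding \<sigma>_def by (intro continuous_on_sum \<tau>)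
  have \<sigma>pos: "\<sigma> v > 0" if v: "v \<in> K" for v
  proof -
    obtain w where "w \<in> P" "v \<in> ball w (r w)" using subsetD[OF P(3) v] by blast
    then show ?thesis unfolding \<sigma>_def using P(2) \<tau>(1) by (intro sum_pos2[of _ w]) (auto simp: \<tau>_def)
  qed
  \<comment> \<open>Dividing \<open>F\<close> rather than the tents keeps everything continuous:
    \<sigma> is positive on the support of \<open>F\<close>, and where \<sigma> is 0 so is
    \<open>F\<close>, hence also the quotient.\<close>
  define G where "G v = F v / \<sigma> v" for v
  have G: "test_continuous G"
  proof (rule test_continuous_glue[of "{v. 0 < \<sigma> v}" _ K])
    show "open {v. 0 < \<sigma> v}" using \<sigma>c by (intro open_Collect_less continuous_intros)
    show "continuous_on {v. 0 < \<sigma> v} G" unfolding G_def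
      by (intro continuous_on_divide continuous_on_subset[OF K(3)] continuous_on_subset[OF \<sigma>c]) auto
  qed (use K \<sigma>pos in \<open>auto simp: G_def\<close>)
  have Gc: "continuous_on UNIV G" using G by (simp add: test_continuous_def)
  have parts: "\<exists>J. has_fibre_density \<Phi> (\<lambda>v. \<tau> w v * G v) J" for w
  proof (rule r(2)[of _ w])
    show "continuous_on UNIV (\<lambda>v. \<tau> w v * G v)" by (intro continuous_on_mult \<tau> Gc)
  qed (simp add: \<tau>_def)
  then obtain J where J: "\<And>w. has_fibre_density \<Phi> (\<lambda>v. \<tau> w v * G v) (J w)" by metis
  have "test_continuous (\<lambda>v. \<tau> w v * G v)" for w
    by (rule test_continuous_mult[OF \<tau>(2) G])
  then have "has_fibre_density \<Phi> (\<lambda>v. \<Sum>w\<in>P. \<tau> w v * G v) (\<lambda>v. \<Sum>w\<in>P. J w v)"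
    using J by (intro has_fibre_density_sum P(2) \<Phi>)
  moreover have "(\<Sum>w\<in>P. \<tau> w v * G v) = F v" for v
  proof (cases "\<sigma> v = 0")
    case True
    then show ?thesis using \<sigma>pos[of v] K(2)[of v] by (force simp: G_def)
  next
    case False
    then show ?thesis unfolding sum_distrib_right[symmetric] \<sigma>_def[symmetric] G_def by simp
  qed
  ultimately show ?thesis by auto
qed

text \<open>The relabelling \<open>P\<close> of coordinates carries the codomain to one with a
  well-ordered index type. It preserves Lebesgue measure, so the density is merely composed with
  \<open>P\<close>.\<close>

lemma ex_has_fibre_density:
  fixes \<Phi> :: "'a::euclidean_space \<times> 'p::euclidean_space \<Rightarrow> real^'k"
  assumes \<Phi>: "continuous_on UNIV \<Phi>"
    and der: "\<And>y x. ((\<lambda>y. \<Phi> (y, x)) has_derivative D (y, x)) (at y)"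
    and Dc: "\<And>v. continuous_on UNIV (\<lambda>w. D w v)"
    and surj: "\<And>w. surj (D w)"
    and F: "test_continuous F"
  shows "\<exists>J. has_fibre_density \<Phi> F J"
proof -
  obtain \<sigma> :: "'k ordered_copy \<Rightarrow> 'k" where \<sigma>: "bij \<sigma>" using ex_bij_ordered_copy by blast
  define P where "P v = (\<chi> i. v $ \<sigma> i)" for v :: "real^'k"
  define Q where "Q v = (\<chi> i. v $ inv \<sigma> i)" for v :: "real^('k ordered_copy)"
  have PQ[simp]: "P (Q v) = v" "Q (P w) = w" for v w
    using \<sigma> by (simp_all add: P_def Q_def vec_eq_iff bij_is_surj bij_is_inj surj_f_inv_f)
  have lP: "bounded_linear P" "bounded_linear Q"
    unfolding linear_conv_bounded_linear[symmetric] P_def Q_def by (auto intro!: linearI simp: vec_eq_iff)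
  have Pc: "continuous_on UNIV P" "continuous_on UNIV Q" using lP by (simp_all add: linear_continuous_on)
  have distr: "distr lborel borel P = lborel" unfolding P_def[abs_def] by (rule lborel_reindex[OF \<sigma>])
  have "\<exists>J. has_fibre_density (\<lambda>w. P (\<Phi> w)) F J"
  proof (rule ex_has_fibre_density_ordered[OF _ _ _ _ F])
    show "continuous_on UNIV (\<lambda>w. P (\<Phi> w))" by (intro continuous_on_compose2[OF Pc(1) \<Phi>]) auto
    show "((\<lambda>y. P (\<Phi> (y, x))) has_derivative (\<lambda>v. P (D (y, x) v))) (at y)" for y x
      by (rule bounded_linear.has_derivative[OF lP(1) der])
    show "continuous_on UNIV (\<lambda>w. P (D w v))" for v by (intro continuous_on_compose2[OF Pc(1) Dc]) auto
    show "surj (\<lambda>v. P (D w v))" for w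
      using surj[of w] PQ(1) unfolding surj_def by metis
  qed
  then obtain J where J: "has_fibre_density (\<lambda>w. P (\<Phi> w)) F J" ..
  define J' where "J' = (\<lambda>(x, t). J (x, P t))"
  have "test_continuous J"
    using J by (simp add: has_fibre_density_def)
  then have "test_continuous J'"
    unfolding J'_def case_prod_unfold
    by (rule test_continuous_embed[where h="\<lambda>w. (fst w, Q (snd w))"])
       (auto intro!: continuous_intros continuous_on_compose2[OF Pc(1)] continuous_on_compose2[OF Pc(2)])
  moreover have "(LINT y|lborel. F (y, x) * \<psi> (\<Phi> (y, x))) = (LINT t|lborel. J' (x, t) * \<psi> t)"
    if \<psi>: "\<psi> \<in> borel_measurable borel" "\<forall>t. \<bar>\<psi> t\<bar> \<le> c" for x \<psi> c
  proof -
    have Qm: "Q \<in> borel_measurable borel" "P \<in> borel_measurable borel" using Pc by (auto intro: borel_measurable_continuous_onI)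
    have m: "(\<lambda>t. \<psi> (Q t)) \<in> borel_measurable borel" using Qm(1) \<psi>(1) by (rule measurable_compose)
    have "(LINT y|lborel. F (y, x) * \<psi> (Q (P (\<Phi> (y, x))))) = (LINT t|lborel. J (x, t) * \<psi> (Q t))"
      using J m \<psi>(2) unfolding has_fibre_density_def by blast
    also have "\<dots> = (LINT t|distr lborel borel P. J (x, t) * \<psi> (Q t))" by (simp add: distr)
    also have "\<dots> = (LINT t|lborel. J (x, P t) * \<psi> (Q (P t)))"
    proof (rule integral_distr)
      have "(\<lambda>t. J (x, t)) \<in> borel_measurable borel"
        using J by (intro test_continuous_measurable test_continuous_slice) (simp add: has_fibre_density_def)
      then show "(\<lambda>t. J (x, t) * \<psi> (Q t)) \<in> borel_measurable borel" using m by simp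
    qed (use Qm in simp)
    finally show ?thesis by (simp add: J'_def)
  qed
  ultimately have "has_fibre_density \<Phi> F J'" unfolding has_fibre_density_def by blast
  then show ?thesis by blast
qed

section \<open>Complex densities and pointwise values of the transposed Radon transforms\<close>

lemma test_continuous_compose:
  assumes "test_continuous f" "continuous_on UNIV h" "h 0 = 0"
  shows "test_continuous (\<lambda>x. h (f x))"
proof -
  obtain K where K: "compact K" "\<And>w. w \<notin> K \<Longrightarrow> f w = 0" "continuous_on UNIV f"
    using assms(1) unfolding test_continuous_def by blast
  show ?thesis
    by (rule test_continuousI[OF _ K(1)]) (auto intro!: continuous_on_compose2[OF assms(2) K(3)] simp: K(2) assms(3))
qed

lemma test_continuous_add:
  assumes "test_continuous f" "test_continuous g"
  shows "test_continuous (\<lambda>x. f x + g x)"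
proof -
  obtain K L where "compact K" "\<And>w. w \<notin> K \<Longrightarrow> f w = 0" "continuous_on UNIV f"
     "compact L" "\<And>w. w \<notin> L \<Longrightarrow> g w = 0" "continuous_on UNIV g"
    using assms unfolding test_continuous_def by blast
  then show ?thesis
    by (intro test_continuousI[of _ "K \<union> L"]) (auto intro!: continuous_intros)
qed

lemma ex_complex_fibre_density:
  fixes \<Phi> :: "'a::euclidean_space \<times> 'p::euclidean_space \<Rightarrow> real^'k" and F :: "'a \<times> 'p \<Rightarrow> complex"
  assumes \<Phi>: "continuous_on UNIV \<Phi>"
    and der: "\<And>y x. ((\<lambda>y. \<Phi> (y, x)) has_derivative D (y, x)) (at y)"
    and Dc: "\<And>v. continuous_on UNIV (\<lambda>w. D w v)"
    and surj: "\<And>w. surj (D w)"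
    and F: "test_continuous F"
  obtains J :: "'p \<times> (real^'k) \<Rightarrow> complex" where "test_continuous J"
    "\<And>x \<psi> c. \<psi> \<in> borel_measurable borel \<Longrightarrow> (\<And>t. \<bar>\<psi> t\<bar> \<le> c) \<Longrightarrow>
        (LINT y|lborel. F (y, x) * of_real (\<psi> (\<Phi> (y, x)))) = (LINT t|lborel. J (x, t) * of_real (\<psi> t))"
proof -
  have F12: "test_continuous (\<lambda>w. Re (F w))" "test_continuous (\<lambda>w. Im (F w))"
    by (auto intro!: test_continuous_compose[OF F] continuous_intros)
  obtain J1 J2 where J: "has_fibre_density \<Phi> (\<lambda>w. Re (F w)) J1" "has_fibre_density \<Phi> (\<lambda>w. Im (F w)) J2"
    using ex_has_fibre_density[OF \<Phi> der Dc surj F12(1)] ex_has_fibre_density[OF \<Phi> der Dc surj F12(2)] by blast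
  have J12: "test_continuous J1" "test_continuous J2" using J by (auto simp: has_fibre_density_def)
  let ?J = "\<lambda>w. of_real (J1 w) + \<i> * of_real (J2 w)"
  have split: "(LINT x|M. f x * of_real (h x)) = of_real (LINT x|M. Re (f x) * h x) + \<i> * of_real (LINT x|M. Im (f x) * h x)"
    if "integrable M (\<lambda>x. f x * of_real (h x))" for M :: "'z measure" and f h
  proof -
    have "Re (LINT x|M. f x * of_real (h x)) = (LINT x|M. Re (f x) * h x)"
      "Im (LINT x|M. f x * of_real (h x)) = (LINT x|M. Im (f x) * h x)"
      using integral_Re[OF that] integral_Im[OF that] by simp_all
    then show ?thesis by (simp add: complex_eq_iff)
  qed
  show ?thesis
  proof (rule that[of ?J])
    show tJ: "test_continuous ?J"
      by (intro test_continuous_add test_continuous_compose[OF J12(1)] test_continuous_compose[OF J12(2)] continuous_intros) auto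
    fix x :: 'p and \<psi> :: "real^'k \<Rightarrow> real" and c :: real assume \<psi>: "\<psi> \<in> borel_measurable borel" "\<And>t. \<bar>\<psi> t\<bar> \<le> c"
    have "(\<lambda>y. \<Phi> (y, x)) \<in> borel_measurable borel"
      by (auto intro!: borel_measurable_continuous_onI continuous_on_compose2[OF \<Phi>] continuous_intros)
    then have m: "(\<lambda>y. \<psi> (\<Phi> (y, x))) \<in> borel_measurable borel" using \<psi>(1) by (rule measurable_compose)
    have i: "integrable lborel (\<lambda>y. F (y, x) * of_real (\<psi> (\<Phi> (y, x))))"
      using \<psi>(2) m by (intro integrable_test_continuous_mult[where B=c] test_continuous_slice(2) F) auto
    have j: "integrable lborel (\<lambda>t. ?J (x, t) * of_real (\<psi> t))"
      using \<psi> by (intro integrable_test_continuous_mult[where B=c] test_continuous_slice(1)[OF tJ]) auto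
    show "(LINT y|lborel. F (y, x) * of_real (\<psi> (\<Phi> (y, x)))) = (LINT t|lborel. ?J (x, t) * of_real (\<psi> t))"
    proof -
      have \<psi>c: "\<forall>t. \<bar>\<psi> t\<bar> \<le> c" using \<psi>(2) by blast
      have "(LINT y|lborel. Re (F (y, x)) * \<psi> (\<Phi> (y, x))) = (LINT t|lborel. J1 (x, t) * \<psi> t)"
        "(LINT y|lborel. Im (F (y, x)) * \<psi> (\<Phi> (y, x))) = (LINT t|lborel. J2 (x, t) * \<psi> t)"
        using J \<psi>(1) \<psi>c unfolding has_fibre_density_def by blast+
      then show ?thesis unfolding split[OF i] split[OF j] by simp
    qed
  qed
qed

text \<open>Continuity gives convergence of the averages at every point rather than almost every
  one, so the \<open>Lim\<close> in \<open>delta_integral\<close> is a genuine limit for each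
  \<open>t\<close>.\<close>

lemma average_tendsto:
  fixes j :: "'b::euclidean_space \<Rightarrow> complex"
  assumes j: "test_continuous j"
  shows "((\<lambda>r. (LINT s|lborel. j s * of_real (indicator (ball t r) s)) / measure lborel (ball t r)) \<longlongrightarrow> j t) (at_right 0)"
proof (rule tendstoI)
  fix e :: real assume e: "e > 0"
  have jc: "continuous_on UNIV j" using j by (simp add: test_continuous_def)
  then obtain d where d: "d > 0" "\<And>s. dist s t < d \<Longrightarrow> dist (j s) (j t) < e / 2"
    unfolding continuous_on_iff using e by (metis UNIV_I half_gt_zero)
  have "dist ((LINT s|lborel. j s * of_real (indicator (ball t r) s)) / measure lborel (ball t r)) (j t) < e" if r: "0 < r" "r < d" for r
  proof -
    define m where "m = measure lborel (ball t r)"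
    have m: "m > 0" unfolding m_def using r content_ball_pos by blast
    have ib: "integrable lborel (indicator (ball t r) :: _ \<Rightarrow> real)"
      by (intro integrable_real_indicator) (use emeasure_lborel_ball_finite[of t r] in \<open>simp_all add: less_top\<close>)
    have i1: "integrable lborel (\<lambda>s. j s * of_real (indicator (ball t r) s))"
      by (intro integrable_test_continuous_mult[where B=1] j) (auto simp: indicator_def)
    have ic: "integrable lborel (\<lambda>s. complex_of_real (indicator (ball t r) s))" using ib by (rule integrable_of_real)
    have i2: "integrable lborel (\<lambda>s. j t * of_real (indicator (ball t r) s))"
      using ic by (rule integrable_mult_right)
    have c2: "(LINT s|lborel. j t * of_real (indicator (ball t r) s)) = j t * of_real m"
    proof -
      have "(LINT s|lborel. complex_of_real (indicator (ball t r) s)) = of_real m"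
        unfolding integral_complex_of_real m_def by simp
      then show ?thesis by simp
    qed
    have "cmod ((LINT s|lborel. j s * of_real (indicator (ball t r) s)) - j t * of_real m)
        = cmod (LINT s|lborel. (j s - j t) * of_real (indicator (ball t r) s))"
      unfolding left_diff_distrib c2[symmetric] using i1 i2 by (subst Bochner_Integration.integral_diff) auto
    also have "\<dots> \<le> (LINT s|lborel. cmod ((j s - j t) * of_real (indicator (ball t r) s)))" by (rule integral_norm_bound)
    also have "\<dots> \<le> (LINT s|lborel. e / 2 * indicator (ball t r) s)"
    proof (rule integral_mono)
      show "integrable lborel (\<lambda>s. cmod ((j s - j t) * of_real (indicator (ball t r) s)))"
        unfolding left_diff_distrib using i1 i2 by (intro integrable_norm Bochner_Integration.integrable_diff)
      show "cmod ((j s - j t) * of_real (indicator (ball t r) s)) \<le> e / 2 * indicator (ball t r) s" for s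
        using d(2)[of s] r by (auto simp: indicator_def norm_mult dist_commute simp flip: dist_norm)
    qed (use ib in simp)
    also have "\<dots> = e / 2 * m" by (simp add: m_def)
    finally have "cmod ((LINT s|lborel. j s * of_real (indicator (ball t r) s)) - j t * of_real m) / m \<le> e / 2"
      using m by (simp add: divide_le_eq)
    moreover have "dist ((LINT s|lborel. j s * of_real (indicator (ball t r) s)) / of_real m) (j t) =
       cmod ((LINT s|lborel. j s * of_real (indicator (ball t r) s)) - j t * of_real m) / m"
    proof -
      have "(LINT s|lborel. j s * of_real (indicator (ball t r) s)) / of_real m - j t = ((LINT s|lborel. j s * of_real (indicator (ball t r) s)) - j t * of_real m) / of_real m"
        using m by (simp add: diff_divide_distrib)
      then show ?thesis using m by (simp only: dist_norm norm_divide norm_of_real abs_of_pos)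
    qed
    ultimately show ?thesis using e unfolding m_def[symmetric] by linarith
  qed
  then show "\<forall>\<^sub>F r in at_right 0. dist ((LINT s|lborel. j s * of_real (indicator (ball t r) s)) / measure lborel (ball t r)) (j t) < e"
    using d(1) by (auto simp: eventually_at_right_field)
qed

lemma smooth_continuous: "smooth f \<Longrightarrow> continuous_on UNIV f"
  unfolding smooth_def using differentiable_imp_continuous_on by (metis iter_deriv.simps(1))

lemma test_function_continuous: "test_function f \<Longrightarrow> test_continuous f"
  unfolding test_function_def
  by (rule test_continuousI[of _ "closure {x. f x \<noteq> 0}"]) (use smooth_continuous closure_subset[of "{x. f x \<noteq> 0}"] in auto)

text \<open>\<open>radon\<close> acts through the operator with exchanged variables, which
  integrates over the first argument of \<Phi>; the rank condition in that argument makes the fibre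
  map a submersion. One function \<open>J\<close> serves two purposes: its values are those of the
  transposed transform, and its integrals in \<open>t\<close> return to integrals over
  \<open>y\<close>.\<close>

lemma radon_fun_density:
  fixes \<Phi> :: "(real ^ 'd) \<times> (real ^ 'd) \<Rightarrow> real ^ 'k" and b :: "(real ^ 'd) \<times> (real ^ 'd) \<Rightarrow> complex"
  assumes \<Phi>: "smooth \<Phi>"
    and rank: "\<And>x y. rank (matrix (frechet_derivative (\<lambda>x'. \<Phi> (x', y)) (at x))) = CARD('k)"
    and b: "test_function b" and h: "continuous_on UNIV h"
  obtains J where "test_continuous J"
    "\<And>x t. radon_fun (\<Phi> \<circ> prod.swap) (b \<circ> prod.swap) t h x = J (x, t)"
    "\<And>x \<psi> c. \<psi> \<in> borel_measurable borel \<Longrightarrow> (\<And>t. \<bar>\<psi> t\<bar> \<le> c) \<Longrightarrow>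
        (LINT y|lborel. b (y, x) * h y * of_real (\<psi> (\<Phi> (y, x)))) = (LINT t|lborel. J (x, t) * of_real (\<psi> t))"
proof -
  have "iter_deriv [] \<Phi> differentiable_on UNIV" using \<Phi> unfolding smooth_def by blast
  then have d: "(\<Phi> has_derivative frechet_derivative \<Phi> (at w)) (at w)" for w
    using frechet_derivative_works by (auto simp: differentiable_on_def simp del: split_paired_All)
  define D where "D w v = frechet_derivative \<Phi> (at w) (v, 0)" for w v
  have der: "((\<lambda>y. \<Phi> (y, x)) has_derivative D (y, x)) (at y)" for y x
  proof -
    have "((\<lambda>y. (y, x)) has_derivative (\<lambda>v. (v, 0))) (at y)" by (auto intro!: derivative_eq_intros)
    from has_derivative_compose[OF this d] show ?thesis by (simp add: D_def[abs_def])
  qed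
  \<comment> \<open>The derivative in the fixed direction \<open>(v, 0)\<close> is an
    \<open>iter_deriv\<close> of length one, hence again differentiable.\<close>
  have Dc: "continuous_on UNIV (\<lambda>w. D w v)" for v
  proof -
    have "iter_deriv [(v, 0)] \<Phi> differentiable_on UNIV" using \<Phi> unfolding smooth_def by blast
    then show ?thesis using differentiable_imp_continuous_on by (simp add: D_def)
  qed
  have surj: "surj (D w)" for w
  proof -
    obtain x y where w: "w = (x, y)" by fastforce
    have "frechet_derivative (\<lambda>x'. \<Phi> (x', y)) (at x) = D w" unfolding w using der by (metis frechet_derivative_at)
    then have "rank (matrix (D w)) = CARD('k)" using rank[of y x] by simp
    then have "surj ((*v) (matrix (D w)))" by (simp add: full_rank_surjective)
    moreover have "linear (D w)" unfolding w using der has_derivative_linear by blast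
    ultimately show ?thesis by (simp add: matrix_works)
  qed
  have "continuous_on UNIV (\<lambda>w::(real^'d) \<times> (real^'d). h (fst w))"
    by (intro continuous_on_compose2[OF h] continuous_intros) auto
  from test_continuous_mult[OF this test_function_continuous[OF b]]
  have F: "test_continuous (\<lambda>w. b w * h (fst w))" by (simp add: mult.commute)
  obtain J where J: "test_continuous J"
    "\<And>x \<psi> c. \<psi> \<in> borel_measurable borel \<Longrightarrow> (\<And>t. \<bar>\<psi> t\<bar> \<le> c) \<Longrightarrow>
        (LINT y|lborel. b (y, x) * h (fst (y, x)) * of_real (\<psi> (\<Phi> (y, x)))) = (LINT t|lborel. J (x, t) * of_real (\<psi> t))"
    using ex_complex_fibre_density[OF smooth_continuous[OF \<Phi>] der Dc surj F] by blast
  show ?thesis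
  proof (rule that[OF J(1)])
    fix x t
    have eq: "(LINT y|lborel. indicator (ball t r) (\<Phi> (y, x)) * (b (y, x) * h y)) = (LINT s|lborel. J (x, s) * of_real (indicator (ball t r) s))" for r
    proof -
      have "(LINT y|lborel. indicator (ball t r) (\<Phi> (y, x)) * (b (y, x) * h y)) = (LINT y|lborel. b (y, x) * h (fst (y, x)) * of_real (indicator (ball t r) (\<Phi> (y, x))))"
        by (intro Bochner_Integration.integral_cong refl) (simp add: indicator_def)
      also have "\<dots> = (LINT s|lborel. J (x, s) * of_real (indicator (ball t r) s))"
        by (rule J(2)[where c=1]) (auto simp: indicator_def)
      finally show ?thesis .
    qed
    have "((\<lambda>r. (LINT y|lborel. indicator (ball t r) (\<Phi> (y, x)) * (b (y, x) * h y)) / measure lborel (ball t r)) \<longlongrightarrow> J (x, t)) (at_right 0)"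
      unfolding eq using average_tendsto[OF test_continuous_slice(1)[OF J(1)]] .
    then show "radon_fun (\<Phi> \<circ> prod.swap) (b \<circ> prod.swap) t h x = J (x, t)"
      unfolding radon_fun_def delta_integral_def o_def prod.swap_def fst_conv snd_conv
      by (rule tendsto_Lim[rotated]) simp
  next
    fix x :: "real^'d" and \<psi> :: "real^'k \<Rightarrow> real" and c :: real assume "\<psi> \<in> borel_measurable borel" "\<And>t. \<bar>\<psi> t\<bar> \<le> c"
    from J(2)[OF this, of x] show "(LINT y|lborel. b (y, x) * h y * of_real (\<psi> (\<Phi> (y, x)))) = (LINT t|lborel. J (x, t) * of_real (\<psi> t))"
      by simp
  qed
qed

section \<open>Discrete Frostman weights\<close>

text \<open>A lower bound for Hausdorff content, tested on finite covers with no upper limit on the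
  diameters. In this form it passes to a piece of \<open>E\<close> and applies to covers by dyadic
  cells of different generations.\<close>

definition finite_content_ge :: "real \<Rightarrow> real \<Rightarrow> 'a::metric_space set \<Rightarrow> bool" where
  "finite_content_ge s c E \<longleftrightarrow>
     (\<forall>\<U>. finite \<U> \<longrightarrow> (\<forall>U\<in>\<U>. bounded U) \<longrightarrow> E \<subseteq> \<Union>\<U> \<longrightarrow> c \<le> (\<Sum>U\<in>\<U>. diameter U powr s))"

lemma finite_content_ge_if_hausdorff_dim:
  fixes E :: "'a::metric_space set"
  assumes "hausdorff_dim E > ereal s0" "s0 \<ge> 0"
  obtains s c where "s > s0" "c > 0" "finite_content_ge s c E"
proof -
  obtain s where s: "ereal s0 < ereal s" "ereal s < hausdorff_dim E"
    using ereal_dense2[OF assms(1)] by blast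
  have s0: "s > s0" "s > 0" using s(1) assms(2) by auto
  have "hausdorff_outer s E \<noteq> 0"
  proof
    assume "hausdorff_outer s E = 0"
    then have "hausdorff_dim E \<le> ereal s" unfolding hausdorff_dim_def using s0 by (intro INF_lower) auto
    then show False using s(2) by simp
  qed
  then have "hausdorff_outer s E > 0" by (simp add: zero_less_iff_neq_zero)
  then obtain \<delta> where \<delta>: "\<delta> > 0" "hausdorff_premeasure s \<delta> E > 0"
    unfolding hausdorff_outer_def less_SUP_iff by auto
  obtain c0 where c0: "0 < ennreal c0" "ennreal c0 < hausdorff_premeasure s \<delta> E"
    using dense[OF \<delta>(2)] by (metis ennreal_cases less_top_ennreal not_less_iff_gr_or_eq order_less_le_trans top_greatest)
  have c0': "c0 > 0" using c0(1) by simp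
  \<comment> \<open>The premeasure controls covers by sets of diameter at most \<delta>; a cover
    with a larger set already costs \<open>\<delta> powr s\<close>.\<close>
  define c where "c = min c0 (\<delta> powr s)"
  have c: "c > 0" using c0' \<delta>(1) by (simp add: c_def)
  have "finite_content_ge s c E"
    unfolding finite_content_ge_def
  proof (intro allI impI)
    fix \<U> :: "'a set set" assume fin: "finite \<U>" and bdd: "\<forall>U\<in>\<U>. bounded U" and cov: "E \<subseteq> \<Union>\<U>"
    show "c \<le> (\<Sum>U\<in>\<U>. diameter U powr s)"
    proof (cases "\<exists>U\<in>\<U>. diameter U > \<delta>")
      case True
      then obtain U where U: "U \<in> \<U>" "diameter U > \<delta>" by blast
      have "\<delta> powr s \<le> diameter U powr s" using U(2) \<delta>(1) s0 by (intro powr_mono2) auto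
      also have "\<dots> \<le> (\<Sum>U\<in>\<U>. diameter U powr s)" using fin U(1) by (intro member_le_sum) auto
      finally show ?thesis by (simp add: c_def)
    next
      case False
      obtain h where h: "bij_betw h {..<card \<U>} \<U>" using ex_bij_betw_nat_finite[OF fin] by (auto simp: atLeast0LessThan)
      \<comment> \<open>The finite cover is padded by empty sets to a sequence. They cost nothing,
        since their diameter is 0 and \<open>0 powr s = 0\<close>.\<close>
      define V where "V i = (if i < card \<U> then h i else {})" for i
      have hi: "i < card \<U> \<Longrightarrow> h i \<in> \<U>" for i using h by (auto simp: bij_betw_def)
      have "E \<subseteq> (\<Union>i. V i)"
      proof
        fix x assume "x \<in> E"
        then obtain U where "U \<in> \<U>" "x \<in> U" using cov by blast
        moreover then obtain i where "i < card \<U>" "U = h i" using h by (auto simp: bij_betw_def)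
        ultimately show "x \<in> (\<Union>i. V i)" by (auto simp: V_def)
      qed
      moreover have "bounded (V i) \<and> diameter (V i) \<le> \<delta>" for i
        using hi[of i] bdd False \<delta>(1) by (auto simp: V_def not_less)
      ultimately have "hausdorff_premeasure s \<delta> E \<le> (\<Sum>i. ennreal (diameter (V i) powr s))"
        unfolding hausdorff_premeasure_def by (intro INF_lower) simp
      also have "\<dots> = (\<Sum>i<card \<U>. ennreal (diameter (V i) powr s))"
        by (rule suminf_finite) (auto simp: V_def)
      also have "\<dots> = (\<Sum>i<card \<U>. ennreal (diameter (h i) powr s))" by (intro sum.cong) (auto simp: V_def)
      also have "\<dots> = (\<Sum>U\<in>\<U>. ennreal (diameter U powr s))" by (rule sum.reindex_bij_betw[OF h])
      also have "\<dots> = ennreal (\<Sum>U\<in>\<U>. diameter U powr s)" by (simp add: sum_ennreal)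
      finally have "ennreal c0 \<le> ennreal (\<Sum>U\<in>\<U>. diameter U powr s)" using c0(2) by simp
      then have "c0 \<le> (\<Sum>U\<in>\<U>. diameter U powr s)" by (subst (asm) ennreal_le_iff) (auto intro: sum_nonneg)
      then show ?thesis by (simp add: c_def)
    qed
  qed
  with s0(1) c show ?thesis by (rule that)
qed

text \<open>Subadditivity: if each piece had a cover of cost below \<open>c / (1 + card A)\<close>,
  the union of these covers would cover \<open>E\<close> at cost below \<open>c\<close>. The added 1
  keeps the denominator positive and the final inequality strict.\<close>

lemma finite_content_ge_localize:
  fixes E :: "'a::metric_space set"
  assumes E: "finite_content_ge s c E" "c > 0" and A: "finite A" "E \<subseteq> (\<Union>a\<in>A. B a)"
  obtains a c' where "a \<in> A" "c' > 0" "finite_content_ge s c' (E \<inter> B a)"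
proof (rule ccontr)
  note th = that
  assume "\<not> thesis"
  moreover have "c / (1 + card A) > 0" using E(2) by (simp add: add_pos_nonneg)
  ultimately have "\<not> finite_content_ge s (c / (1 + card A)) (E \<inter> B a)" if "a \<in> A" for a
    using that th by blast
  then have "\<forall>a\<in>A. \<exists>\<U>. finite \<U> \<and> (\<forall>U\<in>\<U>. bounded U) \<and> E \<inter> B a \<subseteq> \<Union>\<U> \<and> (\<Sum>U\<in>\<U>. diameter U powr s) < c / (1 + card A)"
    unfolding finite_content_ge_def by (meson not_le)
  then obtain \<U> where U: "\<And>a. a \<in> A \<Longrightarrow> finite (\<U> a)" "\<And>a U. a \<in> A \<Longrightarrow> U \<in> \<U> a \<Longrightarrow> bounded U"
    "\<And>a. a \<in> A \<Longrightarrow> E \<inter> B a \<subseteq> \<Union>(\<U> a)" "\<And>a. a \<in> A \<Longrightarrow> (\<Sum>U\<in>\<U> a. diameter U powr s) < c / (1 + card A)"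
    by metis
  have "finite (\<Union>a\<in>A. \<U> a)" "\<forall>U\<in>(\<Union>a\<in>A. \<U> a). bounded U" using U(1,2) A(1) by auto
  moreover have "E \<subseteq> \<Union>(\<Union>a\<in>A. \<U> a)"
  proof
    fix x assume x: "x \<in> E"
    then obtain a where "a \<in> A" "x \<in> B a" using A(2) by blast
    with U(3)[of a] x show "x \<in> \<Union>(\<Union>a\<in>A. \<U> a)" by blast
  qed
  ultimately have "c \<le> (\<Sum>U\<in>(\<Union>a\<in>A. \<U> a). diameter U powr s)"
    using E(1) unfolding finite_content_ge_def by blast
  also have "(\<Union>a\<in>A. \<U> a) = snd ` Sigma A \<U>" by force
  also have "(\<Sum>U\<in>snd ` Sigma A \<U>. diameter U powr s) \<le> (\<Sum>z\<in>Sigma A \<U>. diameter (snd z) powr s)"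
    using sum_image_le[of "Sigma A \<U>" "\<lambda>U. diameter U powr s" snd] A(1) U(1) by (simp add: o_def)
  also have "\<dots> = (\<Sum>a\<in>A. \<Sum>U\<in>\<U> a. diameter U powr s)"
    using A(1) U(1) by (subst sum.Sigma) (auto simp: case_prod_unfold)
  also have "\<dots> \<le> (\<Sum>a\<in>A. c / (1 + card A))" using U(4) by (intro sum_mono less_imp_le)
  also have "\<dots> = c * (card A / (1 + card A))" by simp
  also have "\<dots> < c * 1" using E(2) by (intro mult_strict_left_mono) (simp_all add: divide_less_eq)
  finally show False by simp
qed

text \<open>Starting from saturated cells of generation \<open>n\<close>, the weights are scaled down in every overfull cell of the coarser
  generations in turn.\<close>

lemma frostman_weights:
  fixes q :: "nat \<Rightarrow> 'a \<Rightarrow> 'b" and \<theta> :: "nat \<Rightarrow> real"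
  assumes P: "finite P" and nested: "\<And>m x y. q (Suc m) x = q (Suc m) y \<Longrightarrow> q m x = q m y"
    and \<theta>: "\<And>m. \<theta> m > 0" and "j \<le> n"
  shows "\<exists>w. (\<forall>x\<in>P. w x \<ge> 0) \<and>
     (\<forall>m x. j \<le> m \<longrightarrow> m \<le> n \<longrightarrow> x \<in> P \<longrightarrow> (\<Sum>y | y \<in> P \<and> q m y = q m x. w y) \<le> \<theta> m) \<and>
     (\<forall>x\<in>P. \<exists>m. j \<le> m \<and> m \<le> n \<and> (\<Sum>y | y \<in> P \<and> q m y = q m x. w y) = \<theta> m)"
  using \<open>j \<le> n\<close>
proof (induction rule: inc_induct)
  case base
  \<comment> \<open>In generation \<open>n\<close> the mass \<open>\<theta> n\<close> of a cell is
    divided evenly among its points, so that every cell is saturated.\<close>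
  define w where "w x = \<theta> n / card {y \<in> P. q n y = q n x}" for x
  have eq: "(\<Sum>y | y \<in> P \<and> q n y = q n x. w y) = \<theta> n" if "x \<in> P" for x
  proof -
    have "(\<Sum>y | y \<in> P \<and> q n y = q n x. w y) = (\<Sum>y | y \<in> P \<and> q n y = q n x. w x)"
      by (intro sum.cong) (auto simp: w_def)
    moreover have "card {y \<in> P. q n y = q n x} \<noteq> 0" using P that by auto
    ultimately show ?thesis by (simp add: w_def)
  qed
  have "w x \<ge> 0" for x using \<theta>[of n] by (simp add: w_def less_imp_le)
  show ?case
  proof (intro exI[of _ w] conjI ballI allI impI)
    fix m x assume "n \<le> m" "m \<le> n" "x \<in> P"
    then have "m = n" "x \<in> P" by simp_all
    then show "(\<Sum>y | y \<in> P \<and> q m y = q m x. w y) \<le> \<theta> m" using eq by simp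
  next
    fix x assume "x \<in> P"
    then show "\<exists>m\<ge>n. m \<le> n \<and> (\<Sum>y | y \<in> P \<and> q m y = q m x. w y) = \<theta> m"
      using eq by blast
  qed (rule \<open>\<And>x. w x \<ge> 0\<close>)
next
  case (step j)
  from step.IH obtain w where w: "\<And>x. x \<in> P \<Longrightarrow> w x \<ge> 0"
     "\<And>m x. Suc j \<le> m \<Longrightarrow> m \<le> n \<Longrightarrow> x \<in> P \<Longrightarrow> (\<Sum>y | y \<in> P \<and> q m y = q m x. w y) \<le> \<theta> m"
     "\<And>x. x \<in> P \<Longrightarrow> \<exists>m. Suc j \<le> m \<and> m \<le> n \<and> (\<Sum>y | y \<in> P \<and> q m y = q m x. w y) = \<theta> m"
    by blast
  define S where "S x = (\<Sum>y | y \<in> P \<and> q j y = q j x. w y)" for x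
  \<comment> \<open>Constant on cells of generation \<open>j\<close>, so the sum over every finer
    cell is multiplied by the same factor. Where the factor is 1, saturated cells remain saturated;
    elsewhere the cell of generation \<open>j\<close> becomes saturated itself.\<close>
  define \<nu> where "\<nu> x = (if S x \<le> \<theta> j then 1 else \<theta> j / S x)" for x
  define w' where "w' x = \<nu> x * w x" for x
  have \<nu>: "0 \<le> \<nu> x" "\<nu> x \<le> 1" for x
    using \<theta>[of j] by (auto simp: \<nu>_def intro: divide_nonneg_pos)
  have \<nu>_cong: "\<nu> y = \<nu> x" if "q j y = q j x" for x y using that by (simp add: \<nu>_def S_def)
  have nest: "q j y = q j x" if "j \<le> m" "q m y = q m x" for m x y
    using that by (induction rule: dec_induct) (auto dest: nested)
  have sum': "(\<Sum>y | y \<in> P \<and> q m y = q m x. w' y) = \<nu> x * (\<Sum>y | y \<in> P \<and> q m y = q m x. w y)" if "j \<le> m" for m x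
    unfolding sum_distrib_left w'_def using nest[OF that] \<nu>_cong by (intro sum.cong refl) (metis (mono_tags, lifting) mem_Collect_eq)
  have "w' x \<ge> 0" if "x \<in> P" for x using w(1)[OF that] \<nu> by (simp add: w'_def)
  moreover have "(\<Sum>y | y \<in> P \<and> q m y = q m x. w' y) \<le> \<theta> m" if "j \<le> m" "m \<le> n" "x \<in> P" for m x
  proof (cases "m = j")
    case True
    then show ?thesis using sum'[of j x] \<theta>[of j] by (auto simp: \<nu>_def S_def[symmetric])
  next
    case False
    have "0 \<le> (\<Sum>y | y \<in> P \<and> q m y = q m x. w y)" using w(1) by (intro sum_nonneg) auto
    then have "\<nu> x * (\<Sum>y | y \<in> P \<and> q m y = q m x. w y) \<le> (\<Sum>y | y \<in> P \<and> q m y = q m x. w y)"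
      using \<nu> by (intro mult_left_le_one_le) auto
    then show ?thesis using sum'[OF that(1), of x] w(2)[of m x] that False by simp
  qed
  moreover have "\<exists>m. j \<le> m \<and> m \<le> n \<and> (\<Sum>y | y \<in> P \<and> q m y = q m x. w' y) = \<theta> m" if x: "x \<in> P" for x
  proof (cases "S x \<le> \<theta> j")
    case True
    obtain m where m: "Suc j \<le> m" "m \<le> n" "(\<Sum>y | y \<in> P \<and> q m y = q m x. w y) = \<theta> m" using w(3)[OF x] by blast
    then show ?thesis using sum'[of m x] True by (intro exI[of _ m]) (auto simp: \<nu>_def)
  next
    case False
    then have "S x > 0" using \<theta>[of j] by simp
    then show ?thesis using sum'[of j x] False step.hyps by (intro exI[of _ j]) (auto simp: \<nu>_def S_def[symmetric])
  qed
  ultimately show ?case by (intro exI[of _ w']) blast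
qed

text \<open>Names the half-open dyadic cube of side \<open>1 / 2 ^ m\<close> containing
  \<open>x\<close> by its integer corner. The restriction to \<open>Basis\<close> makes labels equal
  exactly when the cubes are.\<close>

definition dyadic_label :: "nat \<Rightarrow> 'a::euclidean_space \<Rightarrow> 'a \<Rightarrow> int" where
  "dyadic_label m x = restrict (\<lambda>b. \<lfloor>2 ^ m * (x \<bullet> b)\<rfloor>) Basis"

lemma dyadic_label_nested:
  assumes "dyadic_label (Suc m) x = dyadic_label (Suc m) y"
  shows "dyadic_label m x = dyadic_label m y"
proof -
  have "\<lfloor>2 ^ m * (x \<bullet> b)\<rfloor> = \<lfloor>2 ^ m * (y \<bullet> b)\<rfloor>" if b: "b \<in> Basis" for b
  proof -
    have h: "\<lfloor>2 ^ m * (z \<bullet> b)\<rfloor> = \<lfloor>2 ^ Suc m * (z \<bullet> b)\<rfloor> div 2" for z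
      using floor_divide_real_eq_div[of 2 "2 ^ Suc m * (z \<bullet> b)"] by simp
    have "\<lfloor>2 ^ Suc m * (x \<bullet> b)\<rfloor> = \<lfloor>2 ^ Suc m * (y \<bullet> b)\<rfloor>"
      using fun_cong[OF assms, of b] b unfolding dyadic_label_def by (simp only: restrict_apply')
    then show ?thesis unfolding h by (rule arg_cong)
  qed
  then show ?thesis unfolding dyadic_label_def by (intro restrict_ext)
qed

lemma dyadic_label_nested':
  assumes "j \<le> m" "dyadic_label m x = dyadic_label m y"
  shows "dyadic_label j x = dyadic_label j y"
  using assms by (induction rule: dec_induct) (auto dest: dyadic_label_nested)

lemma dist_le_if_dyadic_label_eq:
  fixes x y :: "'a::euclidean_space"
  assumes "dyadic_label m x = dyadic_label m y"
  shows "dist x y \<le> DIM('a) / 2 ^ m"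
proof -
  have "\<bar>(x - y) \<bullet> b\<bar> \<le> 1 / 2 ^ m" if b: "b \<in> Basis" for b
  proof -
    have "\<lfloor>2 ^ m * (x \<bullet> b)\<rfloor> = \<lfloor>2 ^ m * (y \<bullet> b)\<rfloor>"
      using fun_cong[OF assms, of b] b unfolding dyadic_label_def by (simp only: restrict_apply')
    then have "\<bar>2 ^ m * (x \<bullet> b) - 2 ^ m * (y \<bullet> b)\<bar> \<le> 1" by linarith
    also have "2 ^ m * (x \<bullet> b) - 2 ^ m * (y \<bullet> b) = 2 ^ m * ((x - y) \<bullet> b)" by (simp add: inner_diff_left right_diff_distrib)
    finally show ?thesis by (simp add: abs_mult field_simps)
  qed
  then have "(\<Sum>b\<in>Basis. \<bar>(x - y) \<bullet> b\<bar>) \<le> (\<Sum>b\<in>(Basis::'a set). 1 / 2 ^ m)" by (rule sum_mono)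
  then show ?thesis using norm_le_l1[of "x - y"] by (simp add: dist_norm)
qed

text \<open>A displacement of at most one side length changes each integer coordinate by at most 1,
  which leaves three choices per coordinate.\<close>

lemma finite_dyadic_labels_near:
  fixes x :: "'a::euclidean_space"
  shows "\<exists>L. finite L \<and> card L \<le> 3 ^ DIM('a) \<and> (\<forall>y. dist x y \<le> 1 / 2 ^ m \<longrightarrow> dyadic_label m y \<in> L)"
proof -
  define L where "L = PiE Basis (\<lambda>b. {\<lfloor>2 ^ m * (x \<bullet> b)\<rfloor> - 1..\<lfloor>2 ^ m * (x \<bullet> b)\<rfloor> + 1})"
  have "finite L" unfolding L_def by (intro finite_PiE) auto
  moreover have "card L \<le> 3 ^ DIM('a)" unfolding L_def by (subst card_PiE) auto
  moreover have "dyadic_label m y \<in> L" if y: "dist x y \<le> 1 / 2 ^ m" for y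
    unfolding L_def dyadic_label_def
  proof (rule restrict_PiE_iff[THEN iffD2], rule ballI)
    fix b :: 'a assume b: "b \<in> Basis"
    have "\<bar>(x - y) \<bullet> b\<bar> \<le> 1 / 2 ^ m" using Basis_le_norm[OF b, of "x - y"] y by (simp add: dist_norm)
    then have "2 ^ m * \<bar>(x - y) \<bullet> b\<bar> \<le> 1" by (simp add: field_simps)
    then have "\<bar>2 ^ m * ((x - y) \<bullet> b)\<bar> \<le> 1" by (simp add: abs_mult)
    then have "\<bar>2 ^ m * (x \<bullet> b) - 2 ^ m * (y \<bullet> b)\<bar> \<le> 1" by (simp add: inner_diff_left right_diff_distrib)
    then show "\<lfloor>2 ^ m * (y \<bullet> b)\<rfloor> \<in> {\<lfloor>2 ^ m * (x \<bullet> b)\<rfloor> - 1..\<lfloor>2 ^ m * (x \<bullet> b)\<rfloor> + 1}"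
      by (simp; linarith)
  qed
  ultimately show ?thesis by blast
qed

lemma finite_dyadic_labels:
  fixes E :: "'a::euclidean_space set"
  assumes "bounded E"
  shows "finite (dyadic_label m ` E)"
proof -
  obtain R where R: "\<And>x. x \<in> E \<Longrightarrow> norm x \<le> R" using assms by (auto simp: bounded_iff)
  have "dyadic_label m ` E \<subseteq> PiE Basis (\<lambda>_. {- \<lceil>2 ^ m * R\<rceil> - 1..\<lceil>2 ^ m * R\<rceil> + 1})"
  proof
    fix k assume "k \<in> dyadic_label m ` E"
    then obtain x where x: "x \<in> E" "k = dyadic_label m x" by auto
    have "\<lfloor>2 ^ m * (x \<bullet> b)\<rfloor> \<in> {- \<lceil>2 ^ m * R\<rceil> - 1..\<lceil>2 ^ m * R\<rceil> + 1}" if b: "b \<in> Basis" for b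
    proof -
      have "\<bar>x \<bullet> b\<bar> \<le> R" using Basis_le_norm[OF b, of x] R[OF x(1)] by simp
      then have "\<bar>2 ^ m * (x \<bullet> b)\<bar> \<le> 2 ^ m * R" by (simp add: abs_mult)
      then show ?thesis by (simp; linarith)
    qed
    then show "k \<in> PiE Basis (\<lambda>_. {- \<lceil>2 ^ m * R\<rceil> - 1..\<lceil>2 ^ m * R\<rceil> + 1})"
      unfolding x(2) dyadic_label_def by (intro restrict_PiE_iff[THEN iffD2] ballI)
  qed
  then show ?thesis by (rule finite_subset) (auto intro: finite_PiE)
qed

text \<open>The constants do not depend on the scale \<open>2\<^sup>-\<^sup>n\<close>. Such weights replace a Frostman measure, so that no weak limit is
  needed.\<close>

lemma ex_frostman_weights:
  fixes E :: "'a::euclidean_space set"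
  assumes E: "bounded E" "finite_content_ge s c E" and s: "s > 0"
  shows "\<exists>P w. finite P \<and> P \<subseteq> E \<and> (\<forall>x\<in>P. w x \<ge> 0) \<and> c \<le> real DIM('a) powr s * sum w P \<and>
     (\<forall>m\<le>n. \<forall>x. (\<Sum>y | y \<in> P \<and> dist x y \<le> 1 / 2 ^ m. w y) \<le> 3 ^ DIM('a) * 2 powr (- s * m))"
proof -
  define \<theta> where "\<theta> m = 2 powr (- s * real m)" for m :: nat
  have fin: "finite (dyadic_label n ` E)" by (rule finite_dyadic_labels[OF E(1)])
  \<comment> \<open>A finite subset of \<open>E\<close> meeting every cell of generation
    \<open>n\<close> that \<open>E\<close> meets.\<close>
  obtain P where P: "P \<subseteq> E" "finite P" "dyadic_label n ` P = dyadic_label n ` E"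
    using finite_subset_image[OF fin subset_refl] by metis
  obtain w where w: "\<And>x. x \<in> P \<Longrightarrow> w x \<ge> 0"
     "\<And>m x. m \<le> n \<Longrightarrow> x \<in> P \<Longrightarrow> (\<Sum>y | y \<in> P \<and> dyadic_label m y = dyadic_label m x. w y) \<le> \<theta> m"
     "\<And>x. x \<in> P \<Longrightarrow> \<exists>m. m \<le> n \<and> (\<Sum>y | y \<in> P \<and> dyadic_label m y = dyadic_label m x. w y) = \<theta> m"
  proof -
    have pos: "\<theta> m > 0" for m by (simp add: \<theta>_def)
    note ex = frostman_weights[where q=dyadic_label and \<theta>=\<theta>, OF P(2) dyadic_label_nested pos le0[of n]]
    from ex obtain w where w: "(\<forall>x\<in>P. w x \<ge> 0) \<and>
     (\<forall>m x. 0 \<le> m \<longrightarrow> m \<le> n \<longrightarrow> x \<in> P \<longrightarrow> (\<Sum>y | y \<in> P \<and> dyadic_label m y = dyadic_label m x. w y) \<le> \<theta> m) \<and>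
     (\<forall>x\<in>P. \<exists>m. 0 \<le> m \<and> m \<le> n \<and> (\<Sum>y | y \<in> P \<and> dyadic_label m y = dyadic_label m x. w y) = \<theta> m)" ..
    show thesis by (rule that[of w]) (use w in simp_all)
  qed
  define sat where "sat x m \<longleftrightarrow> m \<le> n \<and> (\<Sum>y | y \<in> P \<and> dyadic_label m y = dyadic_label m x. w y) = \<theta> m" for x m
  \<comment> \<open>The generation of the coarsest saturated cell around \<open>x\<close>. By
    nesting and minimality, two of these cells are equal or disjoint, so they partition
    \<open>P\<close> and the total mass is the sum of their thresholds.\<close>
  define l where "l x = (LEAST m. sat x m)" for x
  have l1: "sat x (l x)" if "x \<in> P" for x
    unfolding l_def by (rule LeastI_ex) (use w(3)[OF that] in \<open>simp add: sat_def\<close>)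
  have l2: "l x \<le> m" if "sat x m" for x m
    unfolding l_def using that by (rule Least_le)
  define C where "C x = {y \<in> P. dyadic_label (l x) y = dyadic_label (l x) x}" for x
  have C_eq: "C y = C x" if xy: "x \<in> P" "y \<in> P" "C x \<inter> C y \<noteq> {}" "l x \<le> l y" for x y
  proof -
    obtain z where z: "dyadic_label (l x) z = dyadic_label (l x) x" "dyadic_label (l y) z = dyadic_label (l y) y"
      using xy(3) by (auto simp: C_def)
    have "dyadic_label (l x) z = dyadic_label (l x) y" using dyadic_label_nested'[OF xy(4) z(2)] .
    then have e: "dyadic_label (l x) y = dyadic_label (l x) x" using z(1) by simp
    then have "sat y (l x)" using l1[OF xy(1)] by (simp add: sat_def)
    then have "l y = l x" using l2[of y "l x"] xy(4) by (simp add: le_antisym)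
    then show ?thesis using e by (simp add: C_def)
  qed
  have disj: "C x = C y" if "x \<in> P" "y \<in> P" "C x \<inter> C y \<noteq> {}" for x y
    using C_eq[of x y] C_eq[of y x] that by (cases "l x \<le> l y") (auto simp: Int_commute)
  have xC: "x \<in> C x" if "x \<in> P" for x using that by (simp add: C_def)
  obtain r where r: "\<And>A. A \<in> C ` P \<Longrightarrow> r A \<in> P \<and> C (r A) = A"
    using bchoice[of "C ` P" "\<lambda>A y. y \<in> P \<and> C y = A"] by blast
  have "sum w P = sum w (\<Union>(C ` P))"
  proof -
    have "\<Union>(C ` P) = P" using xC by (auto simp: C_def)
    then show ?thesis by simp
  qed
  also have "\<dots> = (\<Sum>A\<in>C ` P. sum w A)"
    using P(2) disj by (subst sum.Union_disjoint) (auto simp: C_def)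
  also have "\<dots> = (\<Sum>A\<in>C ` P. \<theta> (l (r A)))"
  proof (intro sum.cong refl)
    fix A assume "A \<in> C ` P"
    then have "r A \<in> P" "C (r A) = A" using r by auto
    then show "sum w A = \<theta> (l (r A))" using l1[of "r A"] by (auto simp: sat_def C_def)
  qed
  finally have total: "sum w P = (\<Sum>A\<in>C ` P. \<theta> (l (r A)))" .
  \<comment> \<open>The part of \<open>E\<close> in the chosen cell, not merely its points of
    \<open>P\<close>, so that these sets cover all of \<open>E\<close>. Comparing diameters with
    thresholds turns the content bound into a lower bound for the total mass.\<close>
  define D where "D A = E \<inter> {y. dyadic_label (l (r A)) y = dyadic_label (l (r A)) (r A)}" for A
  have diam: "diameter (D A) powr s \<le> real DIM('a) powr s * \<theta> (l (r A))" for A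
  proof -
    have "diameter (D A) \<le> DIM('a) / 2 ^ l (r A)"
      by (rule diameter_le) (auto simp: D_def dist_norm[symmetric] intro!: dist_le_if_dyadic_label_eq)
    then have "diameter (D A) powr s \<le> (DIM('a) / 2 ^ l (r A)) powr s"
      using s E(1) by (intro powr_mono2) (auto intro!: diameter_ge_0 bounded_subset[of E] simp: D_def)
    also have "\<dots> = real DIM('a) powr s * \<theta> (l (r A))"
      by (simp add: powr_divide \<theta>_def powr_minus_divide powr_powr mult.commute flip: powr_realpow)
    finally show ?thesis .
  qed
  have "c \<le> (\<Sum>U\<in>D ` C ` P. diameter U powr s)"
  proof -
    have "E \<subseteq> \<Union>(D ` C ` P)"
    proof
      fix x assume x: "x \<in> E"
      then obtain p where p: "p \<in> P" "dyadic_label n x = dyadic_label n p" using P(3) by (metis imageE imageI)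
      have rp: "r (C p) \<in> P" "C (r (C p)) = C p" using r p by auto
      then have "p \<in> C (r (C p))" using xC[OF p(1)] by simp
      moreover have "l (r (C p)) \<le> n" using l1[OF rp(1)] by (simp add: sat_def)
      ultimately have "dyadic_label (l (r (C p))) x = dyadic_label (l (r (C p))) (r (C p))"
        using dyadic_label_nested'[OF _ p(2)] by (simp add: C_def)
      then show "x \<in> \<Union>(D ` C ` P)" using x p(1) by (auto simp: D_def)
    qed
    moreover have "finite (D ` C ` P)" using P(2) by simp
    moreover have "\<forall>U\<in>D ` C ` P. bounded U" using E(1) by (auto simp: D_def intro: bounded_subset[of E])
    ultimately show ?thesis using E(2) unfolding finite_content_ge_def by blast
  qed
  also have "\<dots> \<le> (\<Sum>A\<in>C ` P. diameter (D A) powr s)"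
    using sum_image_le[of "C ` P" "\<lambda>U. diameter U powr s" D] P(2) by (simp add: o_def)
  also have "\<dots> \<le> (\<Sum>A\<in>C ` P. real DIM('a) powr s * \<theta> (l (r A)))" by (intro sum_mono diam)
  also have "\<dots> = real DIM('a) powr s * sum w P" by (simp add: total sum_distrib_left)
  finally have lower: "c \<le> real DIM('a) powr s * sum w P" .
  have cells: "(\<Sum>y | y \<in> P \<and> dyadic_label m y \<in> L. w y) \<le> card L * \<theta> m" if "finite L" "m \<le> n" for L m
  proof -
    have "(\<Sum>y | y \<in> P \<and> dyadic_label m y \<in> L. w y) = (\<Sum>k\<in>L. \<Sum>y | y \<in> {y \<in> P. dyadic_label m y \<in> L} \<and> dyadic_label m y = k. w y)"
      using P(2) that(1) by (intro sum.group[symmetric]) auto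
    also have "\<dots> \<le> (\<Sum>k\<in>L. \<theta> m)"
    proof (rule sum_mono)
      fix k assume k: "k \<in> L"
      show "(\<Sum>y | y \<in> {y \<in> P. dyadic_label m y \<in> L} \<and> dyadic_label m y = k. w y) \<le> \<theta> m"
      proof (cases "\<exists>x\<in>P. dyadic_label m x = k")
        case True
        then obtain x where x: "x \<in> P" "dyadic_label m x = k" by blast
        have "{y. y \<in> {y \<in> P. dyadic_label m y \<in> L} \<and> dyadic_label m y = k} = {y. y \<in> P \<and> dyadic_label m y = dyadic_label m x}"
          using x k by auto
        then show ?thesis using w(2)[OF that(2) x(1)] by simp
      next
        case False
        then have e: "{y. y \<in> {y \<in> P. dyadic_label m y \<in> L} \<and> dyadic_label m y = k} = {}" by auto
        show ?thesis unfolding e by (simp add: \<theta>_def)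
      qed
    qed
    finally show ?thesis by simp
  qed
  have ball: "(\<Sum>y | y \<in> P \<and> dist x y \<le> 1 / 2 ^ m. w y) \<le> 3 ^ DIM('a) * \<theta> m" if m: "m \<le> n" for m x
  proof -
    obtain L where L: "finite L" "card L \<le> 3 ^ DIM('a)" "\<And>y. dist x y \<le> 1 / 2 ^ m \<Longrightarrow> dyadic_label m y \<in> L"
      using finite_dyadic_labels_near[of x m] by blast
    have "(\<Sum>y | y \<in> P \<and> dist x y \<le> 1 / 2 ^ m. w y) \<le> (\<Sum>y | y \<in> P \<and> dyadic_label m y \<in> L. w y)"
      using P(2) L(3) w(1) by (intro sum_mono2) auto
    also have "\<dots> \<le> card L * \<theta> m" by (rule cells[OF L(1) m])
    also have "\<dots> \<le> 3 ^ DIM('a) * \<theta> m"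
    proof (rule mult_right_mono)
      have "real (card L) \<le> real (3 ^ DIM('a))" using L(2) by (simp only: of_nat_le_iff)
      then show "real (card L) \<le> 3 ^ DIM('a)" by simp
    qed (simp add: \<theta>_def)
    finally show ?thesis .
  qed
  show ?thesis
    using P(1,2) w(1) lower ball unfolding \<theta>_def by (intro exI[of _ P] exI[of _ w]) blast
qed

section \<open>Gaussian sums under Frostman growth\<close>

lemma gaussian_decay:
  assumes "s \<ge> 0"
  obtains K where "K > 0" "\<And>u. u \<ge> 0 \<Longrightarrow> exp (- pi * u\<^sup>2) \<le> K * (1 + u) powr (- s)"
proof -
  obtain N :: nat where N: "s \<le> real N" using real_arch_simple by blast
  \<comment> \<open>The power is at most \<open>fact N * exp (1 + u)\<close>, and
    \<open>1 + u - pi * u\<^sup>2\<close> is at most 2 because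
    \<open>u \<le> 1 + u\<^sup>2\<close>.\<close>
  define K where "K = fact N * exp (2 :: real)"
  have "exp (- pi * u\<^sup>2) \<le> K * (1 + u) powr (- s)" if u: "u \<ge> 0" for u :: real
  proof -
    have "(1 + u) powr s \<le> (1 + u) ^ N" using powr_mono[OF N, of "1 + u"] u by (simp add: powr_realpow)
    also have "\<dots> \<le> fact N * exp (1 + u)" using u by (intro power_le_fact_exp) simp
    finally have "(1 + u) powr s * exp (- pi * u\<^sup>2) \<le> fact N * exp (1 + u) * exp (- pi * u\<^sup>2)"
      by (intro mult_right_mono) auto
    also have "\<dots> = fact N * exp (1 + u - pi * u\<^sup>2)" by (simp add: exp_diff exp_minus divide_inverse)
    also have "\<dots> \<le> fact N * exp 2"
    proof -
      have "u \<le> 1 + u\<^sup>2" using zero_le_power2[of "u - 1"] u by (simp add: power2_eq_square algebra_simps)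
      moreover have "1 * u\<^sup>2 \<le> pi * u\<^sup>2" using pi_gt3 by (intro mult_right_mono) auto
      ultimately show ?thesis by simp
    qed
    finally show ?thesis unfolding K_def powr_minus_divide using u
      by (simp add: field_simps)
  qed
  then show ?thesis by (intro that[of K]) (auto simp: K_def)
qed

text \<open>The Gaussian of width \<open>1 / 2 ^ j\<close> is cut into balls of radius
  \<open>2 ^ i / 2 ^ j\<close>. Such a ball has mass of order \<open>2 powr (s * i - s * j)\<close>,
  and decay of exponent \<open>s + 1\<close> leaves a factor \<open>(1 / 2) ^ i\<close>; the
  geometric sum 2 explains the exponent \<open>s + 2\<close> in the constant.\<close>

lemma gaussian_sum_bound:
  fixes P :: "'a::euclidean_space set"
  assumes P: "finite P" and w: "\<And>x. x \<in> P \<Longrightarrow> w x \<ge> 0" and s: "s \<ge> 0"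
    and M: "M \<ge> 0" "sum w P \<le> M" "\<And>m x. m \<le> n \<Longrightarrow> (\<Sum>y | y \<in> P \<and> dist x y \<le> 1 / 2 ^ m. w y) \<le> M * 2 powr (- s * m)"
    and K: "K > 0" "\<And>u. u \<ge> 0 \<Longrightarrow> exp (- pi * u\<^sup>2) \<le> K * (1 + u) powr (- (s + 1))"
    and j: "j \<le> n"
  shows "(\<Sum>y\<in>P. w y * exp (- pi * (2 ^ j * dist x y)\<^sup>2)) \<le> 2 powr (s + 2) * K * M * 2 powr (- s * j)"
proof -
  have "\<exists>I::nat. \<forall>y\<in>P. 2 ^ j * dist x y \<le> 2 ^ I"
  proof -
    have "\<exists>I::nat. 2 ^ j * dist x y \<le> 2 ^ I" for y
      using real_arch_pow[of 2 "2 ^ j * dist x y"] by (auto intro: less_imp_le)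
    then obtain I where I: "\<And>y. 2 ^ j * dist x y \<le> 2 ^ (I y)" by metis
    have "2 ^ j * dist x y \<le> 2 ^ (Max (I ` P))" if "y \<in> P" for y
      using I[of y] power_increasing[of "I y" "Max (I ` P)" "2::real"] that P by (meson Max_ge finite_imageI imageI order_trans one_le_numeral)
    then show ?thesis by blast
  qed
  then obtain I :: nat where I: "\<And>y. y \<in> P \<Longrightarrow> 2 ^ j * dist x y \<le> 2 ^ I" by blast
  define a where "a i = 2 powr (- (s + 1) * real i)" for i :: nat
  have layer: "(1 + u) powr (- (s + 1)) \<le> 2 powr (s + 1) * (\<Sum>i\<le>I. a i * of_bool (u \<le> 2 ^ i))"
    if u: "u \<ge> 0" "u \<le> 2 ^ I" for u :: real
  proof -
    define i where "i = (LEAST i. u \<le> 2 ^ i)"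
    have i: "u \<le> 2 ^ i" "i \<le> I" unfolding i_def using LeastI[of "\<lambda>i. u \<le> 2 ^ i", OF u(2)] Least_le[of "\<lambda>i. u \<le> 2 ^ i", OF u(2)] by auto
    have "(1 + u) powr (- (s + 1)) \<le> 2 powr (s + 1) * a i"
    proof (cases i)
      case 0
      have "(1 + u) powr (- (s + 1)) \<le> 1 powr (- (s + 1))" using u s by (intro powr_mono2') auto
      also have "\<dots> \<le> 2 powr (s + 1)" using s by (simp add: ge_one_powr_ge_zero)
      finally show ?thesis by (simp add: a_def 0)
    next
      case (Suc i')
      have "\<not> u \<le> 2 ^ i'" using not_less_Least[of i' "\<lambda>i. u \<le> 2 ^ i"] Suc unfolding i_def by simp
      then have "(1 + u) powr (- (s + 1)) \<le> (2 ^ i') powr (- (s + 1))" using s by (intro powr_mono2') auto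
      also have "\<dots> = 2 powr (s + 1) * a i"
        by (simp add: a_def Suc powr_powr powr_add[symmetric] algebra_simps flip: powr_realpow)
      finally show ?thesis .
    qed
    also have "\<dots> \<le> 2 powr (s + 1) * (\<Sum>i\<le>I. a i * of_bool (u \<le> 2 ^ i))"
    proof (rule mult_left_mono)
      have "a i * of_bool (u \<le> 2 ^ i) \<le> (\<Sum>i\<le>I. a i * of_bool (u \<le> 2 ^ i))"
        using i by (intro member_le_sum) (auto simp: a_def)
      then show "a i \<le> (\<Sum>i\<le>I. a i * of_bool (u \<le> 2 ^ i))" using i by simp
    qed simp
    finally show ?thesis .
  qed
  \<comment> \<open>For \<open>i \<le> j\<close> the radius is a dyadic scale
    \<open>1 / 2 ^ (j - i)\<close> covered by the growth condition; for larger \<open>i\<close> the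
    radius exceeds 1 and the total mass suffices.\<close>
  have mass: "(\<Sum>y\<in>P. w y * of_bool (2 ^ j * dist x y \<le> 2 ^ i)) \<le> M * 2 powr (s * i - s * j)" for i
  proof -
    have e: "(\<Sum>y\<in>P. w y * of_bool (2 ^ j * dist x y \<le> 2 ^ i)) = (\<Sum>y | y \<in> P \<and> 2 ^ j * dist x y \<le> 2 ^ i. w y)"
      using P by (intro sum.mono_neutral_cong_right) auto
    show ?thesis
    proof (cases "i \<le> j")
      case True
      have "2 ^ j * dist x y \<le> 2 ^ i \<longleftrightarrow> dist x y \<le> 1 / 2 ^ (j - i)" for y
        using True by (simp add: power_diff field_simps)
      then have "(\<Sum>y | y \<in> P \<and> 2 ^ j * dist x y \<le> 2 ^ i. w y) \<le> M * 2 powr (- s * (j - i))"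
        using M(3)[of "j - i" x] j by simp
      also have "- s * real (j - i) = s * i - s * j" using True by (simp add: of_nat_diff algebra_simps)
      finally show ?thesis using e by simp
    next
      case False
      have "(\<Sum>y | y \<in> P \<and> 2 ^ j * dist x y \<le> 2 ^ i. w y) \<le> sum w P" using P w by (intro sum_mono2) auto
      also have "\<dots> \<le> M * 1" using M by simp
      also have "\<dots> \<le> M * 2 powr (s * i - s * j)"
        using M(1) s False by (intro mult_left_mono ge_one_powr_ge_zero) (auto simp: mult_left_mono)
      finally show ?thesis using e by simp
    qed
  qed
  have geo: "(\<Sum>i\<le>I. (1 / 2) ^ i) \<le> (2::real)"
    unfolding sum_gp0 by simp
  have "(\<Sum>y\<in>P. w y * exp (- pi * (2 ^ j * dist x y)\<^sup>2)) \<le> (\<Sum>y\<in>P. w y * (K * (2 powr (s + 1) * (\<Sum>i\<le>I. a i * of_bool (2 ^ j * dist x y \<le> 2 ^ i)))))"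
  proof (intro sum_mono mult_left_mono)
    fix y assume y: "y \<in> P"
    have "exp (- pi * (2 ^ j * dist x y)\<^sup>2) \<le> K * (1 + 2 ^ j * dist x y) powr (- (s + 1))" by (intro K) simp
    also have "\<dots> \<le> K * (2 powr (s + 1) * (\<Sum>i\<le>I. a i * of_bool (2 ^ j * dist x y \<le> 2 ^ i)))"
      using K(1) I[OF y] by (intro mult_left_mono layer) auto
    finally show "exp (- pi * (2 ^ j * dist x y)\<^sup>2) \<le> K * (2 powr (s + 1) * (\<Sum>i\<le>I. a i * of_bool (2 ^ j * dist x y \<le> 2 ^ i)))" .
  qed (use w in auto)
  also have "\<dots> = K * 2 powr (s + 1) * (\<Sum>i\<le>I. a i * (\<Sum>y\<in>P. w y * of_bool (2 ^ j * dist x y \<le> 2 ^ i)))"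
    unfolding sum_distrib_left by (subst sum.swap) (intro sum.cong refl, simp only: mult_ac)
  also have "\<dots> \<le> K * 2 powr (s + 1) * (\<Sum>i\<le>I. a i * (M * 2 powr (s * i - s * j)))"
    using K(1) by (intro mult_left_mono sum_mono mass) (auto simp: a_def)
  also have "(\<Sum>i\<le>I. a i * (M * 2 powr (s * i - s * j))) = M * 2 powr (- s * j) * (\<Sum>i\<le>I. (1 / 2) ^ i)"
    unfolding sum_distrib_left
  proof (intro sum.cong refl)
    fix i
    have "a i * 2 powr (s * i - s * j) = 2 powr (- s * j) * (1 / 2) ^ i"
      by (simp add: a_def power_one_over powr_minus_divide powr_realpow[symmetric] powr_add[symmetric] powr_diff[symmetric] algebra_simps)
         (simp add: powr_minus_divide powr_diff powr_add field_simps)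
    then show "a i * (M * 2 powr (s * i - s * j)) = M * 2 powr (- s * j) * (1 / 2) ^ i" by (simp add: mult_ac)
  qed
  also have "K * 2 powr (s + 1) * (M * 2 powr (- s * j) * (\<Sum>i\<le>I. (1 / 2) ^ i)) \<le> K * 2 powr (s + 1) * (M * 2 powr (- s * j) * 2)"
    using K(1) M(1) geo by (intro mult_left_mono) auto
  also have "\<dots> = 2 powr (s + 2) * K * M * 2 powr (- s * j)"
    using powr_add[of 2 "s + 1" 1] by (simp add: add.assoc)
  finally show ?thesis .
qed

section \<open>Approximants of small energy\<close>

lemma gaussian_pair_sum:
  assumes "finite P" "\<And>p. p \<in> P \<Longrightarrow> gaussian_pair (f p) (\<phi> p)"
  shows "gaussian_pair (\<lambda>x. \<Sum>p\<in>P. f p x) (\<lambda>x. \<Sum>p\<in>P. \<phi> p x)"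
  using assms
proof (induction rule: finite_induct)
  case empty
  show ?case using gaussian_pair_cmult[OF gaussian_pair_gauss[of 1 0], of 0] by simp
next
  case (insert p P)
  then show ?case using gaussian_pair_add[of "f p" "\<phi> p"] by simp
qed

text \<open>A stand-in for a probability measure on \<open>E\<close>: a density of mass 1 with mass
  at most \<open>1 / Suc n\<close> at distance at least \<open>1 / Suc n\<close> from
  \<open>E\<close>. The equation \<open>f x = of_real (cmod (f x))\<close> says that
  \<open>f\<close> is real and nonnegative.\<close>

definition approximant :: "'a::euclidean_space set \<Rightarrow> nat \<Rightarrow> ('a \<Rightarrow> complex) \<Rightarrow> ('a \<Rightarrow> complex) \<Rightarrow> bool" where
  "approximant E n f \<phi> \<longleftrightarrow> gaussian_pair f \<phi> \<and> (\<forall>x. f x = of_real (cmod (f x))) \<and>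
     (LINT x|lborel. cmod (f x)) = 1 \<and>
     (LINT x|lborel. cmod (f x) * indicator {x. 1 / Suc n \<le> infdist x E} x) \<le> 1 / Suc n"

text \<open>With \<open>y = pi * (norm (x - p))\<^sup>2 / (2 * e\<^sup>2)\<close> the exponential is
  \<open>exp (- y) * exp (- y)\<close>. One factor is at most \<open>1 / y\<close>, which is small
  away from \<open>p\<close>; the other belongs to a Gaussian of width \<open>sqrt 2 * e\<close>,
  whose integral is again 1.\<close>

lemma gauss_tail:
  fixes p :: "'a::euclidean_space"
  assumes e: "e > 0" and \<eta>: "\<eta> > 0"
  shows "(LINT x|lborel. cmod (gauss p e x) * indicator {x. \<eta> \<le> dist x p} x) \<le> sqrt 2 ^ DIM('a) * (2 * e\<^sup>2 / (pi * \<eta>\<^sup>2))"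
proof -
  let ?B = "sqrt 2 ^ DIM('a) * (2 * e\<^sup>2 / (pi * \<eta>\<^sup>2))"
  have e2: "sqrt 2 * e > 0" using e by simp
  have bound: "cmod (gauss p e x) * indicator {x. \<eta> \<le> dist x p} x \<le> ?B * cmod (gauss p (sqrt 2 * e) x)" for x
  proof (cases "\<eta> \<le> dist x p")
    case True
    define y where "y = pi * (norm (x - p))\<^sup>2 / (2 * e\<^sup>2)"
    have ny: "pi * \<eta>\<^sup>2 / (2 * e\<^sup>2) \<le> y" unfolding y_def using True \<eta> e
      by (intro divide_right_mono mult_left_mono power_mono) (auto simp: dist_norm)
    have y0: "pi * \<eta>\<^sup>2 / (2 * e\<^sup>2) > 0" using \<eta> e by simp
    have "y \<le> exp y" using exp_ge_add_one_self[of y] by linarith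
    then have "y * exp (- y) \<le> 1" by (simp add: exp_minus divide_simps)
    then have "exp (- y) \<le> 1 / y" using ny y0 by (simp add: field_simps)
    also have "\<dots> \<le> 1 / (pi * \<eta>\<^sup>2 / (2 * e\<^sup>2))" using ny y0 by (intro divide_left_mono mult_pos_pos) linarith+
    finally have ey: "exp (- y) \<le> 2 * e\<^sup>2 / (pi * \<eta>\<^sup>2)" by simp
    have "- pi * (norm (x - p))\<^sup>2 / e\<^sup>2 = - y + - y" using e by (simp add: y_def field_simps)
    moreover have "- pi * (norm (x - p))\<^sup>2 / (sqrt 2 * e)\<^sup>2 = - y" by (simp add: y_def power_mult_distrib)
    ultimately have "cmod (gauss p e x) = (1 / e) ^ DIM('a) * (exp (- y) * exp (- y))"
      and g2: "cmod (gauss p (sqrt 2 * e) x) = (1 / (sqrt 2 * e)) ^ DIM('a) * exp (- y)"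
      using e unfolding gauss_def by (simp_all add: norm_mult norm_power norm_divide flip: exp_add)
    then have "cmod (gauss p e x) = exp (- y) * (sqrt 2 ^ DIM('a) * cmod (gauss p (sqrt 2 * e) x))"
      using e by (simp add: power_mult_distrib power_divide)
    also have "\<dots> \<le> (2 * e\<^sup>2 / (pi * \<eta>\<^sup>2)) * (sqrt 2 ^ DIM('a) * cmod (gauss p (sqrt 2 * e) x))"
      by (intro mult_right_mono ey) simp
    finally show ?thesis using True by (simp add: mult_ac)
  qed simp
  have "(LINT x|lborel. cmod (gauss p e x) * indicator {x. \<eta> \<le> dist x p} x) \<le> (LINT x|lborel. ?B * cmod (gauss p (sqrt 2 * e) x))"
    by (rule integral_mono'[OF integrable_mult_right[OF integrable_norm_gauss[OF e2]] bound]) simp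
  also have "\<dots> = ?B" by (rule integral_mult_norm_gauss[OF e2])
  finally show ?thesis .
qed

lemma approximant_mixture:
  fixes E :: "'a::euclidean_space set"
  assumes P: "finite P" "P \<subseteq> E" and w: "\<And>p. p \<in> P \<Longrightarrow> w p \<ge> 0" "sum w P = 1" and e: "e > 0"
    and tail: "sqrt 2 ^ DIM('a) * (2 * e\<^sup>2 / (pi * (1 / Suc n)\<^sup>2)) \<le> 1 / Suc n"
  shows "approximant E n (\<lambda>x. \<Sum>p\<in>P. of_real (w p) * gauss p e x) (\<lambda>x. \<Sum>p\<in>P. of_real (w p) * gauss_hat p e x)"
proof -
  let ?f = "\<lambda>x. \<Sum>p\<in>P. of_real (w p) * gauss p e x"
  have f: "?f x = of_real (\<Sum>p\<in>P. w p * cmod (gauss p e x))" for x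
    by (simp add: norm_gauss[OF e])
  have nf: "cmod (?f x) = (\<Sum>p\<in>P. w p * cmod (gauss p e x))" for x
    unfolding f norm_of_real using w(1) by (intro abs_of_nonneg sum_nonneg) simp
  have "gaussian_pair ?f (\<lambda>x. \<Sum>p\<in>P. of_real (w p) * gauss_hat p e x)"
    by (intro gaussian_pair_sum P(1) gaussian_pair_cmult gaussian_pair_gauss e)
  moreover have "?f x = of_real (cmod (?f x))" for x unfolding nf by (rule f)
  moreover have "(LINT x|lborel. cmod (?f x)) = 1"
    unfolding nf using w(2)
    by (subst Bochner_Integration.integral_sum) (simp_all add: integral_norm_gauss[OF e] integrable_norm_gauss[OF e])
  moreover have "(LINT x|lborel. cmod (?f x) * indicator {x. 1 / Suc n \<le> infdist x E} x) \<le> 1 / Suc n"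
  proof -
    have mE: "{x. 1 / Suc n \<le> infdist x E} \<in> sets lborel"
      unfolding sets_lborel by (intro borel_closed closed_Collect_le continuous_intros)
    have i: "integrable lborel (\<lambda>x. w p * (cmod (gauss p e x) * indicator {x. 1 / Suc n \<le> infdist x E} x))" for p
      by (intro integrable_mult_right integrable_real_mult_indicator[OF mE] integrable_norm_gauss e)
    have "(LINT x|lborel. cmod (?f x) * indicator {x. 1 / Suc n \<le> infdist x E} x)
      = (\<Sum>p\<in>P. LINT x|lborel. w p * (cmod (gauss p e x) * indicator {x. 1 / Suc n \<le> infdist x E} x))"
      unfolding nf sum_distrib_right mult.assoc by (rule Bochner_Integration.integral_sum) (rule i)
    also have "\<dots> \<le> (\<Sum>p\<in>P. w p * (1 / Suc n))"
    proof (rule sum_mono)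
      fix p assume p: "p \<in> P"
      have "(LINT x|lborel. cmod (gauss p e x) * indicator {x. 1 / Suc n \<le> infdist x E} x)
         \<le> (LINT x|lborel. cmod (gauss p e x) * indicator {x. 1 / Suc n \<le> dist x p} x)"
      proof (rule integral_mono)
        show "integrable lborel (\<lambda>x. cmod (gauss p e x) * indicator {x. 1 / Suc n \<le> infdist x E} x)"
          by (intro integrable_real_mult_indicator[OF mE] integrable_norm_gauss e)
        have "{x. 1 / Suc n \<le> dist x p} \<in> sets lborel"
          unfolding sets_lborel by (intro borel_closed closed_Collect_le continuous_intros)
        then show "integrable lborel (\<lambda>x. cmod (gauss p e x) * indicator {x. 1 / Suc n \<le> dist x p} x)"
          by (intro integrable_real_mult_indicator integrable_norm_gauss e)
        show "cmod (gauss p e x) * indicator {x. 1 / Suc n \<le> infdist x E} x \<le> cmod (gauss p e x) * indicator {x. 1 / Suc n \<le> dist x p} x" for x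
          using infdist_le[of p E x] p P(2) by (intro mult_left_mono) (auto simp: indicator_def)
      qed
      also have "\<dots> \<le> 1 / Suc n" using order_trans[OF gauss_tail[OF e] tail] by simp
      finally show "(LINT x|lborel. w p * (cmod (gauss p e x) * indicator {x. 1 / Suc n \<le> infdist x E} x)) \<le> w p * (1 / Suc n)"
        using w(1)[OF p] by (simp only: integral_mult_right_zero mult_left_mono)
    qed
    also have "\<dots> = 1 / Suc n" using w(2) by (simp flip: sum_divide_distrib)
    finally show ?thesis .
  qed
  ultimately show ?thesis unfolding approximant_def by blast
qed

text \<open>Replaces the Sobolev weight, cut off at frequency \<open>2 ^ n\<close> by the squared
  transform of the smoothing Gaussian, by a sum of Gaussians over dyadic frequencies, against which
  trigonometric sums integrate explicitly. The factor \<open>exp pi\<close> comes from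
  \<open>x \<le> 2 ^ j\<close>, the factor \<open>4 powr a\<close> from
  \<open>x > 2 ^ (j - 1)\<close>.\<close>

lemma sobolev_weight_le:
  fixes x a :: real
  assumes "x \<ge> 0" "a \<ge> 0"
  shows "(1 + x\<^sup>2) powr (- a) * exp (- 2 * pi * (x / 2 ^ n)\<^sup>2) \<le> 
     4 powr a * exp pi * (\<Sum>j\<le>n. 4 powr (- a * j) * exp (- pi * (x / 2 ^ j)\<^sup>2))"
proof -
  have member: "4 powr (- a * j) * exp (- pi * (x / 2 ^ j)\<^sup>2) \<le> (\<Sum>j\<le>n. 4 powr (- a * j) * exp (- pi * (x / 2 ^ j)\<^sup>2))" if "j \<le> n" for j
    using that by (intro member_le_sum) auto
  have *: "(1 + x\<^sup>2) powr (- a) * exp (- 2 * pi * (x / 2 ^ n)\<^sup>2) \<le> 4 powr a * exp pi * (4 powr (- a * j) * exp (- pi * (x / 2 ^ j)\<^sup>2))"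
    if "(1 + x\<^sup>2) powr (- a) \<le> 4 powr a * 4 powr (- a * j)" "x \<le> 2 ^ j \<or> j = n" for j
  proof -
    have "exp (- 2 * pi * (x / 2 ^ n)\<^sup>2) \<le> exp pi * exp (- pi * (x / 2 ^ j)\<^sup>2)"
    proof (cases "x \<le> 2 ^ j")
      case True
      then have "(x / 2 ^ j)\<^sup>2 \<le> 1\<^sup>2" using assms(1) by (intro power_mono) (auto simp: divide_le_eq)
      then have "0 \<le> pi + - pi * (x / 2 ^ j)\<^sup>2" by (simp add: mult_left_le)
      then have "1 \<le> exp pi * exp (- pi * (x / 2 ^ j)\<^sup>2)" unfolding exp_add[symmetric] by simp
      moreover have "exp (- 2 * pi * (x / 2 ^ n)\<^sup>2) \<le> 1" by simp
      ultimately show ?thesis by linarith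
    next
      case False
      then have "j = n" using that(2) by simp
      have "exp (- 2 * pi * (x / 2 ^ n)\<^sup>2) \<le> 1 * exp (- pi * (x / 2 ^ n)\<^sup>2)" by simp
      also have "\<dots> \<le> exp pi * exp (- pi * (x / 2 ^ n)\<^sup>2)" by (intro mult_right_mono) auto
      finally show ?thesis by (simp add: \<open>j = n\<close>)
    qed
    then have "(1 + x\<^sup>2) powr (- a) * exp (- 2 * pi * (x / 2 ^ n)\<^sup>2) \<le> (4 powr a * 4 powr (- a * j)) * (exp pi * exp (- pi * (x / 2 ^ j)\<^sup>2))"
      using that(1) by (intro mult_mono) auto
    then show ?thesis by (simp only: mult_ac)
  qed
  have "\<exists>j\<le>n. (1 + x\<^sup>2) powr (- a) \<le> 4 powr a * 4 powr (- a * j) \<and> (x \<le> 2 ^ j \<or> j = n)"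
  proof -
    \<comment> \<open>The dyadic scale of \<open>x\<close>, capped at \<open>n\<close>; beyond the
      cap the Gaussian cutoff itself provides the decay.\<close>
    define j where "j = (if \<exists>i\<le>n. x \<le> 2 ^ i then LEAST i. x \<le> 2 ^ i else n)"
    have jn: "j \<le> n"
    proof (cases "\<exists>i\<le>n. x \<le> 2 ^ i")
      case True
      then obtain i where "i \<le> n" "x \<le> 2 ^ i" by blast
      then show ?thesis using Least_le[of "\<lambda>i. x \<le> 2 ^ i" i] True by (simp add: j_def)
    next
      case False
      then show ?thesis unfolding j_def by (simp only: if_False)
    qed
    have j1: "x \<le> 2 ^ j \<or> j = n"
    proof (cases "\<exists>i\<le>n. x \<le> 2 ^ i")
      case True
      then have "x \<le> 2 ^ (LEAST i. x \<le> 2 ^ i)" by (metis LeastI)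
      then show ?thesis using True by (simp add: j_def)
    next
      case False
      then show ?thesis unfolding j_def by (simp only: if_False simp_thms)
    qed
    have "(1 + x\<^sup>2) powr (- a) \<le> 4 powr a * 4 powr (- a * j)"
    proof (cases j)
      case 0
      have "(1 + x\<^sup>2) powr (- a) \<le> 1 powr (- a)" using assms by (intro powr_mono2') auto
      also have "\<dots> \<le> 4 powr a" using assms by (simp add: ge_one_powr_ge_zero)
      finally show ?thesis by (simp add: 0)
    next
      case (Suc i)
      have "\<not> x \<le> 2 ^ i"
      proof (cases "\<exists>i\<le>n. x \<le> 2 ^ i")
        case True
        then show ?thesis using not_less_Least[of i "\<lambda>i. x \<le> 2 ^ i"] Suc by (simp add: j_def)
      next
        case False
        then show ?thesis using Suc jn by auto
      qed
      then have "(2 ^ i)\<^sup>2 \<le> x\<^sup>2" by (intro power_mono) auto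
      then have "4 ^ i \<le> 1 + x\<^sup>2" by (simp add: power2_eq_square flip: power_mult_distrib)
      then have "(1 + x\<^sup>2) powr (- a) \<le> (4 ^ i) powr (- a)" using assms by (intro powr_mono2') auto
      also have "\<dots> = 4 powr a * 4 powr (- a * j)"
        by (simp add: Suc powr_powr powr_add[symmetric] algebra_simps flip: powr_realpow)
      finally show ?thesis .
    qed
    then show ?thesis using jn j1 by blast
  qed
  then obtain j where j: "j \<le> n" "(1 + x\<^sup>2) powr (- a) \<le> 4 powr a * 4 powr (- a * j)" "x \<le> 2 ^ j \<or> j = n" by blast
  have "(1 + x\<^sup>2) powr (- a) * exp (- 2 * pi * (x / 2 ^ n)\<^sup>2) \<le> 4 powr a * exp pi * (4 powr (- a * j) * exp (- pi * (x / 2 ^ j)\<^sup>2))"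
    by (rule *[OF j(2,3)])
  also have "\<dots> \<le> 4 powr a * exp pi * (\<Sum>j\<le>n. 4 powr (- a * j) * exp (- pi * (x / 2 ^ j)\<^sup>2))"
    by (intro mult_left_mono member j) simp
  finally show ?thesis .
qed

text \<open>The squared modulus is a double sum of characters of frequencies \<open>p - p'\<close>.
  A Gaussian window of width \<open>2 ^ j\<close> in frequency turns each of them into an
  interaction of range \<open>1 / 2 ^ j\<close> between the points.\<close>

lemma trigonometric_sum_gaussian:
  fixes P :: "'a::euclidean_space set"
  assumes P: "finite P"
  shows "has_bochner_integral lborel
     (\<lambda>\<xi>. (cmod (\<Sum>p\<in>P. of_real (w p) * cis (2 * pi * (p \<bullet> \<xi>))))\<^sup>2 * exp (- pi * (norm \<xi> / 2 ^ j)\<^sup>2))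
     (2 ^ (j * DIM('a)) * (\<Sum>p\<in>P. \<Sum>p'\<in>P. w p * w p' * exp (- pi * (2 ^ j * dist p p')\<^sup>2)))"
proof -
  define c :: real where "c = 1 / 4 ^ j"
  have c: "c > 0" "sqrt c = 1 / 2 ^ j"
    by (simp_all add: c_def real_sqrt_divide real_sqrt_power)
  let ?z = "\<lambda>\<xi>. \<Sum>p\<in>P. of_real (w p) * cis (2 * pi * (p \<bullet> \<xi>))"
  have i: "has_bochner_integral lborel
     (\<lambda>\<xi>. \<Sum>p\<in>P. \<Sum>p'\<in>P. of_real (w p * w p') * (cis (2 * pi * ((p - p') \<bullet> \<xi>)) * of_real (exp (- pi * c * (norm \<xi>)\<^sup>2))))
     (\<Sum>p\<in>P. \<Sum>p'\<in>P. of_real (w p * w p') * of_real ((1 / sqrt c) ^ DIM('a) * exp (- pi * (norm (p - p'))\<^sup>2 / c)))"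
    by (intro has_bochner_integral_sum has_bochner_integral_mult_right has_bochner_integral_gaussian c)
  have e1: "(\<Sum>p\<in>P. \<Sum>p'\<in>P. of_real (w p * w p') * (cis (2 * pi * ((p - p') \<bullet> \<xi>)) * of_real (exp (- pi * c * (norm \<xi>)\<^sup>2))))
     = complex_of_real ((cmod (?z \<xi>))\<^sup>2 * exp (- pi * (norm \<xi> / 2 ^ j)\<^sup>2))" for \<xi>
  proof -
    have "complex_of_real ((cmod (?z \<xi>))\<^sup>2) = ?z \<xi> * cnj (?z \<xi>)" by (rule complex_norm_square)
    also have "\<dots> = (\<Sum>p\<in>P. \<Sum>p'\<in>P. of_real (w p * w p') * cis (2 * pi * ((p - p') \<bullet> \<xi>)))"
      unfolding cnj_sum sum_product
      by (intro sum.cong refl) (simp add: cis_cnj cis_mult inner_diff_left right_diff_distrib mult_ac)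
    finally have "complex_of_real ((cmod (?z \<xi>))\<^sup>2) = (\<Sum>p\<in>P. \<Sum>p'\<in>P. of_real (w p * w p') * cis (2 * pi * ((p - p') \<bullet> \<xi>)))" .
    moreover have "- pi * (norm \<xi> / 2 ^ j)\<^sup>2 = - pi * c * (norm \<xi>)\<^sup>2"
      by (simp add: c_def power_divide power2_eq_square flip: power_mult_distrib)
    ultimately show ?thesis
      unfolding of_real_mult by (simp only: sum_distrib_right mult.assoc)
  qed
  have e2: "(\<Sum>p\<in>P. \<Sum>p'\<in>P. of_real (w p * w p') * complex_of_real ((1 / sqrt c) ^ DIM('a) * exp (- pi * (norm (p - p'))\<^sup>2 / c)))
     = complex_of_real (2 ^ (j * DIM('a)) * (\<Sum>p\<in>P. \<Sum>p'\<in>P. w p * w p' * exp (- pi * (2 ^ j * dist p p')\<^sup>2)))"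
  proof -
    have "(1 / sqrt c) ^ DIM('a) = 2 ^ (j * DIM('a))" by (simp add: c power_mult)
    moreover have "- pi * (norm (p - p'))\<^sup>2 / c = - pi * (2 ^ j * dist p p')\<^sup>2" for p p' :: 'a
    proof -
      have "((2::real) ^ j)\<^sup>2 = 4 ^ j" by (simp add: power2_eq_square flip: power_mult_distrib)
      then show ?thesis unfolding c_def dist_norm power_mult_distrib by simp
    qed
    ultimately show ?thesis
      unfolding of_real_mult[symmetric] of_real_sum[symmetric] sum_distrib_left by (simp only: mult_ac)
  qed
  have h: "has_bochner_integral lborel (\<lambda>\<xi>. complex_of_real ((cmod (?z \<xi>))\<^sup>2 * exp (- pi * (norm \<xi> / 2 ^ j)\<^sup>2)))
    (complex_of_real (2 ^ (j * DIM('a)) * (\<Sum>p\<in>P. \<Sum>p'\<in>P. w p * w p' * exp (- pi * (2 ^ j * dist p p')\<^sup>2))))"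
    using i unfolding e1 e2 .
  show ?thesis
    using h unfolding has_bochner_integral_iff complex_of_real_integrable_eq integral_complex_of_real of_real_eq_iff .
qed

text \<open>Scale \<open>j\<close> contributes \<open>4 powr (- a * j)\<close> from the weight,
  \<open>2 ^ (j * DIM('a))\<close> from the window and \<open>2 powr (- s * j)\<close> from Frostman
  growth. The product is \<rho> to the power \<open>j\<close>, with \<rho> below 1 by the condition
  on \<open>a\<close>; hence the bound does not depend on \<open>n\<close>.\<close>

lemma sobolev_energy_mixture_le:
  fixes P :: "'a::euclidean_space set" and s a :: real
  assumes P: "finite P" and w: "\<And>x. x \<in> P \<Longrightarrow> w x \<ge> 0" "sum w P = 1" and s: "s \<ge> 0" and a: "a \<ge> 0" "real DIM('a) - s < 2 * a"
    and M: "1 \<le> M" "\<And>m x. m \<le> n \<Longrightarrow> (\<Sum>y | y \<in> P \<and> dist x y \<le> 1 / 2 ^ m. w y) \<le> M * 2 powr (- s * m)"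
    and K: "K > 0" "\<And>u. u \<ge> 0 \<Longrightarrow> exp (- pi * u\<^sup>2) \<le> K * (1 + u) powr (- (s + 1))"
  shows "sobolev_energy a (\<lambda>\<xi>. \<Sum>p\<in>P. of_real (w p) * gauss_hat p (1 / 2 ^ n) \<xi>)
    \<le> 4 powr a * exp pi * (2 powr (s + 2) * K * M / (1 - 2 powr (real DIM('a) - s - 2 * a)))"
proof -
  let ?\<phi> = "\<lambda>\<xi>. \<Sum>p\<in>P. of_real (w p) * gauss_hat p (1 / 2 ^ n) \<xi>"
  let ?z = "\<lambda>\<xi>. \<Sum>p\<in>P. of_real (w p) * cis (2 * pi * (p \<bullet> \<xi>))"
  define G where "G j \<xi> = (cmod (?z \<xi>))\<^sup>2 * exp (- pi * (norm \<xi> / 2 ^ j)\<^sup>2)" for j \<xi>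
  note GI = trigonometric_sum_gaussian[OF P, of w, folded G_def]
  define B where "B = 2 powr (s + 2) * K * M"
  define \<rho> where "\<rho> = 2 powr (real DIM('a) - s - 2 * a)"
  have \<rho>: "0 < \<rho>" "\<rho> < 1" using a(2) by (auto simp: \<rho>_def powr_less_one)
  have B0: "B > 0" unfolding B_def using K(1) M(1) by simp
  have GB: "(LINT \<xi>|lborel. G j \<xi>) \<le> 2 ^ (j * DIM('a)) * (B * 2 powr (- s * j))" if "j \<le> n" for j
  proof -
    have "(\<Sum>p'\<in>P. w p * w p' * exp (- pi * (2 ^ j * dist p p')\<^sup>2)) \<le> w p * (B * 2 powr (- s * j))" if p: "p \<in> P" for p
    proof -
      have "(\<Sum>p'\<in>P. w p' * exp (- pi * (2 ^ j * dist p p')\<^sup>2)) \<le> B * 2 powr (- s * j)"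
        unfolding B_def using w M \<open>j \<le> n\<close> s by (intro gaussian_sum_bound[OF P _ _ _ _ _ K]) auto
      then show ?thesis using w(1)[OF p] by (simp add: mult.assoc mult_left_mono flip: sum_distrib_left)
    qed
    then have "(\<Sum>p\<in>P. \<Sum>p'\<in>P. w p * w p' * exp (- pi * (2 ^ j * dist p p')\<^sup>2)) \<le> (\<Sum>p\<in>P. w p * (B * 2 powr (- s * j)))"
      by (rule sum_mono)
    also have "\<dots> = B * 2 powr (- s * j)" using w(2) by (simp flip: sum_distrib_right)
    finally show ?thesis using GI[of j] by (simp add: has_bochner_integral_iff)
  qed
  have pw: "sobolev_density (- a) ?\<phi> \<xi> \<le> (\<Sum>j\<le>n. 4 powr a * exp pi * (4 powr (- a * j) * G j \<xi>))" for \<xi>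
  proof -
    have "?\<phi> \<xi> = ?z \<xi> * of_real (exp (- pi * (norm \<xi> / 2 ^ n)\<^sup>2))"
      unfolding sum_distrib_right by (intro sum.cong refl) (simp add: gauss_hat_def power_divide power_one_over)
    then have "(cmod (?\<phi> \<xi>))\<^sup>2 = (cmod (?z \<xi>))\<^sup>2 * exp (- 2 * pi * (norm \<xi> / 2 ^ n)\<^sup>2)"
      by (simp add: norm_mult power_mult_distrib flip: exp_double)
    then have "sobolev_density (- a) ?\<phi> \<xi> = ((1 + (norm \<xi>)\<^sup>2) powr (- a) * exp (- 2 * pi * (norm \<xi> / 2 ^ n)\<^sup>2)) * (cmod (?z \<xi>))\<^sup>2"
      by (simp add: sobolev_density_def)
    also have "\<dots> \<le> (4 powr a * exp pi * (\<Sum>j\<le>n. 4 powr (- a * j) * exp (- pi * (norm \<xi> / 2 ^ j)\<^sup>2))) * (cmod (?z \<xi>))\<^sup>2"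
      by (intro mult_right_mono sobolev_weight_le a) auto
    also have "\<dots> = (\<Sum>j\<le>n. 4 powr a * exp pi * (4 powr (- a * j) * G j \<xi>))"
      unfolding G_def sum_distrib_left sum_distrib_right by (simp only: mult_ac)
    finally show ?thesis .
  qed
  have int: "integrable lborel (\<lambda>\<xi>. 4 powr a * exp pi * (4 powr (- a * j) * G j \<xi>))" for j
    using GI[of j] by (intro integrable_mult_right) (simp add: has_bochner_integral_iff)
  have "sobolev_energy a ?\<phi> \<le> (LINT \<xi>|lborel. (\<Sum>j\<le>n. 4 powr a * exp pi * (4 powr (- a * j) * G j \<xi>)))"
    unfolding sobolev_energy_def
    by (rule integral_mono'[OF Bochner_Integration.integrable_sum[OF int] pw]) (simp add: G_def sum_nonneg)
  also have "\<dots> = (\<Sum>j\<le>n. 4 powr a * exp pi * (4 powr (- a * j) * (LINT \<xi>|lborel. G j \<xi>)))"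
    using int by (subst Bochner_Integration.integral_sum) (simp_all only: integral_mult_right_zero)
  also have "\<dots> \<le> (\<Sum>j\<le>n. 4 powr a * exp pi * (B * \<rho> ^ j))"
  proof (intro sum_mono mult_left_mono)
    fix j assume "j \<in> {..n}"
    then have "4 powr (- a * j) * (LINT \<xi>|lborel. G j \<xi>) \<le> 4 powr (- a * j) * (2 ^ (j * DIM('a)) * (B * 2 powr (- s * j)))"
      by (intro mult_left_mono GB) auto
    also have "\<dots> = B * \<rho> ^ j"
    proof -
      have "(4::real) powr (- a * j) = 2 powr (2 * (- a * j))" using powr_powr[of 2 2 "- a * j"] by simp
      moreover have "(2::real) ^ (j * DIM('a)) = 2 powr (j * DIM('a))" by (simp add: powr_realpow flip: of_nat_mult)
      moreover have "\<rho> ^ j = 2 powr ((real DIM('a) - s - 2 * a) * j)" by (simp add: \<rho>_def powr_power mult.commute)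
      ultimately have "4 powr (- a * j) * (2 ^ (j * DIM('a)) * 2 powr (- s * j)) = \<rho> ^ j"
        by (simp add: powr_add[symmetric] algebra_simps)
      then show ?thesis by (simp add: mult_ac)
    qed
    finally show "4 powr (- a * j) * (LINT \<xi>|lborel. G j \<xi>) \<le> B * \<rho> ^ j" .
  qed simp
  also have "\<dots> = 4 powr a * exp pi * (B * (\<Sum>j\<le>n. \<rho> ^ j))" by (simp add: sum_distrib_left)
  also have "\<dots> \<le> 4 powr a * exp pi * (B * (1 / (1 - \<rho>)))"
  proof (intro mult_left_mono)
    have "(\<Sum>j\<le>n. \<rho> ^ j) = (1 - \<rho> ^ Suc n) / (1 - \<rho>)" using \<rho> by (simp add: sum_gp0)
    also have "\<dots> \<le> 1 / (1 - \<rho>)" using \<rho> by (intro divide_right_mono) auto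
    finally show "(\<Sum>j\<le>n. \<rho> ^ j) \<le> 1 / (1 - \<rho>)" .
  qed (use B0 in auto)
  finally show ?thesis by (simp add: B_def \<rho>_def)
qed

lemma approximants_energy_bounded:
  fixes E :: "'a::euclidean_space set" and s a c :: real
  assumes E: "bounded E" "finite_content_ge s c E" and c: "c > 0" and s: "s > 0" and a: "a \<ge> 0" "real DIM('a) - s < 2 * a"
  obtains M where "\<And>n. \<exists>f \<phi>. approximant E n f \<phi> \<and> sobolev_energy a \<phi> \<le> M"
proof -
  obtain K where K: "K > 0" "\<And>u. u \<ge> 0 \<Longrightarrow> exp (- pi * u\<^sup>2) \<le> K * (1 + u) powr (- (s + 1))"
    using gaussian_decay[of "s + 1"] s by auto
  define D where "D = real DIM('a) powr s"
  have D: "D > 0" by (simp add: D_def)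
  \<comment> \<open>\<open>D / c\<close> bounds the reciprocal of the total mass by which the
    weights are normalized; the 1 ensures \<open>1 \<le> M\<close>, so that \<open>M\<close> also
    dominates the normalized total mass.\<close>
  define M where "M = 3 ^ DIM('a) * D / c + 1"
  define M' where "M' = 4 powr a * exp pi * (2 powr (s + 2) * K * M / (1 - 2 powr (real DIM('a) - s - 2 * a)))"
  have "\<exists>f \<phi>. approximant E N f \<phi> \<and> sobolev_energy a \<phi> \<le> M'" for N
  proof -
    \<comment> \<open>The width \<open>1 / 2 ^ n\<close> is taken small enough for the Gaussian
      tails to meet the tolerance \<open>1 / Suc N\<close>. This uses that the energy bound is
      uniform in \<open>n\<close>.\<close>
    have lim: "(\<lambda>n. sqrt 2 ^ DIM('a) * (2 * (1 / 2 ^ n)\<^sup>2 / (pi * (1 / Suc N)\<^sup>2))) \<longlonglongrightarrow> sqrt 2 ^ DIM('a) * (2 * 0\<^sup>2 / (pi * (1 / Suc N)\<^sup>2))"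
    proof (intro tendsto_intros)
      show "(\<lambda>n. 1 / 2 ^ n) \<longlonglongrightarrow> (0::real)" using LIMSEQ_realpow_zero[of "1 / 2::real"] by (simp add: power_one_over)
    qed auto
    then have "\<forall>\<^sub>F n in sequentially. sqrt 2 ^ DIM('a) * (2 * (1 / 2 ^ n)\<^sup>2 / (pi * (1 / Suc N)\<^sup>2)) < 1 / Suc N"
      by (rule order_tendstoD) simp
    then obtain n where n: "sqrt 2 ^ DIM('a) * (2 * (1 / 2 ^ n)\<^sup>2 / (pi * (1 / Suc N)\<^sup>2)) \<le> 1 / Suc N"
      by (auto simp: eventually_sequentially intro: less_imp_le)
    obtain P w where P: "finite P" "P \<subseteq> E" "\<And>x. x \<in> P \<Longrightarrow> w x \<ge> 0" "c \<le> D * sum w P"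
      "\<And>m x. m \<le> n \<Longrightarrow> (\<Sum>y | y \<in> P \<and> dist x y \<le> 1 / 2 ^ m. w y) \<le> 3 ^ DIM('a) * 2 powr (- s * m)"
      using ex_frostman_weights[OF E s, of n] unfolding D_def by blast
    define T where "T = sum w P"
    have "0 < D * T" using P(4) c by (simp add: T_def)
    then have T0: "T > 0" using D by (simp add: zero_less_mult_iff)
    then have T: "T > 0" "1 / T \<le> D / c" using P(4) c by (simp_all add: T_def field_simps)
    define w' where "w' x = w x / T" for x
    have w': "\<And>x. x \<in> P \<Longrightarrow> w' x \<ge> 0" "sum w' P = 1"
      using P(3) T(1) by (auto simp: w'_def sum_divide_distrib[symmetric] T_def[symmetric])
    have ball: "(\<Sum>y | y \<in> P \<and> dist x y \<le> 1 / 2 ^ m. w' y) \<le> M * 2 powr (- s * m)" if "m \<le> n" for m x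
    proof -
      have "(\<Sum>y | y \<in> P \<and> dist x y \<le> 1 / 2 ^ m. w' y) = (\<Sum>y | y \<in> P \<and> dist x y \<le> 1 / 2 ^ m. w y) * (1 / T)"
        by (simp add: w'_def sum_divide_distrib)
      also have "\<dots> \<le> (3 ^ DIM('a) * 2 powr (- s * m)) * (D / c)"
        using P(3,5) T that by (intro mult_mono sum_nonneg) auto
      also have "\<dots> = (3 ^ DIM('a) * D / c) * 2 powr (- s * m)" by simp
      also have "\<dots> \<le> M * 2 powr (- s * m)" by (intro mult_right_mono) (auto simp: M_def)
      finally show ?thesis .
    qed
    have epos: "0 < 1 / (2::real) ^ n" by (intro divide_pos_pos zero_less_power) simp_all
    have "approximant E N (\<lambda>x. \<Sum>p\<in>P. of_real (w' p) * gauss p (1 / 2 ^ n) x) (\<lambda>x. \<Sum>p\<in>P. of_real (w' p) * gauss_hat p (1 / 2 ^ n) x)"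
      by (rule approximant_mixture[OF P(1,2) w' epos n])
    moreover have "sobolev_energy a (\<lambda>x. \<Sum>p\<in>P. of_real (w' p) * gauss_hat p (1 / 2 ^ n) x) \<le> M'"
      unfolding M'_def using s c D by (intro sobolev_energy_mixture_le P(1) w' a ball K) (auto simp: M_def)
    ultimately show ?thesis by blast
  qed
  then show ?thesis by (rule that)
qed

section \<open>Monotonicity and convexity of approximants, and the minimizing sequence\<close>

lemma approximant_gaussian_pair: "approximant E n f \<phi> \<Longrightarrow> gaussian_pair f \<phi>"
  by (simp add: approximant_def)

lemma approximant_integrable:
  assumes "approximant E n f \<phi>" shows "integrable lborel (\<lambda>x. cmod (f x))"
  using assms gaussian_class_integrable by (intro integrable_norm) (auto simp: approximant_def gaussian_pair_def)

lemma infdist_ge_sets: "{x. r \<le> infdist x E} \<in> sets lborel"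
  unfolding sets_lborel by (intro borel_closed closed_Collect_le continuous_intros)

lemma approximant_antimono:
  assumes f: "approximant E m f \<phi>" and nm: "n \<le> m"
  shows "approximant E n f \<phi>"
proof -
  have inv: "1 / real (Suc m) \<le> 1 / real (Suc n)" using nm by (simp add: frac_le)
  have "(LINT x|lborel. cmod (f x) * indicator {x. 1 / Suc n \<le> infdist x E} x)
      \<le> (LINT x|lborel. cmod (f x) * indicator {x. 1 / Suc m \<le> infdist x E} x)"
  proof (rule integral_mono)
    show "cmod (f x) * indicator {x. 1 / Suc n \<le> infdist x E} x \<le> cmod (f x) * indicator {x. 1 / Suc m \<le> infdist x E} x" for x
      using inv by (intro mult_left_mono) (auto simp: indicator_def)
  qed (intro integrable_real_mult_indicator[OF infdist_ge_sets] approximant_integrable[OF f])+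
  also have "\<dots> \<le> 1 / Suc m" using f by (simp add: approximant_def)
  also note inv
  finally show ?thesis using f unfolding approximant_def by blast
qed

lemma approximant_midpoint:
  assumes f: "approximant E n f \<phi>" and g: "approximant E n g \<psi>"
  shows "approximant E n (\<lambda>x. 1 / 2 * f x + 1 / 2 * g x) (\<lambda>x. 1 / 2 * \<phi> x + 1 / 2 * \<psi> x)"
proof -
  have fr: "f x = of_real (cmod (f x))" "g x = of_real (cmod (g x))" for x
    using f g unfolding approximant_def by blast+
  have nf: "cmod (1 / 2 * f x + 1 / 2 * g x) = 1 / 2 * cmod (f x) + 1 / 2 * cmod (g x)" for x
  proof -
    have "1 / 2 * f x + 1 / 2 * g x = of_real (1 / 2 * cmod (f x) + 1 / 2 * cmod (g x))"
      unfolding of_real_add of_real_mult fr[symmetric] by simp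
    then show ?thesis by (simp only: norm_of_real) simp
  qed
  note i = approximant_integrable[OF f] approximant_integrable[OF g]
  note ii = integrable_real_mult_indicator[OF infdist_ge_sets i(1)] integrable_real_mult_indicator[OF infdist_ge_sets i(2)]
  have "(LINT x|lborel. cmod (1 / 2 * f x + 1 / 2 * g x)) = 1"
    unfolding nf using i f g by (simp add: approximant_def)
  moreover have "(LINT x|lborel. cmod (1 / 2 * f x + 1 / 2 * g x) * indicator {x. 1 / Suc n \<le> infdist x E} x) \<le> 1 / Suc n"
  proof -
    have "(LINT x|lborel. cmod (1 / 2 * f x + 1 / 2 * g x) * indicator {x. 1 / Suc n \<le> infdist x E} x)
       = 1 / 2 * (LINT x|lborel. cmod (f x) * indicator {x. 1 / Suc n \<le> infdist x E} x) + 1 / 2 * (LINT x|lborel. cmod (g x) * indicator {x. 1 / Suc n \<le> infdist x E} x)"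
      unfolding nf distrib_right mult.assoc
      by (subst Bochner_Integration.integral_add) (intro integrable_mult_right ii | simp only: integral_mult_right_zero)+
    also have "\<dots> \<le> 1 / 2 * (1 / Suc n) + 1 / 2 * (1 / Suc n)"
      using f g unfolding approximant_def by (intro add_mono mult_left_mono) auto
    also have "\<dots> = 1 / Suc n" by (simp add: field_simps)
    finally show ?thesis .
  qed
  moreover have "gaussian_pair (\<lambda>x. 1 / 2 * f x + 1 / 2 * g x) (\<lambda>x. 1 / 2 * \<phi> x + 1 / 2 * \<psi> x)"
    by (intro gaussian_pair_add gaussian_pair_cmult approximant_gaussian_pair[OF f] approximant_gaussian_pair[OF g])
  moreover have "1 / 2 * f x + 1 / 2 * g x = of_real (cmod (1 / 2 * f x + 1 / 2 * g x))" for x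
    unfolding nf of_real_add of_real_mult fr[symmetric] by simp
  ultimately show ?thesis unfolding approximant_def by blast
qed

lemma sobolev_energy_nonneg: "sobolev_energy a \<phi> \<ge> 0"
  unfolding sobolev_energy_def by (intro integral_nonneg_AE) (simp add: sobolev_density_nonneg)

lemma sobolev_energy_parallelogram:
  assumes \<phi>: "\<phi> \<in> gaussian_class" and \<psi>: "\<psi> \<in> gaussian_class" and a: "a \<ge> 0"
  shows "sobolev_energy a (\<lambda>x. \<phi> x - \<psi> x) =
    2 * sobolev_energy a \<phi> + 2 * sobolev_energy a \<psi> - 4 * sobolev_energy a (\<lambda>x. 1 / 2 * \<phi> x + 1 / 2 * \<psi> x)"
proof -
  have "(\<lambda>x. 1 / 2 * \<phi> x + 1 / 2 * \<psi> x) \<in> gaussian_class"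
    by (intro gaussian_class.add gaussian_class.cmult \<phi> \<psi>)
  note i = integrable_sobolev_density[OF \<phi> a] integrable_sobolev_density[OF \<psi> a] integrable_sobolev_density[OF this a]
  have "(cmod (z - w))\<^sup>2 = 2 * (cmod z)\<^sup>2 + 2 * (cmod w)\<^sup>2 - 4 * (cmod (1 / 2 * z + 1 / 2 * w))\<^sup>2" for z w :: complex
    unfolding cmod_power2 by (simp add: power2_eq_square field_simps)
  then have eq: "sobolev_density (- a) (\<lambda>x. \<phi> x - \<psi> x) \<xi> =
     2 * sobolev_density (- a) \<phi> \<xi> + 2 * sobolev_density (- a) \<psi> \<xi> - 4 * sobolev_density (- a) (\<lambda>x. 1 / 2 * \<phi> x + 1 / 2 * \<psi> x) \<xi>" for \<xi>
    unfolding sobolev_density_def by (simp only: right_diff_distrib distrib_left mult.left_commute)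
  have "(LINT \<xi>|lborel. sobolev_density (- a) (\<lambda>x. \<phi> x - \<psi> x) \<xi>) = (LINT \<xi>|lborel.
     2 * sobolev_density (- a) \<phi> \<xi> + 2 * sobolev_density (- a) \<psi> \<xi> - 4 * sobolev_density (- a) (\<lambda>x. 1 / 2 * \<phi> x + 1 / 2 * \<psi> x) \<xi>)"
    by (intro Bochner_Integration.integral_cong refl eq)
  then show ?thesis unfolding sobolev_energy_def using i by simp
qed

text \<open>Approximants of almost minimal energy form a Cauchy sequence, by the parallelogram law in the convex decreasing sets of
  approximants.\<close>

lemma ex_cauchy_approximants:
  fixes E :: "'a::euclidean_space set"
  assumes a: "a \<ge> 0" and M: "\<And>n. \<exists>f \<phi>. approximant E n f \<phi> \<and> sobolev_energy a \<phi> \<le> M"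
  obtains f \<phi> where "\<And>n. approximant E n (f n) (\<phi> n)" "\<And>n. sobolev_energy a (\<phi> n) \<le> M + 1"
    "\<And>e. e > 0 \<Longrightarrow> \<exists>N. \<forall>m\<ge>N. \<forall>n\<ge>N. sobolev_energy a (\<lambda>x. \<phi> m x - \<phi> n x) < e"
proof -
  define S where "S n = {q. \<exists>f \<phi>. approximant E n f \<phi> \<and> q = sobolev_energy a \<phi>}" for n
  define \<mu> where "\<mu> n = Inf (S n)" for n
  have bdd: "bdd_below (S n)" for n
    unfolding S_def using sobolev_energy_nonneg by (intro bdd_belowI[of _ 0]) auto
  have ne: "S n \<noteq> {}" for n using M[of n] by (auto simp: S_def)
  have low: "\<mu> n \<le> sobolev_energy a \<phi>" if "approximant E n f \<phi>" for n f \<phi>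
    unfolding \<mu>_def by (rule cInf_lower[OF _ bdd]) (use that in \<open>auto simp: S_def\<close>)
  have \<mu>M: "\<mu> n \<le> M" for n using M[of n] low[of n] by (meson order_trans)
  have "S m \<subseteq> S n" if "n \<le> m" for m n unfolding S_def using approximant_antimono[OF _ that] by blast
  \<comment> \<open>Minimal energies increase as the sets of competitors shrink, and the uniform
    energy bound keeps them below \<open>M\<close>; hence the limit \<open>L\<close>.\<close>
  then have inc: "incseq \<mu>" unfolding \<mu>_def by (intro incseq_def[THEN iffD2] allI impI cInf_superset_mono ne bdd)
  obtain L where L: "\<mu> \<longlonglongrightarrow> L" "\<And>n. \<mu> n \<le> L"
    using incseq_convergent[OF inc, of M] \<mu>M by auto
  have "\<exists>f \<phi>. approximant E n f \<phi> \<and> sobolev_energy a \<phi> < \<mu> n + 1 / Suc n" for n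
  proof -
    have "Inf (S n) < \<mu> n + 1 / Suc n" by (simp add: \<mu>_def)
    then obtain q where "q \<in> S n" "q < \<mu> n + 1 / Suc n" using cInf_lessD[OF ne] by blast
    then show ?thesis by (auto simp: S_def)
  qed
  then obtain f \<phi> where f: "\<And>n. approximant E n (f n) (\<phi> n)" "\<And>n. sobolev_energy a (\<phi> n) < \<mu> n + 1 / Suc n"
    by metis
  have main: "sobolev_energy a (\<lambda>x. \<phi> m x - \<phi> n x) \<le> 4 * (L - \<mu> N) + 4 * (1 / Suc N)" if "N \<le> m" "N \<le> n" for N m n
  proof -
    have g: "\<phi> m \<in> gaussian_class" "\<phi> n \<in> gaussian_class"
      using f(1) approximant_gaussian_pair unfolding gaussian_pair_def by blast+
    \<comment> \<open>The midpoint is still an approximant of level \<open>N\<close>, so its energy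
      is at least \<open>\<mu> N\<close>, while the energies of the endpoints are at most
      \<open>L + 1 / Suc N\<close>. The parallelogram law leaves only the gap between the
      two.\<close>
    have mid: "\<mu> N \<le> sobolev_energy a (\<lambda>x. 1 / 2 * \<phi> m x + 1 / 2 * \<phi> n x)"
      by (rule low[OF approximant_midpoint[OF approximant_antimono[OF f(1) that(1)] approximant_antimono[OF f(1) that(2)]]])
    have le: "sobolev_energy a (\<phi> k) \<le> L + 1 / Suc N" if "N \<le> k" for k
    proof -
      have "1 / real (Suc k) \<le> 1 / real (Suc N)" using that by (simp add: frac_le)
      then show ?thesis using f(2)[of k] L(2)[of k] by linarith
    qed
    have "2 * p + 2 * q - 4 * r \<le> 4 * (L - u) + 4 * d" if "p \<le> L + d" "q \<le> L + d" "u \<le> r" for p q r u d :: real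
      using that by (simp add: algebra_simps)
    from this[OF le[OF that(1)] le[OF that(2)] mid] show ?thesis
      unfolding sobolev_energy_parallelogram[OF g a] .
  qed
  show ?thesis
  proof (rule that[of f \<phi>])
    show "sobolev_energy a (\<phi> n) \<le> M + 1" for n
    proof -
      have "1 / real (Suc n) \<le> 1" by simp
      then show ?thesis using f(2)[of n] \<mu>M[of n] by linarith
    qed
    fix e :: real assume e: "e > 0"
    have "(\<lambda>N. 4 * (L - \<mu> N) + 4 * inverse (real (Suc N))) \<longlonglongrightarrow> 4 * (L - L) + 4 * 0"
      by (intro tendsto_intros L LIMSEQ_inverse_real_of_nat)
    then have "\<forall>\<^sub>F N in sequentially. 4 * (L - \<mu> N) + 4 * inverse (real (Suc N)) < e"
      by (rule order_tendstoD) (use e in simp)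
    then obtain N where "4 * (L - \<mu> N) + 4 * inverse (real (Suc N)) < e" by (auto simp: eventually_sequentially)
    then have N: "4 * (L - \<mu> N) + 4 * (1 / Suc N) < e" by (simp only: inverse_eq_divide)
    show "\<exists>N. \<forall>m\<ge>N. \<forall>n\<ge>N. sobolev_energy a (\<lambda>x. \<phi> m x - \<phi> n x) < e"
      using main[of N] N by (intro exI[of _ N]) (meson le_less_trans)
  qed (rule f(1))
qed

section \<open>Averages against approximants\<close>

lemma test_continuous_uniformly_continuous:
  fixes f :: "'a::euclidean_space \<Rightarrow> 'b::real_normed_vector"
  assumes "test_continuous f"
  shows "uniformly_continuous_on UNIV f"
proof -
  obtain K where K: "compact K" "\<And>w. w \<notin> K \<Longrightarrow> f w = 0" "continuous_on UNIV f"
    using assms unfolding test_continuous_def by blast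
  define L where "L = (\<lambda>(x, v). x + v) ` (K \<times> cball 0 1)"
  have "compact L" unfolding L_def case_prod_unfold
    by (intro compact_continuous_image compact_Times K compact_cball continuous_intros)
  then have uc: "uniformly_continuous_on L f"
    by (intro compact_uniformly_continuous continuous_on_subset[OF K(3)]) auto
  have L: "y \<in> L" if "x \<in> K" "dist x y \<le> 1" for x y
    unfolding L_def using that by (intro image_eqI[of _ _ "(x, y - x)"]) (auto simp: dist_norm norm_minus_commute)
  show ?thesis
    unfolding uniformly_continuous_on_def
  proof (intro allI impI)
    fix e :: real assume e: "e > 0"
    then obtain d where d: "d > 0" "\<And>x y. x \<in> L \<Longrightarrow> y \<in> L \<Longrightarrow> dist y x < d \<Longrightarrow> dist (f y) (f x) < e"
      using uc unfolding uniformly_continuous_on_def by metis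
    have "dist (f y) (f x) < e" if xy: "dist y x < min d 1" for x y
    proof (cases "x \<in> K \<or> y \<in> K")
      case True
      then have "x \<in> L \<and> y \<in> L" using L[of x x] L[of y y] L[of x y] L[of y x] xy by (auto simp: dist_commute)
      then show ?thesis using d(2) xy by simp
    qed (use K(2) e in simp)
    then show "\<exists>d>0. \<forall>x\<in>UNIV. \<forall>x'\<in>UNIV. dist x' x < d \<longrightarrow> dist (f x') (f x) < e"
      using d(1) by (intro exI[of _ "min d 1"]) auto
  qed
qed

text \<open>Uniform continuity extends the lower bound from \<open>E \<times> E\<close> to a
  neighbourhood with loss \<open>e / 2\<close>; outside it \<open>H\<close> is bounded and the
  approximants carry little mass. This replaces positivity of a limiting product measure.\<close>

lemma approximant_double_integral_ge:
  fixes H :: "'a::euclidean_space \<times> 'a \<Rightarrow> complex"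
  assumes f: "\<And>n. approximant E n (f n) (\<phi> n)" and E: "E \<noteq> {}"
    and H: "test_continuous H" "\<And>x y. x \<in> E \<Longrightarrow> y \<in> E \<Longrightarrow> c \<le> Re (H (y, x))" and e: "e > 0"
  shows "\<forall>\<^sub>F n in sequentially. c - e \<le> Re (LINT x|lborel. f n x * (LINT y|lborel. H (y, x) * f n y))"
proof -
  obtain B where B: "B \<ge> 0" "\<And>w. cmod (H w) \<le> B" using test_continuous_bounded[OF H(1)] by metis
  \<comment> \<open>The penalty when a variable is far from \<open>E\<close>:
    \<open>c - D \<le> - B\<close>, so subtracting \<open>D\<close> once makes the lower bound hold
    trivially.\<close>
  define D where "D = \<bar>c\<bar> + B"
  have D: "D \<ge> 0" using B by (simp add: D_def)
  have "uniformly_continuous_on UNIV H"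
    by (rule test_continuous_uniformly_continuous[OF H(1)])
  then obtain \<delta> where \<delta>: "\<delta> > 0" "\<And>w w'. dist w w' < \<delta> \<Longrightarrow> dist (H w) (H w') < e / 2"
    unfolding uniformly_continuous_on_def using e by (metis UNIV_I half_gt_zero)
  have "(\<lambda>n. inverse (real (Suc n))) \<longlonglongrightarrow> 0" by (rule LIMSEQ_inverse_real_of_nat)
  then have "\<forall>\<^sub>F n in sequentially. inverse (real (Suc n)) < min (\<delta> / 2) (e / (4 * (D + 1)))"
    using \<delta>(1) e D by (intro order_tendstoD) auto
  then show ?thesis
  proof eventually_elim
    fix n assume n: "inverse (real (Suc n)) < min (\<delta> / 2) (e / (4 * (D + 1)))"
    define g where "g x = cmod (f n x)" for x
    define Z where "Z x = (indicator {x. 1 / Suc n \<le> infdist x E} x :: real)" for x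
    have fg: "f n x = of_real (g x)" for x using f[of n] by (simp add: approximant_def g_def)
    have gi: "integrable lborel g" unfolding g_def by (rule approximant_integrable[OF f])
    have g1: "(LINT x|lborel. g x) = 1" using f[of n] by (simp add: approximant_def g_def)
    have g0: "g x \<ge> 0" for x by (simp add: g_def)
    have gZi: "integrable lborel (\<lambda>x. g x * Z x)" unfolding Z_def by (rule integrable_real_mult_indicator[OF infdist_ge_sets gi])
    define \<tau> where "\<tau> = (LINT x|lborel. g x * Z x)"
    have "\<tau> \<le> 1 / Suc n" using f[of n] by (simp add: approximant_def g_def Z_def \<tau>_def)
    then have \<tau>: "2 * D * \<tau> \<le> e / 2"
    proof -
      have "D * \<tau> \<le> D * (1 / Suc n)" using \<open>\<tau> \<le> 1 / Suc n\<close> D by (rule mult_left_mono)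
      also have "\<dots> \<le> (D + 1) * (e / (4 * (D + 1)))" using n D by (intro mult_mono) (auto simp: inverse_eq_divide)
      also have "\<dots> = e / 4" using D by (simp add: field_simps)
      finally show ?thesis by simp
    qed
    have near: "\<exists>x'\<in>E. dist x x' < \<delta> / 2" if "Z x = 0" for x
    proof -
      have "infdist x E < \<delta> / 2" using that n by (auto simp: Z_def indicator_def inverse_eq_divide split: if_splits)
      then have "Inf (dist x ` E) < \<delta> / 2" by (simp only: infdist_notempty[OF E])
      then show ?thesis using cInf_lessD[of "dist x ` E" "\<delta> / 2"] E by blast
    qed
    have lower: "(c - e / 2) - D * Z y - D * Z x \<le> Re (H (y, x))" for x y
    proof (cases "Z x = 0 \<and> Z y = 0")
      case True
      obtain x' where x': "x' \<in> E" "dist x x' < \<delta> / 2" using near[of x] True by blast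
      obtain y' where y': "y' \<in> E" "dist y y' < \<delta> / 2" using near[of y] True by blast
      note * = x'(1) y'(1) x'(2) y'(2)
      have "dist (y, x) (y', x') \<le> dist y y' + dist x x'" by (simp add: dist_Pair_Pair sqrt_sum_squares_le_sum)
      then have "dist (H (y, x)) (H (y', x')) < e / 2" using * by (intro \<delta>(2)) linarith
      then have "\<bar>Re (H (y, x) - H (y', x'))\<bar> < e / 2"
        using abs_Re_le_cmod[of "H (y, x) - H (y', x')"] unfolding dist_norm by (rule le_less_trans[rotated])
      then have "Re (H (y', x')) - e / 2 \<le> Re (H (y, x))" unfolding minus_complex.sel by linarith
      then have "c - e / 2 \<le> Re (H (y, x))" using H(2)[OF *(1,2)] by linarith
      then show ?thesis using True by simp
    next
      case False
      then have "Z y = 1 \<or> Z x = 1" by (auto simp: Z_def indicator_def)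
      moreover have "0 \<le> D * Z y" "0 \<le> D * Z x" using D by (simp_all add: Z_def)
      ultimately have "D \<le> D * Z y + D * Z x" by (elim disjE) simp_all
      moreover have "- B \<le> Re (H (y, x))" using abs_Re_le_cmod[of "H (y, x)"] B(2)[of "(y, x)"] by linarith
      moreover have "c - D \<le> - B" by (simp add: D_def)
      ultimately show ?thesis using e by linarith
    qed
    have c: "continuous_on UNIV (f n)"
      using f[of n] gaussian_class_continuous unfolding approximant_def gaussian_pair_def by blast
    have Hg: "test_continuous (\<lambda>(y, x). H (y, x) * f n y)"
      using test_continuous_mult_fst[OF c H(1)] by (simp add: mult.commute)
    define I where "I x = (LINT y|lborel. H (y, x) * f n y)" for x
    have Ic: "test_continuous I" unfolding I_def using test_continuous_integral[OF Hg] by simp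
    have ReI: "Re (I x) = (LINT y|lborel. Re (H (y, x)) * g y)" for x
    proof -
      have "integrable lborel (\<lambda>y. H (y, x) * f n y)"
        using test_continuous_integrable[OF test_continuous_slice(2)[OF Hg, of x]] by simp
      then show ?thesis unfolding I_def fg by (subst integral_Re[symmetric]) simp_all
    qed
    have I_low: "(c - e / 2) - D * \<tau> - D * Z x \<le> Re (I x)" for x
    proof -
      have i: "integrable lborel (\<lambda>y. (c - e / 2 - D * Z x) * g y - D * (g y * Z y))"
        using gi gZi by (intro Bochner_Integration.integrable_diff integrable_mult_right)
      have "(c - e / 2) - D * \<tau> - D * Z x = (LINT y|lborel. (c - e / 2 - D * Z x) * g y - D * (g y * Z y))"
        using gi gZi g1 by (simp add: \<tau>_def)
      also have "\<dots> \<le> (LINT y|lborel. Re (H (y, x)) * g y)"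
      proof (rule integral_mono[OF i])
        show "integrable lborel (\<lambda>y. Re (H (y, x)) * g y)"
        proof -
          have "integrable lborel (\<lambda>y. Re (H (y, x) * f n y))"
            using test_continuous_integrable[OF test_continuous_slice(2)[OF Hg, of x]] by (intro integrable_Re) simp
          then show ?thesis unfolding fg by simp
        qed
        show "(c - e / 2 - D * Z x) * g y - D * (g y * Z y) \<le> Re (H (y, x)) * g y" for y
          using mult_right_mono[OF lower[of y x] g0[of y]] by (simp add: algebra_simps)
      qed
      finally show ?thesis by (simp add: ReI)
    qed
    have fI: "integrable lborel (\<lambda>x. f n x * I x)"
      by (intro test_continuous_integrable test_continuous_mult c Ic)
    have "c - e \<le> (c - e / 2 - D * \<tau>) - D * \<tau>" using \<tau> by simp
    also have "\<dots> = (LINT x|lborel. (c - e / 2 - D * \<tau>) * g x - D * (g x * Z x))"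
      using gi gZi g1 by (simp add: \<tau>_def)
    also have "\<dots> \<le> (LINT x|lborel. g x * Re (I x))"
    proof (rule integral_mono)
      show "integrable lborel (\<lambda>x. (c - e / 2 - D * \<tau>) * g x - D * (g x * Z x))"
        using gi gZi by (intro Bochner_Integration.integrable_diff integrable_mult_right)
      show "integrable lborel (\<lambda>x. g x * Re (I x))"
        using integrable_Re[OF fI] unfolding fg by simp
      show "(c - e / 2 - D * \<tau>) * g x - D * (g x * Z x) \<le> g x * Re (I x)" for x
        using mult_left_mono[OF I_low[of x] g0[of x]] by (simp add: algebra_simps)
    qed
    also have "\<dots> = Re (LINT x|lborel. f n x * I x)"
      using integral_Re[OF fI] unfolding fg by simp
    finally show "c - e \<le> Re (LINT x|lborel. f n x * (LINT y|lborel. H (y, x) * f n y))" unfolding I_def .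
  qed
qed

section \<open>The density of the push-forward\<close>

lemma tempered_diff_gaussian_class:
  assumes "tempered u" "f \<in> gaussian_class" "g \<in> gaussian_class"
  shows "u (\<lambda>x. f x - g x) = u f - u g"
proof -
  have m: "(\<lambda>x. - 1 * g x) \<in> gaussian_class" by (rule gaussian_class.cmult[OF assms(3)])
  note sch = gaussian_class_schwartz[OF assms(2)] gaussian_class_schwartz[OF assms(3)] gaussian_class_schwartz[OF m]
  have "u (\<lambda>x. f x + - 1 * g x) = u f + u (\<lambda>x. - 1 * g x)"
    by (rule assms(1)[unfolded tempered_def, THEN conjunct1, rule_format, OF sch(1,3)])
  also have "u (\<lambda>x. - 1 * g x) = - 1 * u g"
    by (rule assms(1)[unfolded tempered_def, THEN conjunct2, THEN conjunct1, rule_format, OF sch(2)])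
  finally show ?thesis by simp
qed

lemma radon_functional_of:
  assumes "\<And>x. radon_fun (\<Phi> \<circ> prod.swap) (b \<circ> prod.swap) t h x = J (x, t)"
  shows "radon \<Phi> b t (functional_of f) h = (LINT x|lborel. f x * J (x, t))"
  unfolding radon_def functional_of_def by (simp add: assms)

text \<open>The difference of quadratic values is split as \<open>B(f, f - g) + B(f - g, g)\<close>.
  Linearity in the test function comes from temperedness of the image functional, linearity in the
  other argument from the integral formula with \<open>J\<close>.\<close>

lemma radon_quadratic_diff_le:
  fixes f g :: "'a::euclidean_space \<Rightarrow> complex"
  assumes T: "sobolev_bounded (radon \<Phi> b t) (- a) a C" and a: "a \<ge> 0" and C: "C \<ge> 0"
    and f: "gaussian_pair f \<phi>" and g: "gaussian_pair g \<psi>"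
    and M: "sobolev_energy a \<phi> \<le> M" "sobolev_energy a \<psi> \<le> M"
    and J: "test_continuous J" "\<And>x. radon_fun (\<Phi> \<circ> prod.swap) (b \<circ> prod.swap) t g x = J (x, t)"
  shows "cmod (radon \<Phi> b t (functional_of f) f - radon \<Phi> b t (functional_of g) g)
    \<le> 2 * C * sqrt M * sqrt (sobolev_energy a (\<lambda>x. \<phi> x - \<psi> x))"
proof -
  let ?B = "\<lambda>u. radon \<Phi> b t (functional_of u)"
  let ?q = "sobolev_energy a (\<lambda>x. \<phi> x - \<psi> x)"
  note d = gaussian_pair_diff[OF f g]
  have gc: "f \<in> gaussian_class" "g \<in> gaussian_class" using f g by (auto simp: gaussian_pair_def)
  have "?B f \<in> sobolev a" using T sobolev_functional_of(1)[OF f a] unfolding sobolev_bounded_def by blast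
  then have "tempered (?B f)" by (simp add: sobolev_def)
  then have 1: "?B f f - ?B f g = ?B f (\<lambda>x. f x - g x)" using tempered_diff_gaussian_class gc by metis
  have 2: "?B f g - ?B g g = ?B (\<lambda>x. f x - g x) g"
  proof -
    obtain BJ where BJ: "\<And>w. cmod (J w) \<le> BJ" using test_continuous_bounded[OF J(1)] by metis
    have i: "integrable lborel (\<lambda>x. k x * J (x, t))" if "k \<in> gaussian_class" for k
      using test_continuous_measurable[OF test_continuous_slice(2)[OF J(1)]]
      by (intro integrable_mult_bounded[OF gaussian_class_integrable[OF that] _ BJ]) simp
    show ?thesis
      unfolding radon_functional_of[OF J(2)] left_diff_distrib
      using i[OF gc(1)] i[OF gc(2)] by (rule Bochner_Integration.integral_diff[symmetric])
  qed
  have "cmod (?B f f - ?B g g) = cmod ((?B f f - ?B f g) + (?B f g - ?B g g))" by simp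
  also have "\<dots> \<le> cmod (?B f (\<lambda>x. f x - g x)) + cmod (?B (\<lambda>x. f x - g x) g)"
    unfolding 1 2 by (rule norm_triangle_ineq)
  also have "\<dots> \<le> C * (sqrt (sobolev_energy a \<phi>) * sqrt ?q) + C * (sqrt ?q * sqrt (sobolev_energy a \<psi>))"
    by (intro add_mono sobolev_bounded_pairing[OF T a] f g d)
  also have "\<dots> \<le> C * (sqrt M * sqrt ?q) + C * (sqrt ?q * sqrt M)"
    using C M order_trans[OF sobolev_energy_nonneg M(1)]
    by (intro add_mono mult_left_mono mult_mono real_sqrt_le_mono) (auto simp: sobolev_energy_nonneg)
  finally show ?thesis by (simp add: mult_ac)
qed

text \<open>Integrating in \<open>t\<close> against \<psi> undoes the delta: the family of quadratic
  forms becomes a double integral in which \<open>\<psi> (\<Phi> (y, x))\<close> multiplies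
  \<open>b\<close>.\<close>

lemma radon_weak_identity:
  fixes \<Phi> :: "(real ^ 'd) \<times> (real ^ 'd) \<Rightarrow> real ^ 'k" and f :: "real ^ 'd \<Rightarrow> complex"
    and J :: "(real ^ 'd) \<times> (real ^ 'k) \<Rightarrow> complex"
  assumes f: "continuous_on UNIV f" and J: "test_continuous J"
    and eq: "\<And>x \<psi> c. \<psi> \<in> borel_measurable borel \<Longrightarrow> (\<And>t. \<bar>\<psi> t\<bar> \<le> c) \<Longrightarrow>
        (LINT y|lborel. b (y, x) * f y * of_real (\<psi> (\<Phi> (y, x)))) = (LINT t|lborel. J (x, t) * of_real (\<psi> t))"
    and \<psi>: "continuous_on UNIV \<psi>" "\<And>t. \<bar>\<psi> t\<bar> \<le> c"
  shows "(LINT t|lborel. of_real (\<psi> t) * (LINT x|lborel. f x * J (x, t)))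
     = (LINT x|lborel. f x * (LINT y|lborel. b (y, x) * of_real (\<psi> (\<Phi> (y, x))) * f y))"
proof -
  have \<psi>m: "\<psi> \<in> borel_measurable borel" using \<psi>(1) by (rule borel_measurable_continuous_onI)
  have G: "test_continuous (\<lambda>(x, t). f x * J (x, t))" by (rule test_continuous_mult_fst[OF f J])
  have m: "(\<lambda>w::(real^'d) \<times> (real^'k). complex_of_real (\<psi> (snd w))) \<in> borel_measurable borel"
    by (intro borel_measurable_continuous_onI continuous_intros continuous_on_compose2[OF \<psi>(1)]) auto
  have int: "integrable (lborel \<Otimes>\<^sub>M lborel) (\<lambda>(x, t). f x * J (x, t) * of_real (\<psi> t))"
    using integrable_test_continuous_mult[OF G m, of c] \<psi>(2) by (simp add: case_prod_unfold lborel_prod)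
  have "(LINT t|lborel. of_real (\<psi> t) * (LINT x|lborel. f x * J (x, t))) = (LINT t|lborel. LINT x|lborel. f x * J (x, t) * of_real (\<psi> t))"
    by (simp add: mult.commute)
  also have "\<dots> = (LINT x|lborel. LINT t|lborel. f x * J (x, t) * of_real (\<psi> t))"
    by (rule lborel_pair.Fubini_integral[OF int])
  also have "\<dots> = (LINT x|lborel. f x * (LINT t|lborel. J (x, t) * of_real (\<psi> t)))"
    by (simp add: mult.assoc)
  also have "\<dots> = (LINT x|lborel. f x * (LINT y|lborel. b (y, x) * f y * of_real (\<psi> (\<Phi> (y, x)))))"
    by (simp only: eq[OF \<psi>m \<psi>(2)])
  also have "\<dots> = (LINT x|lborel. f x * (LINT y|lborel. b (y, x) * of_real (\<psi> (\<Phi> (y, x))) * f y))"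
    by (simp only: mult_ac)
  finally show ?thesis .
qed

text \<open>\<open>\<nu>\<close> is the density of the push-forward under \<open>\<Phi>\<close> of \<open>b\<close> times the square of the limiting measure on \<open>E\<close>.
  That measure itself never appears: positivity statements about it are read off from the approximants.\<close>

lemma ex_continuous_density:
  fixes \<Phi> :: "(real ^ 'd) \<times> (real ^ 'd) \<Rightarrow> real ^ 'k" and b :: "(real ^ 'd) \<times> (real ^ 'd) \<Rightarrow> complex"
  assumes \<Phi>: "smooth \<Phi>"
    and rank: "\<And>x y. rank (matrix (frechet_derivative (\<lambda>x'. \<Phi> (x', y)) (at x))) = CARD('k)"
    and W: "open W" "bounded W" and b: "test_function b" and a: "a \<ge> 0"
    and T: "\<forall>t\<in>W. sobolev_bounded (radon \<Phi> b t) (- a) a C"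
    and E: "bounded E" "E \<noteq> {}" "finite_content_ge s c E" "c > 0" "s > 0" "real CARD('d) - s < 2 * a"
  obtains \<nu> where "continuous_on W \<nu>" "\<forall>t. t \<notin> W \<longrightarrow> \<nu> t = 0"
    "\<forall>\<psi> k. continuous_on UNIV \<psi> \<longrightarrow> (\<forall>t. \<bar>\<psi> t\<bar> \<le> k) \<longrightarrow> (\<forall>t. t \<notin> W \<longrightarrow> \<psi> t = 0) \<longrightarrow>
        integrable lborel (\<lambda>t. of_real (\<psi> t) * \<nu> t)"
    "\<forall>\<psi> k u l. continuous_on UNIV \<psi> \<longrightarrow> (\<forall>t. \<bar>\<psi> t\<bar> \<le> k) \<longrightarrow> (\<forall>t. t \<notin> W \<longrightarrow> \<psi> t = 0) \<longrightarrow>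
       (\<forall>x\<in>E. \<forall>y\<in>E. l \<le> Re (u * (b (y, x) * of_real (\<psi> (\<Phi> (y, x)))))) \<longrightarrow>
       l \<le> Re (u * (LINT t|lborel. of_real (\<psi> t) * \<nu> t))"
proof -
  \<comment> \<open>A bound holding with a negative constant also holds with 0, and the estimates
    below multiply inequalities by the constant.\<close>
  define C' where "C' = max 0 C"
  have C': "C' \<ge> 0" by (simp add: C'_def)
  have T': "sobolev_bounded (radon \<Phi> b t) (- a) a C'" if "t \<in> W" for t
    unfolding sobolev_bounded_def
  proof (intro ballI conjI)
    fix u :: "(real^'d) functional" assume u: "u \<in> sobolev (- a)"
    note * = bspec[OF T that, unfolded sobolev_bounded_def, rule_format, OF u]
    show "radon \<Phi> b t u \<in> sobolev a" using * by blast
    have "0 \<le> sobolev_norm (- a) u"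
      unfolding sobolev_norm_def by (intro real_sqrt_ge_zero integral_nonneg_AE) (simp add: sobolev_density_nonneg)
    then have "C * sobolev_norm (- a) u \<le> C' * sobolev_norm (- a) u" by (intro mult_right_mono) (simp_all add: C'_def)
    then show "sobolev_norm a (radon \<Phi> b t u) \<le> C' * sobolev_norm (- a) u" using * by linarith
  qed
  obtain M0 where M0: "\<And>n. \<exists>f \<phi>. approximant E n f \<phi> \<and> sobolev_energy a \<phi> \<le> M0"
    using approximants_energy_bounded[OF E(1,3,4,5) a] E(6) by auto
  define M where "M = M0 + 1"
  obtain f \<phi> where f: "\<And>n. approximant E n (f n) (\<phi> n)" "\<And>n. sobolev_energy a (\<phi> n) \<le> M"
    "\<And>e. e > 0 \<Longrightarrow> \<exists>N. \<forall>m\<ge>N. \<forall>n\<ge>N. sobolev_energy a (\<lambda>x. \<phi> m x - \<phi> n x) < e"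
    unfolding M_def by (rule ex_cauchy_approximants[OF a M0]) blast
  have gp: "gaussian_pair (f n) (\<phi> n)" for n by (rule approximant_gaussian_pair[OF f(1)])
  have fc: "continuous_on UNIV (f n)" for n
    using gp[of n] gaussian_class_continuous by (auto simp: gaussian_pair_def)
  define Q where "Q n J \<longleftrightarrow> test_continuous J \<and> (\<forall>x t. radon_fun (\<Phi> \<circ> prod.swap) (b \<circ> prod.swap) t (f n) x = J (x, t)) \<and>
    (\<forall>x \<psi> c. \<psi> \<in> borel_measurable borel \<longrightarrow> (\<forall>t. \<bar>\<psi> t\<bar> \<le> c) \<longrightarrow>
        (LINT y|lborel. b (y, x) * f n y * of_real (\<psi> (\<Phi> (y, x)))) = (LINT t|lborel. J (x, t) * of_real (\<psi> t)))" for n J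
  have "\<exists>J. Q n J" for n
    unfolding Q_def by (rule radon_fun_density[OF \<Phi> rank b fc[of n]]) blast
  then obtain J where Q: "\<And>n. Q n (J n)" by metis
  have J: "test_continuous (J n)"
    "radon_fun (\<Phi> \<circ> prod.swap) (b \<circ> prod.swap) t (f n) x = J n (x, t)"
    "\<psi> \<in> borel_measurable borel \<Longrightarrow> (\<And>t. \<bar>\<psi> t\<bar> \<le> c) \<Longrightarrow>
        (LINT y|lborel. b (y, x) * f n y * of_real (\<psi> (\<Phi> (y, x)))) = (LINT t|lborel. J n (x, t) * of_real (\<psi> t))"
    for n x t \<psi> c
    using Q[of n] unfolding Q_def by blast+
  define \<nu>n where "\<nu>n n t = (LINT x|lborel. f n x * J n (x, t))" for n t
  have \<nu>n: "\<nu>n n t = radon \<Phi> b t (functional_of (f n)) (f n)" for n t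
    unfolding \<nu>n_def by (rule radon_functional_of[symmetric]) (rule J(2))
  have \<nu>nc: "continuous_on UNIV (\<nu>n n)" for n
    using test_continuous_integral[OF test_continuous_mult_fst[OF fc J(1)]]
    unfolding \<nu>n_def[abs_def] test_continuous_def by simp
  have M: "M \<ge> 0" using order_trans[OF sobolev_energy_nonneg f(2)[of 0]] .
  have bound: "cmod (\<nu>n n t) \<le> C' * M" if "t \<in> W" for n t
  proof -
    have "cmod (\<nu>n n t) \<le> C' * (sqrt (sobolev_energy a (\<phi> n)) * sqrt (sobolev_energy a (\<phi> n)))"
      unfolding \<nu>n by (rule sobolev_bounded_pairing[OF T'[OF that] a gp gp])
    also have "\<dots> = C' * sobolev_energy a (\<phi> n)" by (simp add: sobolev_energy_nonneg)
    also have "\<dots> \<le> C' * M" by (intro mult_left_mono f C')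
    finally show ?thesis .
  qed
  have "uniformly_Cauchy_on W \<nu>n"
    unfolding uniformly_Cauchy_on_def
  proof (intro allI impI)
    fix e :: real assume e: "e > 0"
    define A where "A = 2 * C' * sqrt M + 1"
    have A: "A > 0" using C' M by (simp add: A_def add_nonneg_pos)
    obtain N where N: "\<And>m n. m \<ge> N \<Longrightarrow> n \<ge> N \<Longrightarrow> sobolev_energy a (\<lambda>x. \<phi> m x - \<phi> n x) < (e / A)\<^sup>2"
      using f(3)[of "(e / A)\<^sup>2"] e A by auto
    have "dist (\<nu>n m t) (\<nu>n n t) < e" if "t \<in> W" "m \<ge> N" "n \<ge> N" for t m n
    proof -
      have "sqrt (sobolev_energy a (\<lambda>x. \<phi> m x - \<phi> n x)) < e / A"
        using N[OF that(2,3)] e A real_sqrt_less_mono[OF N[OF that(2,3)]] by simp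
      have "dist (\<nu>n m t) (\<nu>n n t) \<le> 2 * C' * sqrt M * sqrt (sobolev_energy a (\<lambda>x. \<phi> m x - \<phi> n x))"
        unfolding dist_norm \<nu>n by (rule radon_quadratic_diff_le[OF T'[OF that(1)] a C' gp gp f(2) f(2) J(1) J(2)])
      also have "\<dots> \<le> 2 * C' * sqrt M * (e / A)"
        using C' M \<open>sqrt _ < e / A\<close> by (intro mult_left_mono) auto
      also have "\<dots> < A * (e / A)" using e A by (intro mult_strict_right_mono) (auto simp: A_def)
      finally show ?thesis using A by simp
    qed
    then show "\<exists>N. \<forall>t\<in>W. \<forall>m\<ge>N. \<forall>n\<ge>N. dist (\<nu>n m t) (\<nu>n n t) < e" by blast
  qed
  then obtain l where l: "uniform_limit W \<nu>n l sequentially"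
    using Cauchy_uniformly_convergent uniformly_convergent_on_def by blast
  \<comment> \<open>The uniform limit carries information on \<open>W\<close> only; every test
    function used below vanishes off \<open>W\<close>.\<close>
  define \<nu> where "\<nu> t = (if t \<in> W then l t else 0)" for t
  have "continuous_on W l"
    by (rule uniform_limit_theorem[OF _ l]) (auto intro: always_eventually continuous_on_subset[OF \<nu>nc])
  then have \<nu>c: "continuous_on W \<nu>" by (rule continuous_on_eq) (simp add: \<nu>_def)
  have \<nu>lim: "(\<lambda>n. \<nu>n n t) \<longlonglongrightarrow> \<nu> t" if "t \<in> W" for t
    using tendsto_uniform_limitI[OF l that] that by (simp add: \<nu>_def)
  \<comment> \<open>The uniform bound \<open>C' * M\<close> on the bounded set \<open>W\<close>
    provides an integrable majorant.\<close>
  have dct: "integrable lborel (\<lambda>t. of_real (\<psi> t) * \<nu> t)"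
    "(\<lambda>n. LINT t|lborel. of_real (\<psi> t) * \<nu>n n t) \<longlonglongrightarrow> (LINT t|lborel. of_real (\<psi> t) * \<nu> t)"
    if \<psi>: "continuous_on UNIV \<psi>" "\<And>t. \<bar>\<psi> t\<bar> \<le> k" "\<And>t. t \<notin> W \<Longrightarrow> \<psi> t = 0" for \<psi> k
  proof -
    let ?w = "\<lambda>t. (k * (C' * M)) * indicator W t :: real"
    have k: "k \<ge> 0" using order_trans[OF abs_ge_zero \<psi>(2)] .
    have Wm: "W \<in> sets lborel" using W(1) by simp
    have "emeasure lborel W < \<infinity>" using W(2) by (rule emeasure_bounded_finite)
    then have w: "integrable lborel ?w" using Wm by (intro integrable_mult_right integrable_real_indicator)
    have meas: "(\<lambda>t. of_real (\<psi> t) * \<nu>n n t) \<in> borel_measurable lborel" for n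
      using \<psi>(1) \<nu>nc[of n] by (auto intro!: borel_measurable_continuous_onI continuous_intros)
    have lim: "(\<lambda>n. of_real (\<psi> t) * \<nu>n n t) \<longlonglongrightarrow> of_real (\<psi> t) * \<nu> t" for t
      using \<psi>(3)[of t] \<nu>lim[of t] by (cases "t \<in> W") (auto intro: tendsto_intros)
    have meas': "(\<lambda>t. of_real (\<psi> t) * \<nu> t) \<in> borel_measurable lborel"
      by (rule borel_measurable_LIMSEQ_metric[OF meas]) (rule lim)
    have bd: "norm (of_real (\<psi> t) * \<nu>n n t) \<le> ?w t" for n t
    proof (cases "t \<in> W")
      case True
      have "\<bar>\<psi> t\<bar> * cmod (\<nu>n n t) \<le> k * (C' * M)"
        by (intro mult_mono \<psi>(2) bound[OF True] k norm_ge_zero)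
      then show ?thesis using True by (simp add: norm_mult)
    qed (simp add: \<psi>(3))
    show "integrable lborel (\<lambda>t. of_real (\<psi> t) * \<nu> t)"
      by (rule integrable_dominated_convergence[OF meas' meas w]) (auto intro!: AE_I2 lim bd)
    show "(\<lambda>n. LINT t|lborel. of_real (\<psi> t) * \<nu>n n t) \<longlonglongrightarrow> (LINT t|lborel. of_real (\<psi> t) * \<nu> t)"
      by (rule integral_dominated_convergence[OF meas' meas w]) (auto intro!: AE_I2 lim bd)
  qed
  show ?thesis
  proof (rule that[OF \<nu>c])
    show "\<forall>t. t \<notin> W \<longrightarrow> \<nu> t = 0" by (simp add: \<nu>_def)
  next
    show "\<forall>\<psi> k. continuous_on UNIV \<psi> \<longrightarrow> (\<forall>t. \<bar>\<psi> t\<bar> \<le> k) \<longrightarrow> (\<forall>t. t \<notin> W \<longrightarrow> \<psi> t = 0) \<longrightarrow>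
        integrable lborel (\<lambda>t. of_real (\<psi> t) * \<nu> t)"
      using dct(1) by blast
  next
    show "\<forall>\<psi> k u l. continuous_on UNIV \<psi> \<longrightarrow> (\<forall>t. \<bar>\<psi> t\<bar> \<le> k) \<longrightarrow> (\<forall>t. t \<notin> W \<longrightarrow> \<psi> t = 0) \<longrightarrow>
       (\<forall>x\<in>E. \<forall>y\<in>E. l \<le> Re (u * (b (y, x) * of_real (\<psi> (\<Phi> (y, x)))))) \<longrightarrow>
       l \<le> Re (u * (LINT t|lborel. of_real (\<psi> t) * \<nu> t))"
    proof (intro allI impI)
    fix \<psi> :: "real^'k \<Rightarrow> real" and k l0 :: real and u :: complex
    assume \<psi>': "continuous_on UNIV \<psi>" "\<forall>t. \<bar>\<psi> t\<bar> \<le> k" "\<forall>t. t \<notin> W \<longrightarrow> \<psi> t = 0"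
      and low: "\<forall>x\<in>E. \<forall>y\<in>E. l0 \<le> Re (u * (b (y, x) * of_real (\<psi> (\<Phi> (y, x)))))"
    note \<psi> = \<psi>'(1) \<psi>'(2,3)[rule_format]
    define H where "H w = u * (b w * of_real (\<psi> (\<Phi> w)))" for w
    have H: "test_continuous H"
    proof -
      have "continuous_on UNIV (\<lambda>w. u * of_real (\<psi> (\<Phi> w)))"
        by (intro continuous_intros continuous_on_compose2[OF \<psi>(1)] smooth_continuous[OF \<Phi>]) auto
      from test_continuous_mult[OF this test_function_continuous[OF b]] show ?thesis by (simp add: H_def[abs_def] mult_ac)
    qed
    have eq: "(LINT x|lborel. f n x * (LINT y|lborel. H (y, x) * f n y)) = u * (LINT t|lborel. of_real (\<psi> t) * \<nu>n n t)" for n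
    proof -
      have "(LINT x|lborel. f n x * (LINT y|lborel. H (y, x) * f n y)) = u * (LINT x|lborel. f n x * (LINT y|lborel. b (y, x) * of_real (\<psi> (\<Phi> (y, x))) * f n y))"
        unfolding H_def mult.assoc[of u] integral_mult_right_zero mult.left_commute[of _ u] ..
      also have "(LINT x|lborel. f n x * (LINT y|lborel. b (y, x) * of_real (\<psi> (\<Phi> (y, x))) * f n y)) = (LINT t|lborel. of_real (\<psi> t) * \<nu>n n t)"
        unfolding \<nu>n_def by (rule radon_weak_identity[OF fc J(1) J(3) \<psi>(1,2), symmetric])
      finally show ?thesis .
    qed
    have lim: "(\<lambda>n. Re (u * (LINT t|lborel. of_real (\<psi> t) * \<nu>n n t))) \<longlonglongrightarrow> Re (u * (LINT t|lborel. of_real (\<psi> t) * \<nu> t))"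
      by (intro tendsto_intros dct(2)[OF \<psi>])
    show "l0 \<le> Re (u * (LINT t|lborel. of_real (\<psi> t) * \<nu> t))"
    proof (rule field_le_epsilon)
      fix e :: real assume e: "e > 0"
      have "\<forall>\<^sub>F n in sequentially. l0 - e \<le> Re (u * (LINT t|lborel. of_real (\<psi> t) * \<nu>n n t))"
        unfolding eq[symmetric] by (rule approximant_double_integral_ge[OF f(1) E(2) H _ e]) (unfold H_def, rule low[rule_format])
      then have "l0 - e \<le> Re (u * (LINT t|lborel. of_real (\<psi> t) * \<nu> t))"
        by (rule tendsto_lowerbound[OF lim]) simp
      then show "l0 \<le> Re (u * (LINT t|lborel. of_real (\<psi> t) * \<nu> t)) + e" by simp
    qed
    qed
  qed
qed

section \<open>Support and nonvanishing of the limiting density\<close>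

lemma half_norm_square_less: "z \<noteq> 0 \<Longrightarrow> (cmod z)\<^sup>2 / 2 < Re (cnj z * z)"
  by (metis Re_complex_of_real complex_norm_square field_sum_of_halves less_add_same_cancel1 mult.commute half_gt_zero zero_less_norm_iff zero_less_power)

theorem theorem1p1:
  fixes \<Phi> :: "(real ^ 'd) \<times> (real ^ 'd) \<Rightarrow> real ^ 'k"
    and b :: "(real ^ 'd) \<times> (real ^ 'd) \<Rightarrow> complex"
    and W :: "(real ^ 'k) set"
    and E :: "(real ^ 'd) set"
    and \<alpha> :: real
  assumes "CARD('k) \<le> CARD('d)"
    and "smooth \<Phi>"
    and "\<And>x y. rank (matrix (frechet_derivative (\<lambda>x'. \<Phi> (x', y)) (at x))) = CARD('k)"
    and "\<And>x y. rank (matrix (frechet_derivative (\<lambda>y'. \<Phi> (x, y')) (at y))) = CARD('k)"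
    and "open W" and "bounded W"
    and "test_function b"
    and "0 \<le> \<alpha>" and "\<alpha> \<le> (real CARD('d) - real CARD('k)) / 2"
    and "\<And>s. \<exists>C. \<forall>t\<in>W. sobolev_bounded (radon \<Phi> b t) s (s + \<alpha>) C"
    and "compact E"
    and "\<And>x y. x \<in> E \<Longrightarrow> y \<in> E \<Longrightarrow> \<Phi> (x, y) \<in> W"
    and "\<And>x y. x \<in> E \<Longrightarrow> y \<in> E \<Longrightarrow> b (x, y) \<noteq> 0"
    and "hausdorff_dim E > ereal (real CARD('d) - \<alpha>)"
  shows "interior {\<Phi> (x, y) | x y. x \<in> E \<and> y \<in> E} \<noteq> {}"
proof -
  have \<Phi>c: "continuous_on UNIV \<Phi>" by (rule smooth_continuous[OF assms(2)])
  have bc: "continuous_on UNIV b" using test_function_continuous[OF assms(7)] by (simp add: test_continuous_def)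
  have s0: "real CARD('d) - \<alpha> \<ge> 0" using assms(9) by (simp add: field_simps)
  obtain s c where s: "s > real CARD('d) - \<alpha>" "c > 0" "finite_content_ge s c E"
    using finite_content_ge_if_hausdorff_dim[OF assms(14) s0] by blast
  \<comment> \<open>\<open>b\<close> is complex valued, so its phase could cause cancellation in
    integrals over \<open>E \<times> E\<close>. Near \<open>(z, z)\<close>, multiplication by the
    conjugate of \<open>b (z, z)\<close> makes the real part at least half of the squared
    modulus.\<close>
  have "\<exists>\<rho>>0. \<forall>x\<in>cball z \<rho>. \<forall>y\<in>cball z \<rho>. (cmod (b (z, z)))\<^sup>2 / 2 \<le> Re (cnj (b (z, z)) * b (x, y))" if "z \<in> E" for z
  proof -
    let ?z = "b (z, z)"
    have "open {w. (cmod ?z)\<^sup>2 / 2 < Re (cnj ?z * b w)}" by (intro open_Collect_less continuous_intros bc)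
    moreover have "(z, z) \<in> {w. (cmod ?z)\<^sup>2 / 2 < Re (cnj ?z * b w)}"
      using half_norm_square_less[OF assms(13)[OF that that]] by (simp only: mem_Collect_eq)
    ultimately obtain A B where AB: "open A" "open B" "z \<in> A" "z \<in> B" "A \<times> B \<subseteq> {w. (cmod ?z)\<^sup>2 / 2 < Re (cnj ?z * b w)}"
      by (metis open_prod_elim mem_Sigma_iff)
    then obtain \<rho> where "\<rho> > 0" "cball z \<rho> \<subseteq> A \<inter> B" using open_contains_cball[of "A \<inter> B"] by blast
    then show ?thesis using AB(5) by (intro exI[of _ \<rho>]) (auto simp: subset_eq less_imp_le)
  qed
  then obtain \<rho> where \<rho>: "\<And>z. z \<in> E \<Longrightarrow> \<rho> z > 0"
    "\<And>z x y. z \<in> E \<Longrightarrow> x \<in> cball z (\<rho> z) \<Longrightarrow> y \<in> cball z (\<rho> z) \<Longrightarrow> (cmod (b (z, z)))\<^sup>2 / 2 \<le> Re (cnj (b (z, z)) * b (x, y))"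
    by metis
  obtain P where P: "P \<subseteq> E" "finite P" "E \<subseteq> (\<Union>z\<in>P. ball z (\<rho> z))"
  proof (rule compactE_image[OF assms(11), of E "\<lambda>z. ball z (\<rho> z)"])
    show "E \<subseteq> (\<Union>z\<in>E. ball z (\<rho> z))" using \<rho>(1) by auto
  qed auto
  have P': "E \<subseteq> (\<Union>z\<in>P. cball z (\<rho> z))"
    using P(3) by (rule order_trans) (intro UN_mono subset_refl ball_subset_cball)
  obtain z c' where z: "z \<in> P" "c' > 0" "finite_content_ge s c' (E \<inter> cball z (\<rho> z))"
    by (rule finite_content_ge_localize[OF s(3,2) P(2) P'])
  define F where "F = E \<inter> cball z (\<rho> z)"
  define \<beta> where "\<beta> = b (z, z)"
  have zE: "z \<in> E" using z(1) P(1) by blast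
  have \<beta>: "cmod \<beta> > 0" using assms(13)[OF zE zE] by (simp add: \<beta>_def)
  have Fne: "F \<noteq> {}" using zE \<rho>(1)[OF zE] by (auto simp: F_def)
  have Fc: "compact F" unfolding F_def by (intro compact_Int_closed assms(11) closed_cball)
  have s_pos: "s > 0" using s(1) s0 by linarith
  have s_ad: "real CARD('d) - s < 2 * (\<alpha> / 2)" using s(1) by simp
  \<comment> \<open>With \<open>s = - (\<alpha> / 2)\<close> the target order
    \<open>s + \<alpha>\<close> is \<open>\<alpha> / 2\<close>, the dual order.\<close>
  obtain C where C: "\<forall>t\<in>W. sobolev_bounded (radon \<Phi> b t) (- (\<alpha> / 2)) (\<alpha> / 2) C"
    using assms(10)[of "- (\<alpha> / 2)"] by auto
  have a: "\<alpha> / 2 \<ge> 0" using assms(8) by simp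
  obtain \<nu> where \<nu>: "continuous_on W \<nu>" "\<forall>t. t \<notin> W \<longrightarrow> \<nu> t = 0"
    "\<forall>\<psi> k. continuous_on UNIV \<psi> \<longrightarrow> (\<forall>t. \<bar>\<psi> t\<bar> \<le> k) \<longrightarrow> (\<forall>t. t \<notin> W \<longrightarrow> \<psi> t = 0) \<longrightarrow>
        integrable lborel (\<lambda>t. of_real (\<psi> t) * \<nu> t)"
    "\<forall>\<psi> k u l. continuous_on UNIV \<psi> \<longrightarrow> (\<forall>t. \<bar>\<psi> t\<bar> \<le> k) \<longrightarrow> (\<forall>t. t \<notin> W \<longrightarrow> \<psi> t = 0) \<longrightarrow>
       (\<forall>x\<in>F. \<forall>y\<in>F. l \<le> Re (u * (b (y, x) * of_real (\<psi> (\<Phi> (y, x)))))) \<longrightarrow>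
       l \<le> Re (u * (LINT t|lborel. of_real (\<psi> t) * \<nu> t))"
    by (rule ex_continuous_density[OF assms(2,3,5,6,7) a C compact_imp_bounded[OF Fc] Fne z(3)[folded F_def] z(2) s_pos s_ad]) (rule that)
  define K where "K = \<Phi> ` (F \<times> F)"
  have Kc: "compact K" unfolding K_def
    by (intro compact_continuous_image compact_Times Fc continuous_on_subset[OF \<Phi>c]) auto
  have KW: "K \<subseteq> W" using assms(12) by (auto simp: K_def F_def)
  have Kne: "K \<noteq> {}" using Fne by (auto simp: K_def)
  have \<nu>0: "\<nu> t1 = 0" if t1: "t1 \<in> W - K" for t1
  proof (rule ccontr)
    assume nz: "\<nu> t1 \<noteq> 0"
    have O: "open (W - K)" by (intro open_Diff assms(5) compact_imp_closed Kc)
    have "continuous_on (W - K) (\<lambda>t. Re (cnj (\<nu> t1) * \<nu> t))" by (intro continuous_intros continuous_on_subset[OF \<nu>(1)]) auto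
    \<comment> \<open>On a ball around \<open>t1\<close> inside \<open>W - K\<close> the values of
      \<nu> keep a positive component along \<open>\<nu> t1\<close>, so that a tent on this ball has
      a positive pairing with \<nu> in that direction.\<close>
    then have "open ((W - K) \<inter> (\<lambda>t. Re (cnj (\<nu> t1) * \<nu> t)) -` {(cmod (\<nu> t1))\<^sup>2 / 2<..})"
      using O by (intro continuous_open_preimage) auto
    moreover have "t1 \<in> (W - K) \<inter> (\<lambda>t. Re (cnj (\<nu> t1) * \<nu> t)) -` {(cmod (\<nu> t1))\<^sup>2 / 2<..}"
      using t1 half_norm_square_less[OF nz] by (simp only: Int_iff vimage_eq greaterThan_iff)
    ultimately obtain r where r: "r > 0" "ball t1 r \<subseteq> (W - K) \<inter> (\<lambda>t. Re (cnj (\<nu> t1) * \<nu> t)) -` {(cmod (\<nu> t1))\<^sup>2 / 2<..}"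
      using open_contains_ball by blast
    define \<psi> where "\<psi> t = max 0 (r - dist t t1)" for t
    have \<psi>t: "test_continuous \<psi>" unfolding \<psi>_def by (rule test_continuous_tent)
    have \<psi>c: "continuous_on UNIV \<psi>" using \<psi>t by (simp add: test_continuous_def)
    have \<psi>b: "\<bar>\<psi> t\<bar> \<le> r" for t using r(1) by (simp add: \<psi>_def)
    have \<psi>0: "\<psi> t = 0" if "t \<notin> ball t1 r" for t using that by (simp add: \<psi>_def dist_commute)
    have \<psi>W: "\<psi> t = 0" if "t \<notin> W" for t using r(2) that by (intro \<psi>0) blast
    \<comment> \<open>The tent vanishes on \<open>K\<close>, so the integrand over
      \<open>F \<times> F\<close> is 0 and the lower bound applies with \<open>l = 0\<close>. Taking
      \<open>u = - cnj (\<nu> t1)\<close> turns it into the upper bound that contradicts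
      positivity.\<close>
    have "0 \<le> Re (- cnj (\<nu> t1) * (LINT t|lborel. of_real (\<psi> t) * \<nu> t))"
    proof (rule \<nu>(4)[rule_format, OF \<psi>c \<psi>b \<psi>W])
      fix x y assume "x \<in> F" "y \<in> F"
      then have "\<Phi> (y, x) \<in> K" by (auto simp: K_def)
      then have "\<psi> (\<Phi> (y, x)) = 0" using r(2) by (intro \<psi>0) blast
      then show "0 \<le> Re (- cnj (\<nu> t1) * (b (y, x) * of_real (\<psi> (\<Phi> (y, x)))))" by simp
    qed
    then have le: "Re (cnj (\<nu> t1) * (LINT t|lborel. of_real (\<psi> t) * \<nu> t)) \<le> 0" by simp
    have i: "integrable lborel (\<lambda>t. of_real (\<psi> t) * \<nu> t)" by (rule \<nu>(3)[rule_format, OF \<psi>c \<psi>b \<psi>W])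
    then have i': "integrable lborel (\<lambda>t. cnj (\<nu> t1) * (of_real (\<psi> t) * \<nu> t))" by (rule integrable_mult_right)
    have "(cmod (\<nu> t1))\<^sup>2 / 2 * (LINT t|lborel. \<psi> t) = (LINT t|lborel. (cmod (\<nu> t1))\<^sup>2 / 2 * \<psi> t)" by simp
    also have "\<dots> \<le> (LINT t|lborel. Re (cnj (\<nu> t1) * (of_real (\<psi> t) * \<nu> t)))"
    proof (rule integral_mono)
      show "integrable lborel (\<lambda>t. (cmod (\<nu> t1))\<^sup>2 / 2 * \<psi> t)" by (intro integrable_mult_right test_continuous_integrable \<psi>t)
      show "integrable lborel (\<lambda>t. Re (cnj (\<nu> t1) * (of_real (\<psi> t) * \<nu> t)))" by (rule integrable_Re[OF i'])
      show "(cmod (\<nu> t1))\<^sup>2 / 2 * \<psi> t \<le> Re (cnj (\<nu> t1) * (of_real (\<psi> t) * \<nu> t))" for t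
      proof (cases "t \<in> ball t1 r")
        case True
        then have "(cmod (\<nu> t1))\<^sup>2 / 2 < Re (cnj (\<nu> t1) * \<nu> t)" using r(2) by auto
        then have "(cmod (\<nu> t1))\<^sup>2 / 2 * \<psi> t \<le> Re (cnj (\<nu> t1) * \<nu> t) * \<psi> t"
          by (intro mult_right_mono) (auto simp: \<psi>_def)
        also have "\<dots> = Re (cnj (\<nu> t1) * (of_real (\<psi> t) * \<nu> t))" by (simp add: algebra_simps)
        finally show ?thesis .
      qed (simp add: \<psi>0)
    qed
    also have "\<dots> = Re (cnj (\<nu> t1) * (LINT t|lborel. of_real (\<psi> t) * \<nu> t))" using integral_Re[OF i'] by simp
    finally have "(cmod (\<nu> t1))\<^sup>2 / 2 * (LINT t|lborel. \<psi> t) \<le> 0" using le by linarith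
    moreover have "(LINT t|lborel. \<psi> t) > 0" unfolding \<psi>_def by (rule integral_tent_pos[OF r(1)])
    ultimately show False using nz by (simp add: mult_le_0_iff)
  qed
  have "\<exists>t0. \<nu> t0 \<noteq> 0"
  proof (rule ccontr)
    assume "\<nexists>t0. \<nu> t0 \<noteq> 0"
    then have z: "\<nu> t = 0" for t by blast
    obtain e where e: "e > 0" "(\<Union>t\<in>K. ball t e) \<subseteq> W"
      using compact_subset_open_imp_ball_epsilon_subset[OF Kc assms(5) KW] by blast
    \<comment> \<open>A cutoff equal to 1 on \<open>K\<close> and 0 off \<open>W\<close>. On
      \<open>F \<times> F\<close> it leaves \<open>b\<close> unchanged, so with
      \<open>u = cnj \<beta>\<close> the integral of \<open>\<psi> * \<nu>\<close> is bounded away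
      from zero.\<close>
    define \<psi> where "\<psi> t = max 0 (1 - infdist t K / e)" for t
    have "(cmod \<beta>)\<^sup>2 / 2 \<le> Re (cnj \<beta> * (LINT t|lborel. of_real (\<psi> t) * \<nu> t))"
    proof (rule \<nu>(4)[rule_format])
      show "continuous_on UNIV \<psi>" unfolding \<psi>_def using e by (intro continuous_intros) auto
      show "\<bar>\<psi> t\<bar> \<le> 1" for t using e by (simp add: \<psi>_def infdist_nonneg)
      show "\<psi> t = 0" if "t \<notin> W" for t
      proof -
        have "\<not> infdist t K < e"
        proof
          assume "infdist t K < e"
          then have "Inf (dist t ` K) < e" by (simp only: infdist_notempty[OF Kne])
          then obtain t' where "t' \<in> K" "dist t t' < e" using cInf_lessD[of "dist t ` K" e] Kne by blast
          then have "t \<in> W" using e(2) by (force simp: dist_commute)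
          then show False using that by simp
        qed
        then show ?thesis using e by (simp add: \<psi>_def)
      qed
      fix x y assume xy: "x \<in> F" "y \<in> F"
      then have "\<Phi> (y, x) \<in> K" by (auto simp: K_def)
      then have "\<psi> (\<Phi> (y, x)) = 1" by (simp add: \<psi>_def)
      then show "(cmod \<beta>)\<^sup>2 / 2 \<le> Re (cnj \<beta> * (b (y, x) * of_real (\<psi> (\<Phi> (y, x)))))"
        using \<rho>(2)[OF zE, of y x] xy by (simp add: F_def \<beta>_def)
    qed
    then show False using \<beta> by (simp add: z)
  qed
  then obtain t0 where t0: "\<nu> t0 \<noteq> 0" by blast
  define V where "V = W \<inter> \<nu> -` (- {0})"
  have "open V" unfolding V_def by (intro continuous_open_preimage \<nu>(1) assms(5)) auto
  moreover have "t0 \<in> V" using t0 \<nu>(2) by (auto simp: V_def)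
  moreover have "V \<subseteq> {\<Phi> (x, y) | x y. x \<in> E \<and> y \<in> E}"
  proof
    fix t assume "t \<in> V"
    then have "t \<in> K" using \<nu>0[of t] by (auto simp: V_def)
    then show "t \<in> {\<Phi> (x, y) | x y. x \<in> E \<and> y \<in> E}" by (auto simp: K_def F_def)
  qed
  ultimately have "t0 \<in> interior {\<Phi> (x, y) | x y. x \<in> E \<and> y \<in> E}" by (auto intro: interiorI)
  then show ?thesis by blast
qed

end
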